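(* Let $G$ be a compact, totally disconnected group, and let $\omega$ be a central weight on $\widehat G$. Then $A(G,\omega)$ is operator weakly amenable.
   Context: $\widehat G$ is the set of equivalence classes of continuous irreducible unitary representations of the compact group $G$; $d_\pi=\dim\pi$; $\widehat f(\pi)=\int_Gf(t)\overline\pi(t)\,dt$; $\|\cdot\|_1$ is the trace-class norm; $\operatorname{supp}\rho$ is the set of irreducible representations occurring in a finite-dimensional representation $\rho$. A central weight on $\widehat G$ is a function $\omega:\widehat G\to(\delta,\infty)$, some $\delta>0$, with $\omega(\sigma)\le\omega(\pi)\omega(\pi')$ whenever $\sigma\in\operatorname{supp}(\pi\otimes\pi')$. $A(G,\omega)=\{f\in C(G):\sum_\pi d_\pi\omega(\pi)\|\widehat f(\pi)\|_1<\infty\}$ with this sum as norm, pointwise multiplication, and the operator space structure for which $f\mapsto\phi$, $\widehat\phi(\pi)=\omega(\pi)\widehat f(\pi)$, is a complete isometry onto the Fourier algebra $A(G)=VN(G)_*$; it is a completely contractive Banach algebra. A completely contractive Banach algebra $A$ is operator weakly amenable if every completely bounded derivation $A\to A^*$ is inner. *)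

theory Defs
  imports "HOL-Probability.Probability_Measure" "Jordan_Normal_Form.Schur_Decomposition"
begin

text \<open>
  Groups are types of class \<open>topological_group_add\<close>.  The group law is written additively but is
  not assumed to be commutative (\<open>group_add\<close>); \<open>s + t\<close>, \<open>- s\<close>, \<open>0\<close> stand for $st$, $s^{-1}$, $e$.
\<close>

section \<open>The group and its Haar measure\<close>

definition totally_disconnected :: "'a::topological_space set \<Rightarrow> bool" where
  "totally_disconnected X \<longleftrightarrow> (\<forall>x\<in>X. connected_component_set X x = {x})"

text \<open>Normalized Haar measure of a compact group: the left-invariant regular Borel probability measure.\<close>

definition haar_probability :: "'a::topological_group_add measure \<Rightarrow> bool" where
  "haar_probability M \<longleftrightarrow>
     sets M = sets borel \<and> prob_space M \<and>
     (\<forall>s. distr M M (\<lambda>t. s + t) = M) \<and>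
     (\<forall>A\<in>sets M. emeasure M A = (INF U\<in>{U. open U \<and> A \<subseteq> U}. emeasure M U)) \<and>
     (\<forall>A\<in>sets M. emeasure M A = (SUP K\<in>{K. compact K \<and> K \<subseteq> A}. emeasure M K))"


section \<open>Matrices\<close>

definition unitary_mat :: "nat \<Rightarrow> complex mat \<Rightarrow> bool" where
  "unitary_mat d U \<longleftrightarrow> U \<in> carrier_mat d d \<and> mat_adjoint U * U = 1\<^sub>m d \<and> U * mat_adjoint U = 1\<^sub>m d"

definition kron :: "complex mat \<Rightarrow> complex mat \<Rightarrow> complex mat" where
  "kron A B = mat (dim_row A * dim_row B) (dim_col A * dim_col B)
     (\<lambda>(i, j). A $$ (i div dim_row B, j div dim_col B) * B $$ (i mod dim_row B, j mod dim_col B))"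

definition positive_semidef :: "nat \<Rightarrow> complex mat \<Rightarrow> bool" where
  "positive_semidef d P \<longleftrightarrow> P \<in> carrier_mat d d \<and> mat_adjoint P = P \<and>
     (\<forall>v\<in>carrier_vec d. 0 \<le> Re (scalar_prod (P *\<^sub>v v) (conjugate v)))"

text \<open>$|A| = (A^*A)^{1/2}$ and $\|A\|_1 = \mathrm{tr}\,|A|$.\<close>

definition mat_abs :: "complex mat \<Rightarrow> complex mat" where
  "mat_abs A = (THE P. positive_semidef (dim_col A) P \<and> P * P = mat_adjoint A * A)"

definition trace_norm :: "complex mat \<Rightarrow> real" where
  "trace_norm A = Re (\<Sum>i<dim_col A. mat_abs A $$ (i, i))"

text \<open>
  Operator norm on $\ell^2(I)$, $I$ finite, of a matrix with entries \<open>A i j\<close>, \<open>i, j \<in> I\<close>.  Taking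
  \<open>I = {..<n} \<times> {..<m}\<close> gives $M_n \otimes M_m = M_{nm}$ without flattening indices.
\<close>

definition idx_opnorm :: "'i set \<Rightarrow> ('i \<Rightarrow> 'i \<Rightarrow> complex) \<Rightarrow> ennreal" where
  "idx_opnorm I A =
     (SUP v\<in>{v. (\<Sum>i\<in>I. (cmod (v i))\<^sup>2) \<le> 1}.
        ennreal (sqrt (\<Sum>i\<in>I. (cmod (\<Sum>j\<in>I. A i j * v j))\<^sup>2)))"


section \<open>The dual of a compact group\<close>

text \<open>
  Representations are matrix valued: irreducible unitary representations of compact groups are
  finite-dimensional, hence unitarily equivalent to one on some \<open>\<complex>\<^sup>d\<close>.
\<close>

definition rep_dim :: "('a::topological_group_add \<Rightarrow> complex mat) \<Rightarrow> nat" where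
  "rep_dim \<pi> = dim_row (\<pi> 0)"

definition unitary_rep :: "('a::topological_group_add \<Rightarrow> complex mat) \<Rightarrow> bool" where
  "unitary_rep \<pi> \<longleftrightarrow>
     (\<forall>t. unitary_mat (rep_dim \<pi>) (\<pi> t)) \<and>
     (\<forall>s t. \<pi> (s + t) = \<pi> s * \<pi> t) \<and>
     (\<forall>i<rep_dim \<pi>. \<forall>j<rep_dim \<pi>. continuous_on UNIV (\<lambda>t. \<pi> t $$ (i, j)))"

definition irreducible_rep :: "('a::topological_group_add \<Rightarrow> complex mat) \<Rightarrow> bool" where
  "irreducible_rep \<pi> \<longleftrightarrow> 0 < rep_dim \<pi> \<and>
     (\<forall>W. VectorSpace.subspace class_ring W (module_vec TYPE(complex) (rep_dim \<pi>)) \<and>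
          (\<forall>t. \<forall>v\<in>W. \<pi> t *\<^sub>v v \<in> W) \<longrightarrow>
          W = {0\<^sub>v (rep_dim \<pi>)} \<or> W = carrier_vec (rep_dim \<pi>))"

definition irreps :: "('a::topological_group_add \<Rightarrow> complex mat) set" where
  "irreps = {\<pi>. unitary_rep \<pi> \<and> irreducible_rep \<pi>}"

definition equiv_rep :: "('a::topological_group_add \<Rightarrow> complex mat) \<Rightarrow> ('a \<Rightarrow> complex mat) \<Rightarrow> bool" where
  "equiv_rep \<pi> \<sigma> \<longleftrightarrow> rep_dim \<pi> = rep_dim \<sigma> \<and>
     (\<exists>U. unitary_mat (rep_dim \<pi>) U \<and> (\<forall>t. U * \<pi> t = \<sigma> t * U))"

definition dual_group :: "('a::topological_group_add \<Rightarrow> complex mat) set set" where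
  "dual_group = irreps // {(\<pi>, \<sigma>). \<pi> \<in> irreps \<and> \<sigma> \<in> irreps \<and> equiv_rep \<pi> \<sigma>}"

text \<open>A representative of a class; everything below is independent of its choice.\<close>

definition rep_of :: "('a::topological_group_add \<Rightarrow> complex mat) set \<Rightarrow> 'a \<Rightarrow> complex mat" where
  "rep_of P = (SOME \<pi>. \<pi> \<in> P)"

text \<open>\<open>\<sigma>\<close> occurs in \<open>\<rho>\<close>: it is equivalent, via an isometry \<open>V\<close>, to a subrepresentation of \<open>\<rho>\<close>.\<close>

definition occurs_in :: "('a::topological_group_add \<Rightarrow> complex mat) \<Rightarrow> ('a \<Rightarrow> complex mat) \<Rightarrow> bool" where
  "occurs_in \<sigma> \<rho> \<longleftrightarrow>
     (\<exists>V\<in>carrier_mat (rep_dim \<rho>) (rep_dim \<sigma>).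
        mat_adjoint V * V = 1\<^sub>m (rep_dim \<sigma>) \<and> (\<forall>t. \<rho> t * V = V * \<sigma> t))"

definition supp_rep ::
    "('a::topological_group_add \<Rightarrow> complex mat) \<Rightarrow> ('a \<Rightarrow> complex mat) set set" where
  "supp_rep \<rho> = {S\<in>dual_group. occurs_in (rep_of S) \<rho>}"

definition tensor_rep ::
    "('a::topological_group_add \<Rightarrow> complex mat) \<Rightarrow> ('a \<Rightarrow> complex mat) \<Rightarrow> 'a \<Rightarrow> complex mat" where
  "tensor_rep \<pi> \<pi>' = (\<lambda>t. kron (\<pi> t) (\<pi>' t))"

definition central_weight :: "(('a::topological_group_add \<Rightarrow> complex mat) set \<Rightarrow> real) \<Rightarrow> bool" where
  "central_weight \<omega> \<longleftrightarrow>
     (\<exists>\<delta>>0. \<forall>P\<in>dual_group. \<delta> < \<omega> P) \<and>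
     (\<forall>P\<in>dual_group. \<forall>P'\<in>dual_group. \<forall>S\<in>supp_rep (tensor_rep (rep_of P) (rep_of P')).
        \<omega> S \<le> \<omega> P * \<omega> P')"

text \<open>$\widehat f(\pi) = \int_G f(t)\,\overline\pi(t)\,dt$, with $\overline\pi$ the entrywise conjugate of $\pi$.\<close>

definition fourier ::
    "'a::topological_group_add measure \<Rightarrow> ('a \<Rightarrow> complex) \<Rightarrow> ('a \<Rightarrow> complex mat) set \<Rightarrow> complex mat" where
  "fourier M f P = mat (rep_dim (rep_of P)) (rep_dim (rep_of P))
     (\<lambda>(i, j). LINT t|M. f t * cnj (rep_of P t $$ (i, j)))"


section \<open>The group von Neumann algebra and the Fourier algebra\<close>

text \<open>
  \<open>L2 M\<close> consists of functions rather than almost-everywhere classes.  Operators on $L^2(G)$ are maps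
  on functions which are linear almost everywhere and bounded; such maps respect a.e. equality.
\<close>

definition L2 :: "'a measure \<Rightarrow> ('a \<Rightarrow> complex) set" where
  "L2 M = {\<xi> \<in> borel_measurable M. integrable M (\<lambda>t. (cmod (\<xi> t))\<^sup>2)}"

definition L2_inner :: "'a measure \<Rightarrow> ('a \<Rightarrow> complex) \<Rightarrow> ('a \<Rightarrow> complex) \<Rightarrow> complex" where
  "L2_inner M \<xi> \<eta> = (LINT t|M. \<xi> t * cnj (\<eta> t))"

definition L2_norm :: "'a measure \<Rightarrow> ('a \<Rightarrow> complex) \<Rightarrow> real" where
  "L2_norm M \<xi> = sqrt (LINT t|M. (cmod (\<xi> t))\<^sup>2)"

type_synonym 'a op = "('a \<Rightarrow> complex) \<Rightarrow> ('a \<Rightarrow> complex)"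

definition bounded_ops :: "'a measure \<Rightarrow> 'a op set" where
  "bounded_ops M = {T.
     (\<forall>\<xi>\<in>L2 M. T \<xi> \<in> L2 M) \<and>
     (\<forall>\<xi>\<in>L2 M. \<forall>\<eta>\<in>L2 M. \<forall>a b.
        AE t in M. T (\<lambda>x. a * \<xi> x + b * \<eta> x) t = a * T \<xi> t + b * T \<eta> t) \<and>
     (\<exists>C. \<forall>\<xi>\<in>L2 M. L2_norm M (T \<xi>) \<le> C * L2_norm M \<xi>)}"

definition left_regular :: "'a::topological_group_add \<Rightarrow> 'a op" where
  "left_regular s = (\<lambda>\<xi> t. \<xi> (- s + t))"

definition left_regular_span :: "'a::topological_group_add op set" where
  "left_regular_span = {(\<lambda>\<xi> t. \<Sum>s\<in>F. c s * left_regular s \<xi> t) | F c. finite F}"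

text \<open>The $\sigma$-weakly continuous functionals on $B(L^2(G))$.\<close>

definition normal_functionals :: "'a measure \<Rightarrow> ('a op \<Rightarrow> complex) set" where
  "normal_functionals M =
     {(\<lambda>T. \<Sum>k. L2_inner M (T (\<xi> k)) (\<eta> k)) | \<xi> \<eta> :: nat \<Rightarrow> 'a \<Rightarrow> complex.
        (\<forall>k. \<xi> k \<in> L2 M \<and> \<eta> k \<in> L2 M) \<and>
        summable (\<lambda>k. (L2_norm M (\<xi> k))\<^sup>2) \<and> summable (\<lambda>k. (L2_norm M (\<eta> k))\<^sup>2)}"

text \<open>The von Neumann algebra generated by the left regular representation: the $\sigma$-weak closure
  of its linear span.\<close>

definition VN :: "'a::topological_group_add measure \<Rightarrow> 'a op set" where
  "VN M = {T \<in> bounded_ops M.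
     \<forall>\<Phi> e. finite \<Phi> \<and> \<Phi> \<subseteq> normal_functionals M \<and> 0 < e \<longrightarrow>
       (\<exists>S\<in>left_regular_span. \<forall>\<phi>\<in>\<Phi>. cmod (\<phi> T - \<phi> S) < e)}"

text \<open>Norm of $M_k(B(L^2(G))) = B(L^2(G)^k)$.\<close>

definition op_mnorm :: "'a measure \<Rightarrow> nat \<Rightarrow> (nat \<Rightarrow> nat \<Rightarrow> 'a op) \<Rightarrow> ennreal" where
  "op_mnorm M k T =
     (SUP \<xi>\<in>{\<xi>. (\<forall>j<k. \<xi> j \<in> L2 M) \<and> (\<Sum>j<k. (L2_norm M (\<xi> j))\<^sup>2) \<le> 1}.
        ennreal (sqrt (\<Sum>i<k. (L2_norm M (\<lambda>t. \<Sum>j<k. T i j (\<xi> j) t))\<^sup>2)))"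

text \<open>
  $A(G) = VN(G)_*$: a normal functional $\varphi$ on $VN(G)$ is identified with the function
  $s \mapsto \varphi(\lambda(s))$, which determines it; \<open>fourier_pairing\<close> is the duality between
  $A(G)$ and $VN(G)$.
\<close>

definition fourier_algebra :: "'a::topological_group_add measure \<Rightarrow> ('a \<Rightarrow> complex) set" where
  "fourier_algebra M = {(\<lambda>s. \<phi> (left_regular s)) | \<phi>. \<phi> \<in> normal_functionals M}"

definition fourier_pairing :: "'a::topological_group_add measure \<Rightarrow> ('a \<Rightarrow> complex) \<Rightarrow> 'a op \<Rightarrow> complex" where
  "fourier_pairing M f T =
     (THE c. \<exists>\<phi>\<in>normal_functionals M. (\<forall>s. \<phi> (left_regular s) = f s) \<and> c = \<phi> T)"

text \<open>
  Throughout, an element of $M_n(X)$ is given by its entries \<open>x i j\<close>, \<open>i, j < n\<close>.  Predual operator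
  space structure: $M_n(VN(G)_*) \subseteq CB(VN(G), M_n)$.
\<close>

definition fourier_mnorm ::
    "'a::topological_group_add measure \<Rightarrow> nat \<Rightarrow> (nat \<Rightarrow> nat \<Rightarrow> 'a \<Rightarrow> complex) \<Rightarrow> ennreal" where
  "fourier_mnorm M n f =
     (SUP (k, T)\<in>{(k, T). (\<forall>i<k. \<forall>j<k. T i j \<in> VN M) \<and> op_mnorm M k T \<le> 1}.
        idx_opnorm ({..<n} \<times> {..<k}) (\<lambda>(i, p) (j, q). fourier_pairing M (f i j) (T p q)))"


section \<open>The Beurling-Fourier algebra\<close>

definition beurling_fourier ::
    "'a::topological_group_add measure \<Rightarrow> (('a \<Rightarrow> complex mat) set \<Rightarrow> real) \<Rightarrow> ('a \<Rightarrow> complex) set" where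
  "beurling_fourier M \<omega> = {f. continuous_on UNIV f \<and>
     (\<lambda>P. real (rep_dim (rep_of P)) * \<omega> P * trace_norm (fourier M f P)) summable_on dual_group}"

definition beurling_norm ::
    "'a::topological_group_add measure \<Rightarrow> (('a \<Rightarrow> complex mat) set \<Rightarrow> real) \<Rightarrow> ('a \<Rightarrow> complex) \<Rightarrow> real" where
  "beurling_norm M \<omega> f =
     (\<Sum>\<^sub>\<infinity>P\<in>dual_group. real (rep_dim (rep_of P)) * \<omega> P * trace_norm (fourier M f P))"

text \<open>The map $f \mapsto \varphi$ with $\widehat\varphi(\pi) = \omega(\pi)\widehat f(\pi)$ onto $A(G)$, and
  the operator space structure making it a complete isometry.\<close>

definition weight_map ::
    "'a::topological_group_add measure \<Rightarrow> (('a \<Rightarrow> complex mat) set \<Rightarrow> real) \<Rightarrow> ('a \<Rightarrow> complex) \<Rightarrow> 'a \<Rightarrow> complex" where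
  "weight_map M \<omega> f = (THE \<phi>. \<phi> \<in> fourier_algebra M \<and>
     (\<forall>P\<in>dual_group. fourier M \<phi> P = complex_of_real (\<omega> P) \<cdot>\<^sub>m fourier M f P))"

definition beurling_mnorm ::
    "'a::topological_group_add measure \<Rightarrow> (('a \<Rightarrow> complex mat) set \<Rightarrow> real) \<Rightarrow>
     nat \<Rightarrow> (nat \<Rightarrow> nat \<Rightarrow> 'a \<Rightarrow> complex) \<Rightarrow> ennreal" where
  "beurling_mnorm M \<omega> n f = fourier_mnorm M n (\<lambda>i j. weight_map M \<omega> (f i j))"


section \<open>Operator weak amenability\<close>

text \<open>
  For an algebra \<open>A\<close> of complex functions with pointwise operations, norm \<open>N\<close> and matrix norms
  \<open>MN n\<close> on $M_n(A)$.  Functionals on \<open>A\<close> are only considered on \<open>A\<close>; their values elsewhere are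
  irrelevant.
\<close>

definition dual_space :: "('x \<Rightarrow> complex) set \<Rightarrow> (('x \<Rightarrow> complex) \<Rightarrow> real) \<Rightarrow> (('x \<Rightarrow> complex) \<Rightarrow> complex) set" where
  "dual_space A N = {\<psi>.
     (\<forall>f\<in>A. \<forall>g\<in>A. \<forall>a b. \<psi> (\<lambda>x. a * f x + b * g x) = a * \<psi> f + b * \<psi> g) \<and>
     (\<exists>C. \<forall>f\<in>A. cmod (\<psi> f) \<le> C * N f)}"

text \<open>Dual operator space structure: $M_n(A^*) = CB(A, M_n)$.\<close>

definition dual_mnorm ::
    "('x \<Rightarrow> complex) set \<Rightarrow> (nat \<Rightarrow> (nat \<Rightarrow> nat \<Rightarrow> 'x \<Rightarrow> complex) \<Rightarrow> ennreal) \<Rightarrow>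
     nat \<Rightarrow> (nat \<Rightarrow> nat \<Rightarrow> ('x \<Rightarrow> complex) \<Rightarrow> complex) \<Rightarrow> ennreal" where
  "dual_mnorm A MN n \<psi> =
     (SUP (m, g)\<in>{(m, g). (\<forall>i<m. \<forall>j<m. g i j \<in> A) \<and> MN m g \<le> 1}.
        idx_opnorm ({..<n} \<times> {..<m}) (\<lambda>(i, p) (j, q). \<psi> i j (g p q)))"

text \<open>The bimodule actions $(f\cdot\psi)(h) = \psi(hf)$ and $(\psi\cdot f)(h) = \psi(fh)$ on $A^*$.\<close>

definition left_action :: "('x \<Rightarrow> complex) \<Rightarrow> (('x \<Rightarrow> complex) \<Rightarrow> complex) \<Rightarrow> ('x \<Rightarrow> complex) \<Rightarrow> complex" where
  "left_action f \<psi> = (\<lambda>h. \<psi> (\<lambda>x. h x * f x))"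

definition right_action :: "(('x \<Rightarrow> complex) \<Rightarrow> complex) \<Rightarrow> ('x \<Rightarrow> complex) \<Rightarrow> ('x \<Rightarrow> complex) \<Rightarrow> complex" where
  "right_action \<psi> f = (\<lambda>h. \<psi> (\<lambda>x. f x * h x))"

definition derivation ::
    "('x \<Rightarrow> complex) set \<Rightarrow> (('x \<Rightarrow> complex) \<Rightarrow> real) \<Rightarrow>
     (('x \<Rightarrow> complex) \<Rightarrow> ('x \<Rightarrow> complex) \<Rightarrow> complex) \<Rightarrow> bool" where
  "derivation A N D \<longleftrightarrow>
     (\<forall>f\<in>A. D f \<in> dual_space A N) \<and>
     (\<forall>f\<in>A. \<forall>g\<in>A. \<forall>a b. \<forall>h\<in>A. D (\<lambda>x. a * f x + b * g x) h = a * D f h + b * D g h) \<and>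
     (\<forall>f\<in>A. \<forall>g\<in>A. \<forall>h\<in>A. D (\<lambda>x. f x * g x) h = left_action f (D g) h + right_action (D f) g h)"

definition inner_derivation ::
    "('x \<Rightarrow> complex) set \<Rightarrow> (('x \<Rightarrow> complex) \<Rightarrow> real) \<Rightarrow>
     (('x \<Rightarrow> complex) \<Rightarrow> ('x \<Rightarrow> complex) \<Rightarrow> complex) \<Rightarrow> bool" where
  "inner_derivation A N D \<longleftrightarrow>
     (\<exists>\<psi>\<in>dual_space A N. \<forall>f\<in>A. \<forall>h\<in>A. D f h = left_action f \<psi> h - right_action \<psi> f h)"

definition completely_bounded ::
    "'v set \<Rightarrow> (nat \<Rightarrow> (nat \<Rightarrow> nat \<Rightarrow> 'v) \<Rightarrow> ennreal) \<Rightarrow>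
     (nat \<Rightarrow> (nat \<Rightarrow> nat \<Rightarrow> 'w) \<Rightarrow> ennreal) \<Rightarrow> ('v \<Rightarrow> 'w) \<Rightarrow> bool" where
  "completely_bounded A MN MN' D \<longleftrightarrow>
     (\<exists>C::real. \<forall>n f. (\<forall>i<n. \<forall>j<n. f i j \<in> A) \<longrightarrow> MN' n (\<lambda>i j. D (f i j)) \<le> ennreal C * MN n f)"

definition operator_weakly_amenable ::
    "('x \<Rightarrow> complex) set \<Rightarrow> (('x \<Rightarrow> complex) \<Rightarrow> real) \<Rightarrow>
     (nat \<Rightarrow> (nat \<Rightarrow> nat \<Rightarrow> 'x \<Rightarrow> complex) \<Rightarrow> ennreal) \<Rightarrow> bool" where
  "operator_weakly_amenable A N MN \<longleftrightarrow>
     (\<forall>D. derivation A N D \<and> completely_bounded A MN (dual_mnorm A MN) D \<longrightarrow> inner_derivation A N D)"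

end

theory Submission
  imports Defs "Jordan_Normal_Form.Spectral_Radius"
begin

text \<open>
  The algebra \<open>A(G, \<omega>)\<close> is commutative, so the only inner derivation into its dual is zero, and one has to
  show that a completely bounded derivation \<open>D\<close> vanishes.  A derivation of a commutative algebra kills every
  idempotent (\<open>derivation_zero_locally_constant\<close>).  When \<open>G\<close> is compact and totally disconnected, idempotents
  abound: the indicators of clopen sets belong to \<open>A(G, \<omega>)\<close>, and their span, the space of locally constant
  functions, is dense (\<open>locally_constant_dense\<close>).  Complete boundedness makes \<open>D\<close> norm continuous, so \<open>D\<close> vanishes
  altogether (\<open>completely_bounded_derivation_zero\<close>).

  The density rests on the fact that the matrix entries of irreducible representations span the locally
  constant functions.  On the one hand, the unitary group has no small subgroups while \<open>G\<close> has a basis of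
  neighbourhoods consisting of open subgroups; so a representation is trivial on an open subgroup and its
  entries are locally constant (\<open>unitary_rep_locally_constant\<close>).  On the other hand, a clopen set is a union of
  cosets of an open subgroup, its indicator is a sum of entries of the permutation representation on the
  cosets, and this representation decomposes into irreducible ones (\<open>clopen_indicator_trig\<close>).  Together with
  Schur orthogonality this makes the Fourier support of a clopen indicator finite, and the partial sums of
  Fourier series locally constant.

  The continuity of \<open>D\<close> is not immediate, because the matrix norms on \<open>A(G, \<omega>)\<close> are those of the predual of \<open>VN(G)\<close>,
  transported by a map \<open>f \<mapsto> \<phi>\<close> which is given only through Fourier coefficients.  One has to know that \<open>\<phi>\<close> exists and
  is unique, and that its norm as a functional is at most the norm of \<open>f\<close> (\<open>beurling_mnorm_scale_le\<close>).  For
  existence and the norm, each Fourier coefficient is written as a sum of rank one matrices that realizes its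
  trace norm (\<open>trace_norm_factorization\<close>), and the representation spaces are embedded isometrically into
  \<open>L\<^sup>2(G)\<close> (\<open>left_regular_embed\<close>); this displays \<open>\<phi>\<close> as a series of vector functionals
  (\<open>weight_map_normal_functional\<close>).  Uniqueness holds because elements of the Fourier algebra are continuous
  (\<open>fourier_algebra_continuous\<close>) and a continuous function is determined by its Fourier coefficients
  (\<open>fourier_injective\<close>).
\<close>

section \<open>Clopen sets, open subgroups and locally constant functions\<close>

text \<open>No connected set meets both \<open>K\<close> and the complement of \<open>U\<close>, and in a compact Hausdorff space two
  closed sets that no connected set joins are separated by a clopen set.\<close>

lemma clopen_between:
  fixes K U :: "'a::t2_space set"
  assumes "compact (UNIV :: 'a set)" "totally_disconnected (UNIV :: 'a set)"
    and "compact K" "open U" "K \<subseteq> U"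
  obtains C where "open C" "closed C" "K \<subseteq> C" "C \<subseteq> U"
proof -
  have single: "S \<subseteq> {x}" if "connected S" "x \<in> S" for S and x :: 'a
    using assms(2) that connected_component_maximal[of x S UNIV]
    unfolding totally_disconnected_def by auto
  have "separated_between euclidean K (- U)"
  proof (rule cut_wire_fence_theorem_gen)
    show "compact_space (euclidean :: 'a topology)"
      using assms(1) by (simp add: compact_space_def)
    have "\<exists>U. open U \<and> (\<exists>V. open V \<and> x \<in> U \<and> y \<in> V \<and> U \<inter> V = {})" if "x \<noteq> y" for x y :: 'a
      using hausdorff[OF that] by auto
    then show "Hausdorff_space (euclidean :: 'a topology) \<or> regular_space (euclidean :: 'a topology) \<or> normal_space (euclidean :: 'a topology)"
      by (intro disjI1) (simp add: Hausdorff_space_def disjnt_def)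
    show "compactin euclidean K" "closedin euclidean (- U)" using assms by auto
    show "disjnt S K \<or> disjnt S (- U)" if "connectedin euclidean S" for S
      using that single assms(5) unfolding disjnt_def connectedin_iff_connected by blast
  qed
  then obtain A B where AB: "open A" "open B" "A \<union> B = UNIV" "disjnt A B" "K \<subseteq> A" "- U \<subseteq> B"
    unfolding separated_between_def by auto
  then have "A = - B" unfolding disjnt_def by auto
  with AB show thesis by (intro that[of A]) auto
qed

definition add_subgroup :: "'a::group_add set \<Rightarrow> bool" where
  "add_subgroup N \<longleftrightarrow> 0 \<in> N \<and> (\<forall>x\<in>N. \<forall>y\<in>N. x + y \<in> N) \<and> (\<forall>x\<in>N. - x \<in> N)"

lemma open_left_translate:
  fixes N :: "'a::topological_group_add set"
  assumes "open N"
  shows "open {z. x + z \<in> N}"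
proof -
  have "continuous_on UNIV (\<lambda>z. x + z)" by (intro continuous_intros)
  from open_vimage[OF assms this] show ?thesis by (simp add: vimage_def)
qed

lemma open_of_translates:
  fixes S :: "'a::topological_group_add set"
  assumes "open N" "0 \<in> N" "\<And>x n. x \<in> S \<Longrightarrow> n \<in> N \<Longrightarrow> x + n \<in> S"
  shows "open S"
proof (subst open_subopen, intro ballI)
  fix x assume "x \<in> S"
  have "y \<in> S" if "- x + y \<in> N" for y
    using assms(3)[OF \<open>x \<in> S\<close> that] by (simp add: add.assoc[symmetric])
  then show "\<exists>T. open T \<and> x \<in> T \<and> T \<subseteq> S"
    using open_left_translate[OF assms(1), of "- x"] assms(2)
    by (intro exI[of _ "{z. - x + z \<in> N}"]) auto
qed

text \<open>The right stabilizer of \<open>C\<close> is a subgroup.  It contains a neighbourhood of \<open>0\<close>, by continuity of the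
  group operation and compactness of \<open>C\<close>, and is therefore open.\<close>

lemma clopen_stabilizer:
  fixes C :: "'a::{topological_group_add, t2_space} set"
  assumes "compact (UNIV :: 'a set)" "open C" "closed C"
  obtains N where "open N" "add_subgroup N" "\<And>c n. n \<in> N \<Longrightarrow> c + n \<in> C \<longleftrightarrow> c \<in> C"
proof -
  define N where "N = {n. \<forall>c. c + n \<in> C \<longleftrightarrow> c \<in> C}"
  have sub: "add_subgroup N"
    unfolding add_subgroup_def
  proof (intro conjI ballI)
    show "0 \<in> N" by (simp add: N_def)
    show "x + y \<in> N" if "x \<in> N" "y \<in> N" for x y
      using that unfolding N_def mem_Collect_eq add.assoc[symmetric] by blast
    show "- x \<in> N" if "x \<in> N" for x
    proof -
      have "c + - x \<in> C \<longleftrightarrow> c \<in> C" for c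
      proof -
        have "(c + - x) + x \<in> C \<longleftrightarrow> c + - x \<in> C" using that unfolding N_def by blast
        then show ?thesis by (simp add: add.assoc)
      qed
      then show ?thesis unfolding N_def by blast
    qed
  qed
  have "compact C" using closed_Int_compact[OF assms(3,1)] by simp
  have cont: "continuous_on UNIV (\<lambda>p::'a \<times> 'a. fst p + snd p)"
    by (intro continuous_on_add continuous_on_fst continuous_on_snd continuous_on_id)
  have opn: "open {p::'a\<times>'a. fst p + snd p \<in> C}"
    using open_vimage[OF assms(2) cont] by (simp add: vimage_def)
  have "\<exists>W. open W \<and> 0 \<in> W \<and> (\<forall>c\<in>C. \<forall>n\<in>W. c + n \<in> C)"
  proof -
    have "\<exists>A B. c \<in> A \<and> open A \<and> open B \<and> 0 \<in> B \<and> (\<forall>a\<in>A. \<forall>b\<in>B. a + b \<in> C)" if "c \<in> C" for c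
    proof -
      have "(c, 0) \<in> {p::'a\<times>'a. fst p + snd p \<in> C}" using that by simp
      from open_prod_elim[OF opn this]
      obtain A B where "open A" "open B" "(c, 0) \<in> A \<times> B" "A \<times> B \<subseteq> {p::'a\<times>'a. fst p + snd p \<in> C}"
        by blast
      then show ?thesis by (intro exI[of _ A] exI[of _ B]) auto
    qed
    then have "\<forall>c\<in>C. \<exists>A B. c \<in> A \<and> open A \<and> open B \<and> 0 \<in> B \<and> (\<forall>a\<in>A. \<forall>b\<in>B. a + b \<in> C)" by blast
    then obtain A where "\<forall>c\<in>C. \<exists>B. c \<in> A c \<and> open (A c) \<and> open B \<and> 0 \<in> B \<and> (\<forall>a\<in>A c. \<forall>b\<in>B. a + b \<in> C)"
      unfolding bchoice_iff by blast
    then obtain B where AB: "\<forall>c\<in>C. c \<in> A c \<and> open (A c) \<and> open (B c) \<and> 0 \<in> B c \<and> (\<forall>a\<in>A c. \<forall>b\<in>B c. a + b \<in> C)"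
      unfolding bchoice_iff by blast
    have opA: "\<And>c. c \<in> C \<Longrightarrow> open (A c)" and covA: "C \<subseteq> (\<Union>c\<in>C. A c)" using AB by auto
    obtain F where F: "F \<subseteq> C" "finite F" "C \<subseteq> (\<Union>c\<in>F. A c)"
      by (rule compactE_image[OF \<open>compact C\<close> opA covA]) auto
    show ?thesis
    proof (intro exI[of _ "\<Inter>c\<in>F. B c"] conjI ballI)
      show "open (\<Inter>c\<in>F. B c)" using F(1,2) AB by (intro open_INT) blast+
      show "0 \<in> (\<Inter>c\<in>F. B c)" using F(1) AB by blast
      show "c + n \<in> C" if "c \<in> C" "n \<in> (\<Inter>c\<in>F. B c)" for c n
      proof -
        obtain d where "d \<in> F" "c \<in> A d" using F(3) \<open>c \<in> C\<close> by blast
        with that(2) have "n \<in> B d" by blast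
        with AB F(1) \<open>d \<in> F\<close> \<open>c \<in> A d\<close> show ?thesis by blast
      qed
    qed
  qed
  then obtain W where W: "open W" "0 \<in> W" "\<forall>c\<in>C. \<forall>n\<in>W. c + n \<in> C" by blast
  \<comment> \<open>the elements of the symmetric set \<open>V\<close> move \<open>C\<close> into, and hence onto, itself\<close>
  define V where "V = W \<inter> ((\<lambda>x. - x) -` W)"
  have cu: "continuous_on UNIV (\<lambda>x::'a. - x)" by (intro continuous_on_minus continuous_on_id)
  have V: "open V" "0 \<in> V" unfolding V_def using W(1,2) open_vimage[OF W(1) cu] by auto
  have "V \<subseteq> N"
  proof
    fix n assume n: "n \<in> V"
    then have "n \<in> W" "- n \<in> W" by (auto simp: V_def)
    have "c + n \<in> C \<longleftrightarrow> c \<in> C" for c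
    proof
      assume "c + n \<in> C"
      with W(3) \<open>- n \<in> W\<close> have "c + n + - n \<in> C" by blast
      then show "c \<in> C" by (simp add: add.assoc)
    qed (use W(3) \<open>n \<in> W\<close> in blast)
    then show "n \<in> N" by (simp add: N_def)
  qed
  then have "open N"
    using sub by (intro open_of_translates[OF V]) (auto simp: add_subgroup_def)
  with sub show thesis by (intro that[of N]) (auto simp: N_def)
qed

text \<open>Van Dantzig's theorem: the stabilizer of a clopen set \<open>C\<close> containing \<open>0\<close> lies in \<open>C\<close>.\<close>

lemma open_subgroup_in_neighbourhood:
  fixes U :: "'a::{topological_group_add, t2_space} set"
  assumes "compact (UNIV :: 'a set)" "totally_disconnected (UNIV :: 'a set)" "open U" "0 \<in> U"
  obtains N where "open N" "add_subgroup N" "N \<subseteq> U"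
proof -
  obtain C where C: "open C" "closed C" "{0} \<subseteq> C" "C \<subseteq> U"
    using clopen_between[OF assms(1,2), of "{0}" U] assms(3,4) by auto
  obtain N where N: "open N" "add_subgroup N" "\<And>c n. n \<in> N \<Longrightarrow> c + n \<in> C \<longleftrightarrow> c \<in> C"
    using clopen_stabilizer[OF assms(1) C(1,2)] by metis
  have "N \<subseteq> C" using N(3)[of _ 0] C(3) by auto
  with N C show thesis by (intro that[of N]) auto
qed

definition locally_constant :: "('a::topological_space \<Rightarrow> 'b) \<Rightarrow> bool" where
  "locally_constant f \<longleftrightarrow> (\<forall>y. open (f -` {y}))"

lemma locally_constant_const: "locally_constant (\<lambda>_. c)"
  unfolding locally_constant_def by (simp add: vimage_def)

lemma locally_constant_vimage:
  assumes "locally_constant f" shows "open (f -` S)"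
proof -
  have "f -` S = (\<Union>y\<in>S. f -` {y})" by auto
  with assms show ?thesis by (auto simp: locally_constant_def)
qed

lemma locally_constant_binop:
  assumes "locally_constant f" "locally_constant g"
  shows "locally_constant (\<lambda>t. h (f t) (g t))"
  unfolding locally_constant_def
proof
  fix y
  have "(\<lambda>t. h (f t) (g t)) -` {y} = (\<Union>a. \<Union>b\<in>{b. h a b = y}. f -` {a} \<inter> g -` {b})" by auto
  moreover have "open (\<Union>a. \<Union>b\<in>{b. h a b = y}. f -` {a} \<inter> g -` {b})"
    using assms by (intro open_UN ballI open_Int) (auto simp: locally_constant_def)
  ultimately show "open ((\<lambda>t. h (f t) (g t)) -` {y})" by simp
qed

lemma locally_constant_sum:
  fixes f :: "'i \<Rightarrow> 'a::topological_space \<Rightarrow> complex"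
  assumes "\<And>i. i \<in> I \<Longrightarrow> locally_constant (f i)"
  shows "locally_constant (\<lambda>t. \<Sum>i\<in>I. f i t)"
  using assms
  by (induction I rule: infinite_finite_induct)
     (auto intro: locally_constant_const locally_constant_binop[where h="(+)"])

lemma locally_constant_continuous:
  assumes "locally_constant f" shows "continuous_on UNIV f"
  using locally_constant_vimage[OF assms] by (simp add: continuous_on_open_vimage)

lemma locally_constant_indicator:
  assumes "open C" "closed C"
  shows "locally_constant (indicator C :: 'a::topological_space \<Rightarrow> complex)"
  unfolding locally_constant_def
proof
  fix y :: complex
  have "(indicator C :: 'a \<Rightarrow> complex) -` {y} = (if y = 1 then C else if y = 0 then - C else {})"
    by (auto simp: indicator_def)
  with assms show "open ((indicator C :: 'a \<Rightarrow> complex) -` {y})" by auto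
qed

lemma locally_constant_subgroup:
  fixes f :: "'a::topological_group_add \<Rightarrow> 'b"
  assumes "open N" "0 \<in> N" "\<And>x n. n \<in> N \<Longrightarrow> f (x + n) = f x"
  shows "locally_constant f"
  unfolding locally_constant_def
  by (intro allI open_of_translates[OF assms(1,2)]) (auto simp: assms(3))

text \<open>By compactness a locally constant function has finite range, so it is a finite linear
  combination of indicators of clopen sets.\<close>

lemma locally_constant_induct [consumes 2, case_names indicator lin]:
  fixes f :: "'a::topological_space \<Rightarrow> complex"
  assumes "compact (UNIV :: 'a set)" "locally_constant f"
    and ind: "\<And>C. open C \<Longrightarrow> closed C \<Longrightarrow> P (indicator C)"
    and lin: "\<And>f g a b. locally_constant f \<Longrightarrow> locally_constant g \<Longrightarrow> P f \<Longrightarrow> P g \<Longrightarrow> P (\<lambda>t. a * f t + b * g t)"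
  shows "P f"
proof -
  have "finite (range f)"
  proof -
    obtain F where F: "F \<subseteq> range f" "finite F" "UNIV \<subseteq> (\<Union>y\<in>F. f -` {y})"
      using compactE_image[OF assms(1), of "range f" "\<lambda>y. f -` {y}"] assms(2)
      by (auto simp: locally_constant_def)
    then have "range f \<subseteq> F" by auto
    with F(2) show ?thesis by (rule rev_finite_subset)
  qed
  have clp: "open (f -` {y})" "closed (f -` {y})" for y
    using locally_constant_vimage[OF assms(2), of "{y}"] locally_constant_vimage[OF assms(2), of "- {y}"]
    by (auto simp: closed_def vimage_Compl)
  have "locally_constant (\<lambda>t. \<Sum>y\<in>Y. y * indicator (f -` {y}) t) \<and> P (\<lambda>t. \<Sum>y\<in>Y. y * indicator (f -` {y}) t)" if "finite Y" for Y
    using that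
  proof (induction Y)
    case empty
    have "(indicator {} :: 'a \<Rightarrow> complex) = (\<lambda>_. 0)" by auto
    with ind[of "{}"] show ?case by (auto intro: locally_constant_const)
  next
    case (insert y Y)
    have *: "(\<lambda>t. \<Sum>z\<in>insert y Y. z * indicator (f -` {z}) t)
      = (\<lambda>t. y * indicator (f -` {y}) t + 1 * (\<Sum>z\<in>Y. z * indicator (f -` {z}) t))"
      by (simp only: sum.insert[OF insert.hyps] mult_1)
    show ?case unfolding *
      using insert.IH ind[OF clp] locally_constant_indicator[OF clp]
      by (intro conjI lin locally_constant_binop[where h="\<lambda>u v. y * u + 1 * v"]) auto
  qed
  from this[OF \<open>finite (range f)\<close>] have "P (\<lambda>t. \<Sum>y\<in>range f. y * indicator (f -` {y}) t)" by blast
  moreover have "(\<Sum>y\<in>range f. y * indicator (f -` {y}) t) = f t" for t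
    using \<open>finite (range f)\<close> by (subst sum.remove[of _ "f t"]) (auto simp: indicator_def intro!: sum.neutral)
  ultimately show ?thesis by simp
qed

section \<open>Orthonormal families and the spectral theorem\<close>

text \<open>Vectors of \<open>\<complex>\<^sup>n\<close> are functions on the natural numbers of which only the values below \<open>n\<close> count; this
  leaves \<open>n\<close> a term, so that one can argue by induction on dimensions.  \<open>ip n\<close> is the inner product.\<close>

definition ip :: "nat \<Rightarrow> (nat \<Rightarrow> complex) \<Rightarrow> (nat \<Rightarrow> complex) \<Rightarrow> complex" where
  "ip n x y = (\<Sum>k<n. x k * cnj (y k))"

definition orthonormal :: "nat \<Rightarrow> nat \<Rightarrow> (nat \<Rightarrow> nat \<Rightarrow> complex) \<Rightarrow> bool" where
  "orthonormal n m u \<longleftrightarrow> (\<forall>i<m. \<forall>j<m. ip n (u i) (u j) = (if i = j then 1 else 0))"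

text \<open>The orthogonal projection onto the span of \<open>u 0, \<dots>, u (m - 1)\<close>, provided that these are orthonormal.\<close>

definition proj :: "nat \<Rightarrow> nat \<Rightarrow> (nat \<Rightarrow> nat \<Rightarrow> complex) \<Rightarrow> (nat \<Rightarrow> complex) \<Rightarrow> nat \<Rightarrow> complex" where
  "proj n m u x = (\<lambda>k. \<Sum>j<m. ip n x (u j) * u j k)"

lemma ip_diff_left: "ip n (\<lambda>k. x k - y k) z = ip n x z - ip n y z"
  by (simp add: ip_def left_diff_distrib sum_subtractf)

lemma ip_diff_right: "ip n z (\<lambda>k. x k - y k) = ip n z x - ip n z y"
  by (simp add: ip_def right_diff_distrib sum_subtractf)

lemma ip_scale_left: "ip n (\<lambda>k. c * x k) z = c * ip n x z"
  by (simp add: ip_def sum_distrib_left mult.assoc)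

lemma ip_scale_right: "ip n z (\<lambda>k. c * x k) = cnj c * ip n z x"
  by (simp add: ip_def sum_distrib_left mult_ac)

lemma ip_sum_left: "ip n (\<lambda>k. \<Sum>j\<in>J. c j * x j k) z = (\<Sum>j\<in>J. c j * ip n (x j) z)"
  unfolding ip_def sum_distrib_right sum_distrib_left by (subst sum.swap) (simp add: mult.assoc)

lemma ip_sum_right: "ip n z (\<lambda>k. \<Sum>j\<in>J. c j * x j k) = (\<Sum>j\<in>J. cnj (c j) * ip n z (x j))"
  unfolding ip_def sum_distrib_right sum_distrib_left cnj_sum by (subst sum.swap) (simp add: mult_ac)

lemma cnj_ip: "cnj (ip n x y) = ip n y x"
  by (simp add: ip_def mult.commute)

lemma ip_self: "ip n x x = of_real (\<Sum>k<n. (cmod (x k))\<^sup>2)"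
  by (simp add: ip_def complex_norm_square[symmetric])

lemma ip_self_eq_0: "ip n x x = 0 \<longleftrightarrow> (\<forall>k<n. x k = 0)"
  by (auto simp: ip_self of_real_eq_0_iff sum_nonneg_eq_0_iff simp del: of_real_sum)

lemma ip_cong: "(\<And>k. k < n \<Longrightarrow> x k = x' k) \<Longrightarrow> (\<And>k. k < n \<Longrightarrow> y k = y' k) \<Longrightarrow> ip n x y = ip n x' y'"
  by (simp add: ip_def)

lemma ip_unit: "k < n \<Longrightarrow> ip n (\<lambda>l. if l = k then 1 else 0) y = cnj (y k)"
  by (simp add: ip_def if_distrib[of "\<lambda>z. z * _"] cong: if_cong)

lemma residual_orthogonal:
  assumes "orthonormal n m u" "i < m"
  shows "ip n (\<lambda>k. x k - proj n m u x k) (u i) = 0"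
proof -
  have "ip n (proj n m u x) (u i) = (\<Sum>j<m. ip n x (u j) * ip n (u j) (u i))"
    by (simp add: proj_def ip_sum_left)
  also have "\<dots> = (\<Sum>j<m. if j = i then ip n x (u i) else 0)"
    using assms by (intro sum.cong) (auto simp: orthonormal_def)
  also have "\<dots> = ip n x (u i)" using assms(2) by simp
  finally show ?thesis by (simp add: ip_diff_left)
qed

text \<open>Pythagoras; it yields both the inequality of Bessel and the identity of Parseval.\<close>

lemma residual_norm:
  assumes "orthonormal n m u"
  shows "ip n (\<lambda>k. x k - proj n m u x k) (\<lambda>k. x k - proj n m u x k)
    = ip n x x - of_real (\<Sum>j<m. (cmod (ip n x (u j)))\<^sup>2)"
proof -
  let ?r = "\<lambda>k. x k - proj n m u x k"
  have "ip n ?r (proj n m u x) = (\<Sum>j<m. cnj (ip n x (u j)) * ip n ?r (u j))"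
    unfolding proj_def ip_sum_right ..
  also have "\<dots> = 0" using residual_orthogonal[OF assms] by simp
  finally have "ip n ?r ?r = ip n ?r x" by (simp add: ip_diff_right[of n ?r])
  also have "\<dots> = ip n x x - (\<Sum>j<m. ip n x (u j) * ip n (u j) x)"
    unfolding ip_diff_left by (simp add: proj_def ip_sum_left)
  also have "(\<Sum>j<m. ip n x (u j) * ip n (u j) x) = (\<Sum>j<m. of_real ((cmod (ip n x (u j)))\<^sup>2))"
    by (simp only: complex_norm_square cnj_ip)
  also have "\<dots> = of_real (\<Sum>j<m. (cmod (ip n x (u j)))\<^sup>2)" by (rule of_real_sum[symmetric])
  finally show ?thesis .
qed

text \<open>Bessel's inequality for the \<open>n\<close> standard unit vectors, summed up.\<close>

lemma orthonormal_card_le: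
  assumes "orthonormal n m u" shows "m \<le> n"
proof -
  have b: "(\<Sum>j<m. (cmod (u j k))\<^sup>2) \<le> 1" if "k < n" for k
  proof -
    let ?e = "\<lambda>l. if l = k then 1 else 0 :: complex"
    have "0 \<le> Re (ip n (\<lambda>k. ?e k - proj n m u ?e k) (\<lambda>k. ?e k - proj n m u ?e k))"
      by (simp add: ip_self sum_nonneg)
    also have "\<dots> = 1 - (\<Sum>j<m. (cmod (u j k))\<^sup>2)"
      unfolding residual_norm[OF assms] using that by (simp add: ip_unit)
    finally show ?thesis by simp
  qed
  have "real m = (\<Sum>j<m. Re (ip n (u j) (u j)))" using assms by (simp add: orthonormal_def)
  also have "\<dots> = (\<Sum>k<n. \<Sum>j<m. (cmod (u j k))\<^sup>2)" by (subst sum.swap) (simp add: ip_self)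
  also have "\<dots> \<le> (\<Sum>k<n. 1)" using b by (intro sum_mono) auto
  finally show ?thesis by simp
qed

lemma orthonormal_extend:
  assumes "orthonormal n m u" "k < n" "x k \<noteq> proj n m u x k"
  obtains c where "orthonormal n (Suc m) (u(m := (\<lambda>k. c * (x k - proj n m u x k))))"
proof -
  define r where "r = (\<lambda>k. x k - proj n m u x k)"
  define s where "s = (\<Sum>k<n. (cmod (r k))\<^sup>2)"
  have rr: "ip n r r = of_real s" by (simp only: ip_self s_def)
  have "ip n r r \<noteq> 0" unfolding ip_self_eq_0 using assms(2,3) by (auto simp: r_def)
  then have "s \<noteq> 0" unfolding rr by simp
  moreover have "s \<ge> 0" by (simp add: s_def sum_nonneg)
  ultimately have s: "s > 0" by simp
  define c where "c = complex_of_real (1 / sqrt s)"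
  have cc: "c * cnj c * of_real s = 1"
    using s by (simp add: c_def of_real_mult[symmetric] real_sqrt_mult_self del: of_real_mult of_real_divide)
  have cc': "c * (cnj c * of_real s) = 1" "cnj c * (c * of_real s) = 1"
    using cc by (simp_all add: mult_ac)
  have o: "ip n r (u i) = 0" "ip n (u i) r = 0" if "i < m" for i
  proof -
    show "ip n r (u i) = 0" using residual_orthogonal[OF assms(1) that] by (simp add: r_def)
    then show "ip n (u i) r = 0" using cnj_ip[of n r "u i"] by simp
  qed
  have "orthonormal n (Suc m) (u(m := (\<lambda>k. c * r k)))"
    using assms(1) o cc'
    by (auto simp: orthonormal_def less_Suc_eq ip_scale_left ip_scale_right rr)
  then show thesis using that by (simp add: r_def)
qed

text \<open>Take a longest orthonormal extension of \<open>u\<close> within \<open>S\<close>; by Gram--Schmidt it spans \<open>S\<close>.\<close>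

lemma orthonormal_spanning_extension:
  assumes "orthonormal n m u" "\<And>i. i < m \<Longrightarrow> S (u i)"
    and lin: "\<And>x y a b. S x \<Longrightarrow> S y \<Longrightarrow> S (\<lambda>k. a * x k + b * y k)"
  obtains m' v where "m \<le> m'" "orthonormal n m' v" "\<And>i. i < m \<Longrightarrow> v i = u i" "\<And>i. i < m' \<Longrightarrow> S (v i)"
    "\<And>x k. S x \<Longrightarrow> k < n \<Longrightarrow> x k = proj n m' v x k"
proof -
  define Q where "Q = (\<lambda>m'. m \<le> m' \<and> (\<exists>v. orthonormal n m' v \<and> (\<forall>i<m. v i = u i) \<and> (\<forall>i<m'. S (v i))))"
  have "Q m" using assms(1,2) by (auto simp: Q_def)
  moreover have bd: "\<forall>m'. Q m' \<longrightarrow> m' \<le> n" using orthonormal_card_le by (auto simp: Q_def)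
  ultimately obtain m' where m': "Q m'" "\<And>l. Q l \<Longrightarrow> l \<le> m'"
    using GreatestI_nat[of Q m n] Greatest_le_nat[of Q _ n] by blast
  then obtain v where v: "m \<le> m'" "orthonormal n m' v" "\<forall>i<m. v i = u i" "\<forall>i<m'. S (v i)"
    by (auto simp: Q_def)
  have "x k = proj n m' v x k" if "S x" and kn: "k < n" for x k
  proof (rule ccontr)
    assume ne: "x k \<noteq> proj n m' v x k"
    obtain c where c: "orthonormal n (Suc m') (v(m' := (\<lambda>k. c * (x k - proj n m' v x k))))"
      by (rule orthonormal_extend[OF v(2) kn ne])
    have partial: "S (\<lambda>k. x k - (\<Sum>j<l. ip n x (v j) * v j k))" if "l \<le> m'" for l
      using that
    proof (induction l)
      case (Suc l)
      then have *: "S (\<lambda>k. x k - (\<Sum>j<l. ip n x (v j) * v j k))" "S (v l)" using v(4) by auto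
      have "S (\<lambda>k. 1 * (x k - (\<Sum>j<l. ip n x (v j) * v j k)) + (- ip n x (v l)) * v l k)"
        by (rule lin[OF *])
      then show ?case by (simp add: algebra_simps)
    qed (use \<open>S x\<close> in simp)
    have "S (\<lambda>k. c * (x k - proj n m' v x k) + 0 * (x k - proj n m' v x k))"
      using partial[of m'] by (intro lin) (simp_all add: proj_def)
    then have "S (\<lambda>k. c * (x k - proj n m' v x k))" by simp
    with c v have "Q (Suc m')"
      unfolding Q_def by (intro conjI exI[of _ "v(m' := (\<lambda>k. c * (x k - proj n m' v x k)))"]) (auto simp: less_Suc_eq)
    with m'(2) show False by fastforce
  qed
  with v show thesis by (intro that[of m' v]) auto
qed

lemma parseval:
  assumes "orthonormal n m v" "\<And>k. k < n \<Longrightarrow> x k = proj n m v x k"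
  shows "ip n x x = of_real (\<Sum>j<m. (cmod (ip n x (v j)))\<^sup>2)"
proof -
  have "ip n (\<lambda>k. x k - proj n m v x k) (\<lambda>k. x k - proj n m v x k) = 0"
    using assms(2) by (simp add: ip_self_eq_0)
  with residual_norm[OF assms(1), of x] show ?thesis by simp
qed

text \<open>A maximal family spans everything; Parseval's identity for the standard unit vectors, summed up, shows
  that it has \<open>n\<close> members.\<close>

lemma orthonormal_completion:
  assumes "orthonormal n m u"
  obtains v where "orthonormal n n v" "\<And>i. i < m \<Longrightarrow> v i = u i" "\<And>x k. k < n \<Longrightarrow> x k = proj n n v x k"
proof -
  obtain m' v where v: "m \<le> m'" "orthonormal n m' v" "\<And>i. i < m \<Longrightarrow> v i = u i"
    "\<And>x k. k < n \<Longrightarrow> x k = proj n m' v x k"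
    by (rule orthonormal_spanning_extension[OF assms, of "\<lambda>_. True"]) auto
  have b: "(\<Sum>j<m'. (cmod (v j k))\<^sup>2) = 1" if "k < n" for k
  proof -
    let ?e = "\<lambda>l. if l = k then 1 else 0 :: complex"
    have "complex_of_real 1 = of_real (\<Sum>j<m'. (cmod (ip n ?e (v j)))\<^sup>2)"
      using parseval[OF v(2), of ?e] v(4)[of _ ?e] that by (simp add: ip_unit)
    then have "1 = (\<Sum>j<m'. (cmod (ip n ?e (v j)))\<^sup>2)" unfolding of_real_eq_iff .
    with that show ?thesis by (simp add: ip_unit)
  qed
  have "real m' = (\<Sum>j<m'. Re (ip n (v j) (v j)))" using v(2) by (simp add: orthonormal_def)
  also have "\<dots> = (\<Sum>k<n. \<Sum>j<m'. (cmod (v j k))\<^sup>2)" by (subst sum.swap) (simp add: ip_self)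
  also have "\<dots> = (\<Sum>k<n. 1)" using b by (intro sum.cong) auto
  finally have "m' = n" by simp
  with v show thesis by (intro that[of v]) auto
qed

text \<open>The product of a matrix with a vector, both given by their entries.\<close>

definition mv :: "nat \<Rightarrow> (nat \<Rightarrow> nat \<Rightarrow> complex) \<Rightarrow> (nat \<Rightarrow> complex) \<Rightarrow> nat \<Rightarrow> complex" where
  "mv n p x = (\<lambda>i. \<Sum>j<n. p i j * x j)"

lemma mv_scale: "mv n p (\<lambda>k. c * x k) = (\<lambda>i. c * mv n p x i)"
  by (simp add: mv_def sum_distrib_left mult_ac)

lemma mv_sum: "mv n p (\<lambda>k. \<Sum>j\<in>J. c j * x j k) = (\<lambda>i. \<Sum>j\<in>J. c j * mv n p (x j) i)"
  unfolding mv_def sum_distrib_left by (intro ext, subst sum.swap) (simp add: mult_ac)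

lemma mv_diff: "mv n p (\<lambda>k. x k - y k) = (\<lambda>i. mv n p x i - mv n p y i)"
  by (simp add: mv_def right_diff_distrib sum_subtractf)

lemma mv_cong: "(\<And>k. k < n \<Longrightarrow> x k = y k) \<Longrightarrow> mv n p x = mv n p y"
  by (simp add: mv_def)

lemma ip_mv: "ip n (mv n p x) y = ip n x (mv n (\<lambda>i j. cnj (p j i)) y)"
  unfolding ip_def mv_def sum_distrib_left sum_distrib_right cnj_sum
  by (subst sum.swap) (simp add: mult_ac)

lemma ip_mv_hermitian:
  assumes "\<And>i j. i < n \<Longrightarrow> j < n \<Longrightarrow> p i j = cnj (p j i)"
  shows "ip n (mv n p x) y = ip n x (mv n p y)"
proof -
  have "mv n (\<lambda>i j. cnj (p j i)) y i = mv n p y i" if "i < n" for i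
    unfolding mv_def
  proof (rule sum.cong)
    fix j assume "j \<in> {..<n}"
    then have "p i j = cnj (p j i)" by (intro assms that) simp
    then show "cnj (p j i) * y j = p i j * y j" by (rule arg_cong[symmetric])
  qed simp
  then show ?thesis unfolding ip_mv by (intro ip_cong) auto
qed

text \<open>Take a longest orthonormal family of eigenvectors.  Its orthogonal complement is invariant, so an
  eigenvector of the compression to a nonzero complement would make the family longer.\<close>

lemma hermitian_spectral:
  assumes herm: "\<And>i j. i < n \<Longrightarrow> j < n \<Longrightarrow> p i j = cnj (p j i)"
  obtains u \<mu> where "orthonormal n n u" "\<And>x k. k < n \<Longrightarrow> x k = proj n n u x k"
    "\<And>i k. i < n \<Longrightarrow> k < n \<Longrightarrow> mv n p (u i) k = complex_of_real (\<mu> i) * u i k"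
proof -
  have sa: "ip n (mv n p x) y = ip n x (mv n p y)" for x y by (rule ip_mv_hermitian[OF herm])
  define Q where "Q = (\<lambda>m. \<exists>u \<mu>. orthonormal n m u \<and> (\<forall>i<m. \<forall>k<n. mv n p (u i) k = complex_of_real (\<mu> i) * u i k))"
  have "Q 0" by (auto simp: Q_def orthonormal_def)
  moreover have bd: "\<forall>m'. Q m' \<longrightarrow> m' \<le> n" using orthonormal_card_le by (auto simp: Q_def)
  ultimately obtain m where m: "Q m" "\<And>l. Q l \<Longrightarrow> l \<le> m"
    using GreatestI_nat[of Q 0 n] Greatest_le_nat[of Q _ n] by blast
  then have "\<exists>u \<mu>. orthonormal n m u \<and> (\<forall>i<m. \<forall>k<n. mv n p (u i) k = complex_of_real (\<mu> i) * u i k)"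
    unfolding Q_def by blast
  then obtain u \<mu> where u: "orthonormal n m u"
    and ev': "\<forall>i<m. \<forall>k<n. mv n p (u i) k = complex_of_real (\<mu> i) * u i k"
    by blast
  have ev: "mv n p (u i) k = complex_of_real (\<mu> i) * u i k" if "i < m" "k < n" for i k
    using ev' that by blast
  have "m \<le> n" using bd m(1) by blast
  obtain v where v: "orthonormal n n v" "\<And>i. i < m \<Longrightarrow> v i = u i" "\<And>x k. k < n \<Longrightarrow> x k = proj n n v x k"
    using orthonormal_completion[OF u] by blast
  have "m = n"
  proof (rule ccontr)
    assume "m \<noteq> n"
    with \<open>m \<le> n\<close> have mn: "m < n" by simp
    \<comment> \<open>the compression of \<open>p\<close> to the orthogonal complement of \<open>u 0, \<dots>, u (m - 1)\<close>\<close>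
    define B where "B = mat (n - m) (n - m) (\<lambda>(i, j). ip n (mv n p (v (m + j))) (v (m + i)))"
    have B: "B \<in> carrier_mat (n - m) (n - m)" by (simp add: B_def)
    obtain l where "eigenvalue B l" using spectrum_non_empty[OF B] mn by (auto simp: spectrum_def)
    then obtain w where w: "w \<in> carrier_vec (n - m)" "w \<noteq> 0\<^sub>v (n - m)" "B *\<^sub>v w = l \<cdot>\<^sub>v w"
      using B by (auto simp: eigenvalue_def eigenvector_def)
    define x where "x = (\<lambda>k. \<Sum>j<n-m. vec_index w j * v (m + j) k)"
    have ipx: "ip n x (v i) = (if i < m then 0 else vec_index w (i - m))" if "i < n" for i
    proof -
      have "ip n x (v i) = (\<Sum>j<n-m. vec_index w j * ip n (v (m + j)) (v i))" by (simp add: x_def ip_sum_left)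
      also have "\<dots> = (\<Sum>j<n-m. if m + j = i then vec_index w j else 0)"
        using v(1) that by (intro sum.cong) (auto simp: orthonormal_def)
      also have "\<dots> = (if i < m then 0 else vec_index w (i - m))"
      proof (cases "i < m")
        case False
        then have "(\<Sum>j<n-m. if m + j = i then vec_index w j else 0) = (\<Sum>j<n-m. if j = i - m then vec_index w j else 0)"
          by (intro sum.cong) auto
        with False that show ?thesis by simp
      qed (auto intro!: sum.neutral)
      finally show ?thesis .
    qed
    have ipPx: "ip n (mv n p x) (v i) = l * ip n x (v i)" if "i < n" for i
    proof (cases "i < m")
      case True
      have "ip n (mv n p x) (v i) = ip n x (mv n p (u i))" using v(2)[OF True] by (simp add: sa)
      also have "\<dots> = ip n x (\<lambda>k. complex_of_real (\<mu> i) * u i k)" using ev[OF True] by (intro ip_cong) auto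
      also have "\<dots> = complex_of_real (\<mu> i) * ip n x (v i)" using v(2)[OF True] by (simp add: ip_scale_right)
      finally show ?thesis using ipx[OF that] True by simp
    next
      case False
      then have im: "i - m < n - m" using that by auto
      have "ip n (mv n p x) (v i) = (\<Sum>j<n-m. vec_index w j * ip n (mv n p (v (m + j))) (v i))"
        unfolding x_def mv_sum ip_sum_left ..
      also have "\<dots> = vec_index (B *\<^sub>v w) (i - m)"
        using im w(1) False by (auto simp: B_def scalar_prod_def lessThan_atLeast0 mult.commute intro!: sum.cong)
      also have "\<dots> = l * vec_index w (i - m)" using w im by simp
      finally show ?thesis using ipx[OF that] False by simp
    qed
    have Px: "mv n p x k = l * x k" if "k < n" for k
    proof -
      have "mv n p x k = proj n n v (mv n p x) k" by (rule v(3)[OF that])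
      also have "\<dots> = l * proj n n v x k" by (simp add: proj_def ipPx sum_distrib_left mult.assoc)
      also have "proj n n v x k = x k" using v(3)[OF that, of x] by simp
      finally show ?thesis .
    qed
    obtain j where j: "j < n - m" "vec_index w j \<noteq> 0" using w(1,2)
      by (metis carrier_vecD eq_vecI index_zero_vec(1) index_zero_vec(2))
    have x0: "ip n x x \<noteq> 0"
    proof
      assume "ip n x x = 0"
      then have "\<forall>k<n. x k = 0" by (simp add: ip_self_eq_0)
      then have "ip n x (v (m + j)) = 0" by (simp add: ip_def)
      moreover have "m + j < n" using j(1) by simp
      ultimately show False using ipx[of "m + j"] j(2) by simp
    qed
    have "ip n (mv n p x) x = ip n (\<lambda>k. l * x k) x" using Px by (intro ip_cong) auto
    then have "ip n (mv n p x) x = l * ip n x x" by (simp add: ip_scale_left)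
    moreover have "ip n x (mv n p x) = ip n x (\<lambda>k. l * x k)" using Px by (intro ip_cong) auto
    then have "ip n x (mv n p x) = cnj l * ip n x x" by (simp add: ip_scale_right)
    ultimately have "l = cnj l" using sa[where x=x and y=x] x0 by simp
    then have lr: "l = complex_of_real (Re l)" by (metis Reals_cnj_iff of_real_Re)
    have xu: "ip n x (u i) = 0" if "i < m" for i using ipx[of i] v(2)[OF that] that mn by simp
    have pr0: "proj n m u x = (\<lambda>k. 0)" by (auto simp: proj_def xu intro!: ext sum.neutral)
    obtain k where k: "k < n" "x k \<noteq> 0" using x0 by (auto simp: ip_self_eq_0)
    obtain c where c: "orthonormal n (Suc m) (u(m := (\<lambda>k. c * (x k - proj n m u x k))))"
      using orthonormal_extend[OF u k(1), of x] k(2) pr0 by auto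
    have "Q (Suc m)"
      unfolding Q_def
    proof (intro exI conjI allI impI)
      show "orthonormal n (Suc m) (u(m := (\<lambda>k. c * x k)))" using c by (simp add: pr0)
      fix i k assume "i < Suc m" "k < n"
      then show "mv n p ((u(m := \<lambda>k. c * x k)) i) k = complex_of_real ((\<mu>(m := Re l)) i) * (u(m := \<lambda>k. c * x k)) i k"
        using ev[of i k] Px[of k] lr by (auto simp: less_Suc_eq mv_scale mult_ac)
    qed
    with m(2) show False by fastforce
  qed
  with v ev show thesis by (intro that[of v \<mu>]) auto
qed

section \<open>Trace norm\<close>

abbreviation ent :: "complex mat \<Rightarrow> nat \<Rightarrow> nat \<Rightarrow> complex" where
  "ent A \<equiv> \<lambda>i j. A $$ (i, j)"

lemma mat_adjoint_carrier: "A \<in> carrier_mat n m \<Longrightarrow> mat_adjoint A \<in> carrier_mat m n"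
  by (auto simp: mat_adjoint_def)

lemma mat_adjoint_index:
  "A \<in> carrier_mat n m \<Longrightarrow> i < m \<Longrightarrow> j < n \<Longrightarrow> mat_adjoint A $$ (i, j) = cnj (A $$ (j, i))"
  by (auto simp: mat_adjoint_def mat_of_rows_index)

lemma mat_mult_index:
  "A \<in> carrier_mat n m \<Longrightarrow> B \<in> carrier_mat m p \<Longrightarrow> i < n \<Longrightarrow> j < p \<Longrightarrow>
    (A * B) $$ (i, j) = (\<Sum>k<m. A $$ (i, k) * B $$ (k, j))"
  by (auto simp: scalar_prod_def lessThan_atLeast0 intro!: sum.cong)

lemma mv_ent: "A \<in> carrier_mat n m \<Longrightarrow> v \<in> carrier_vec m \<Longrightarrow> i < n \<Longrightarrow> vec_index (A *\<^sub>v v) i = mv m (ent A) (vec_index v) i"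
  by (auto simp: scalar_prod_def mv_def lessThan_atLeast0 intro!: sum.cong)

lemma mv_mult:
  assumes "A \<in> carrier_mat d d" "B \<in> carrier_mat d d" "i < d"
  shows "mv d (ent (A * B)) x i = mv d (ent A) (mv d (ent B) x) i"
proof -
  have "mv d (ent (A * B)) x i = (\<Sum>j<d. (\<Sum>k<d. A $$ (i, k) * B $$ (k, j)) * x j)"
    unfolding mv_def using mat_mult_index[OF assms(1,2,3)] by (intro sum.cong) (simp_all del: index_mult_mat)
  also have "\<dots> = mv d (ent A) (mv d (ent B) x) i"
    unfolding mv_def sum_distrib_left sum_distrib_right by (subst sum.swap) (simp add: mult.assoc)
  finally show ?thesis .
qed

lemma mat_eq_mv:
  assumes "A \<in> carrier_mat d d" "B \<in> carrier_mat d d"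
    and "\<And>x i. i < d \<Longrightarrow> mv d (ent A) x i = mv d (ent B) x i"
  shows "A = B"
proof (rule eq_matI)
  fix i j assume "i < dim_row B" "j < dim_col B"
  then have ij: "i < d" "j < d" using assms(2) by auto
  have "mv d (ent C) (\<lambda>l. if l = j then 1 else 0) i = C $$ (i, j)" for C
    using ij by (simp add: mv_def if_distrib[of "\<lambda>z. _ * z"] cong: if_cong)
  with assms(3)[OF ij(1), of "\<lambda>l. if l = j then 1 else 0"] show "A $$ (i, j) = B $$ (i, j)" by simp
qed (use assms in auto)

lemma positive_semidef_iff:
  assumes P: "P \<in> carrier_mat d d"
  shows "positive_semidef d P \<longleftrightarrow>
    (\<forall>i<d. \<forall>j<d. P $$ (i, j) = cnj (P $$ (j, i))) \<and> (\<forall>x. 0 \<le> Re (ip d (mv d (ent P) x) x))"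
proof -
  have "mat_adjoint P = P \<longleftrightarrow> (\<forall>i<d. \<forall>j<d. P $$ (i, j) = cnj (P $$ (j, i)))"
  proof
    assume e: "mat_adjoint P = P"
    show "\<forall>i<d. \<forall>j<d. P $$ (i, j) = cnj (P $$ (j, i))"
      using mat_adjoint_index[OF P] unfolding e by blast
  next
    assume h: "\<forall>i<d. \<forall>j<d. P $$ (i, j) = cnj (P $$ (j, i))"
    show "mat_adjoint P = P"
    proof (rule eq_matI)
      fix i j assume "i < dim_row P" "j < dim_col P"
      then have "i < d" "j < d" using P by auto
      then show "mat_adjoint P $$ (i, j) = P $$ (i, j)"
        using mat_adjoint_index[OF P] h by metis
    qed (use P mat_adjoint_carrier[OF P] in auto)
  qed
  moreover have sp: "scalar_prod (P *\<^sub>v v) (conjugate v) = ip d (mv d (ent P) (vec_index v)) (vec_index v)"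
    if "v \<in> carrier_vec d" for v
    using that P mv_ent[OF P that] unfolding scalar_prod_def ip_def
    by (auto simp: lessThan_atLeast0 intro!: sum.cong)
  moreover have "(\<forall>v\<in>carrier_vec d. 0 \<le> Re (scalar_prod (P *\<^sub>v v) (conjugate v))) \<longleftrightarrow>
    (\<forall>x. 0 \<le> Re (ip d (mv d (ent P) x) x))"
  proof (intro iffI allI ballI)
    fix x assume *: "\<forall>v\<in>carrier_vec d. 0 \<le> Re (scalar_prod (P *\<^sub>v v) (conjugate v))"
    have "ip d (mv d (ent P) (vec_index (vec d x))) (vec_index (vec d x)) = ip d (mv d (ent P) x) x"
      using mv_cong[of d "vec_index (vec d x)" x "ent P"] by (intro ip_cong) auto
    with * sp[of "vec d x"] show "0 \<le> Re (ip d (mv d (ent P) x) x)" by (metis vec_carrier)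
  qed (simp add: sp)
  ultimately show ?thesis using P unfolding positive_semidef_def by blast
qed

text \<open>The vector \<open>y = q u - m u\<close> satisfies \<open>q y = - m y\<close>.  For \<open>m > 0\<close> positivity forces \<open>y = 0\<close>, and for \<open>m = 0\<close> one
  has \<open>\<parallel>y\<parallel>\<^sup>2 = \<langle>u, q y\<rangle> = 0\<close>.  This is why a positive square root is unique.\<close>

lemma positive_sqrt_eigenvector:
  assumes herm: "\<And>i j. i < d \<Longrightarrow> j < d \<Longrightarrow> q i j = cnj (q j i)"
    and pos: "\<And>x. 0 \<le> Re (ip d (mv d q x) x)"
    and sq: "\<And>i. i < d \<Longrightarrow> mv d q (mv d q u) i = complex_of_real (m\<^sup>2) * u i"
    and m: "0 \<le> m" and i: "i < d"
  shows "mv d q u i = complex_of_real m * u i"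
proof -
  define y where "y = (\<lambda>i. mv d q u i - complex_of_real m * u i)"
  have qy: "mv d q y i = - complex_of_real m * y i" if "i < d" for i
    unfolding y_def mv_diff mv_scale sq[OF that] by (simp add: algebra_simps power2_eq_square)
  have "ip d (mv d q y) y = ip d (\<lambda>i. - complex_of_real m * y i) y" using qy by (intro ip_cong) auto
  also have "\<dots> = - complex_of_real m * ip d y y" by (rule ip_scale_left)
  finally have e: "ip d (mv d q y) y = - complex_of_real m * ip d y y" .
  have "ip d y y = 0"
  proof (cases "m = 0")
    case True
    have "ip d y y = ip d (mv d q u) y" by (simp add: y_def True)
    also have "\<dots> = ip d u (mv d q y)" by (rule ip_mv_hermitian[OF herm])
    also have "\<dots> = ip d u (\<lambda>k. 0)" using qy True by (intro ip_cong) auto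
    finally show ?thesis by (simp add: ip_def)
  next
    case False
    have "Re (ip d (mv d q y) y) = - m * (\<Sum>k<d. (cmod (y k))\<^sup>2)"
      unfolding e ip_self by (simp del: of_real_sum)
    with pos[of y] have "m * (\<Sum>k<d. (cmod (y k))\<^sup>2) \<le> 0" by simp
    moreover have "0 \<le> (\<Sum>k<d. (cmod (y k))\<^sup>2)" by (simp add: sum_nonneg)
    ultimately have "(\<Sum>k<d. (cmod (y k))\<^sup>2) = 0" using m False by (simp add: mult_le_0_iff)
    then show ?thesis unfolding ip_self by (simp only: of_real_0)
  qed
  with i show ?thesis by (simp add: ip_self_eq_0 y_def)
qed

text \<open>For an orthonormal eigenbasis \<open>u\<^sub>j\<close> of \<open>F\<^sup>* F\<close>, the norms \<open>\<parallel>F u\<^sub>j\<parallel>\<close> are the eigenvalues \<open>\<mu>\<^sub>j\<close> of \<open>|F|\<close>, and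
  \<open>F = \<Sum>\<^sub>j (F u\<^sub>j) u\<^sub>j\<^sup>*\<close>.  Distributing \<open>\<mu>\<^sub>j\<close> evenly between the two factors gives a sum of rank one matrices
  that realizes the trace norm; such sums are what a functional on the group algebra is made of.\<close>

lemma trace_norm_factorization:
  assumes F: "F \<in> carrier_mat d d"
  obtains x y \<mu> where "\<And>j. j < d \<Longrightarrow> 0 \<le> \<mu> j"
    "\<And>j. j < d \<Longrightarrow> (\<Sum>k<d. (cmod (x j k))\<^sup>2) = \<mu> j"
    "\<And>j. j < d \<Longrightarrow> (\<Sum>k<d. (cmod (y j k))\<^sup>2) = \<mu> j"
    "\<And>k l. k < d \<Longrightarrow> l < d \<Longrightarrow> F $$ (k, l) = (\<Sum>j<d. y j k * x j l)"
    "trace_norm F = (\<Sum>j<d. \<mu> j)"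
proof -
  let ?G = "mat_adjoint F * F"
  note Fa = mat_adjoint_carrier[OF F]
  have G: "?G \<in> carrier_mat d d" using F Fa by auto
  have Gij: "?G $$ (i, j) = (\<Sum>k<d. cnj (F $$ (k, i)) * F $$ (k, j))" if "i < d" "j < d" for i j
    using that mat_mult_index[OF Fa F] mat_adjoint_index[OF F] by simp
  have herm: "ent ?G i j = cnj (ent ?G j i)" if "i < d" "j < d" for i j
    using that by (simp add: Gij mult.commute)
  have Gip: "ip d (mv d (ent ?G) v) v = ip d (mv d (ent F) v) (mv d (ent F) v)" for v
  proof -
    have "mv d (ent ?G) v i = mv d (\<lambda>i j. cnj (ent F j i)) (mv d (ent F) v) i" if "i < d" for i
    proof -
      have "mv d (ent ?G) v i = mv d (ent (mat_adjoint F)) (mv d (ent F) v) i" by (rule mv_mult[OF Fa F that])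
      also have "\<dots> = mv d (\<lambda>i j. cnj (ent F j i)) (mv d (ent F) v) i"
        unfolding mv_def[of d _ "mv d (ent F) v"] using mat_adjoint_index[OF F that] by (intro sum.cong) auto
      finally show ?thesis .
    qed
    then have "ip d v (mv d (ent ?G) v) = ip d (mv d (ent F) v) (mv d (ent F) v)"
      unfolding ip_mv[of d "ent F" v "mv d (ent F) v"] by (intro ip_cong) auto
    moreover have "ip d (mv d (ent ?G) v) v = ip d v (mv d (ent ?G) v)" by (rule ip_mv_hermitian[OF herm])
    ultimately show ?thesis by simp
  qed
  obtain u \<nu> where u: "orthonormal d d u" and ex: "\<And>x k. k < d \<Longrightarrow> x k = proj d d u x k"
    and ev: "\<And>i k. i < d \<Longrightarrow> k < d \<Longrightarrow> mv d (ent ?G) (u i) k = complex_of_real (\<nu> i) * u i k"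
    using hermitian_spectral[of d "ent ?G"] herm by blast
  have uu: "ip d (u i) (u i) = 1" if "i < d" for i using u that by (simp add: orthonormal_def)
  have uu': "(\<Sum>k<d. (cmod (u i k))\<^sup>2) = 1" if "i < d" for i
    using uu[OF that] unfolding ip_self by (simp only: of_real_eq_1_iff)
  have \<nu>: "\<nu> i = (\<Sum>k<d. (cmod (mv d (ent F) (u i) k))\<^sup>2)" if "i < d" for i
  proof -
    have "complex_of_real (\<nu> i) = complex_of_real (\<nu> i) * ip d (u i) (u i)" using uu[OF that] by simp
    also have "\<dots> = ip d (\<lambda>k. complex_of_real (\<nu> i) * u i k) (u i)" by (rule ip_scale_left[symmetric])
    also have "\<dots> = ip d (mv d (ent ?G) (u i)) (u i)" using ev[OF that] by (intro ip_cong) auto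
    also have "\<dots> = of_real (\<Sum>k<d. (cmod (mv d (ent F) (u i) k))\<^sup>2)" unfolding Gip ip_self ..
    finally show ?thesis unfolding of_real_eq_iff .
  qed
  then have \<nu>0: "0 \<le> \<nu> i" if "i < d" for i using that by (simp add: sum_nonneg)
  define \<mu> where "\<mu> = (\<lambda>i. sqrt (\<nu> i))"
  have \<mu>0: "0 \<le> \<mu> i" and \<mu>2: "(\<mu> i)\<^sup>2 = \<nu> i" if "i < d" for i using \<nu>0[OF that] by (auto simp: \<mu>_def)
  have expand: "mv d p x i = (\<Sum>l<d. ip d x (u l) * mv d p (u l) i)" for p x i
  proof -
    have "mv d p x = mv d p (proj d d u x)" by (rule mv_cong) (rule ex)
    then show ?thesis unfolding proj_def mv_sum by (rule fun_cong)
  qed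
  have determined: "mv d p x i = mv d q x i" if "\<And>l. l < d \<Longrightarrow> mv d p (u l) i = mv d q (u l) i" for p q x i
  proof -
    have "mv d p x i = (\<Sum>l<d. ip d x (u l) * mv d p (u l) i)" by (rule expand)
    also have "\<dots> = (\<Sum>l<d. ip d x (u l) * mv d q (u l) i)" using that by (intro sum.cong) auto
    also have "\<dots> = mv d q x i" by (rule expand[symmetric])
    finally show ?thesis .
  qed
  define P where "P = mat d d (\<lambda>(i, j). \<Sum>l<d. complex_of_real (\<mu> l) * u l i * cnj (u l j))"
  have P: "P \<in> carrier_mat d d" by (simp add: P_def)
  have Pu: "mv d (ent P) x i = (\<Sum>l<d. complex_of_real (\<mu> l) * ip d x (u l) * u l i)" if "i < d" for x i
  proof -
    have "mv d (ent P) x i = (\<Sum>j<d. \<Sum>l<d. complex_of_real (\<mu> l) * u l i * cnj (u l j) * x j)"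
      unfolding mv_def using that by (intro sum.cong) (auto simp: P_def sum_distrib_right)
    also have "\<dots> = (\<Sum>l<d. complex_of_real (\<mu> l) * ip d x (u l) * u l i)"
      by (subst sum.swap) (simp add: ip_def sum_distrib_left sum_distrib_right mult_ac)
    finally show ?thesis .
  qed
  have Pul: "mv d (ent P) (u l) i = complex_of_real (\<mu> l) * u l i" if "l < d" "i < d" for l i
  proof -
    have "mv d (ent P) (u l) i = (\<Sum>k<d. if k = l then complex_of_real (\<mu> l) * u l i else 0)"
      unfolding Pu[OF that(2)] using u that(1) by (intro sum.cong) (auto simp: orthonormal_def)
    with that show ?thesis by simp
  qed
  have psd: "positive_semidef d P"
    unfolding positive_semidef_iff[OF P]
  proof (intro conjI allI impI)
    fix i j assume "i < d" "j < d"
    then show "P $$ (i, j) = cnj (P $$ (j, i))" by (simp add: P_def mult_ac)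
  next
    fix x
    have "ip d (mv d (ent P) x) x = ip d (\<lambda>i. \<Sum>l<d. complex_of_real (\<mu> l) * ip d x (u l) * u l i) x"
      using Pu by (intro ip_cong) auto
    also have "\<dots> = (\<Sum>l<d. complex_of_real (\<mu> l) * ip d x (u l) * ip d (u l) x)" by (rule ip_sum_left)
    also have "\<dots> = (\<Sum>l<d. complex_of_real (\<mu> l * (cmod (ip d x (u l)))\<^sup>2))"
    proof (rule sum.cong)
      fix l
      have "ip d x (u l) * ip d (u l) x = of_real ((cmod (ip d x (u l)))\<^sup>2)"
        by (simp only: complex_norm_square cnj_ip)
      then show "complex_of_real (\<mu> l) * ip d x (u l) * ip d (u l) x = complex_of_real (\<mu> l * (cmod (ip d x (u l)))\<^sup>2)"
        by (simp only: of_real_mult mult.assoc)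
    qed simp
    finally have "Re (ip d (mv d (ent P) x) x) = (\<Sum>l<d. \<mu> l * (cmod (ip d x (u l)))\<^sup>2)"
      by (simp add: Re_sum del: of_real_mult of_real_power)
    with \<mu>0 show "0 \<le> Re (ip d (mv d (ent P) x) x)" by (auto intro!: sum_nonneg)
  qed
  have PP: "P * P = ?G"
  proof (rule mat_eq_mv[OF _ G])
    show "P * P \<in> carrier_mat d d" using P by auto
    fix x i assume i: "i < d"
    have "mv d (ent (P * P)) (u l) i = mv d (ent ?G) (u l) i" if "l < d" for l
    proof -
      have "mv d (ent (P * P)) (u l) i = mv d (ent P) (mv d (ent P) (u l)) i" by (rule mv_mult[OF P P i])
      also have "mv d (ent P) (mv d (ent P) (u l)) = mv d (ent P) (\<lambda>i. complex_of_real (\<mu> l) * u l i)"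
        using Pul[OF that] by (rule mv_cong)
      also have "\<dots> i = complex_of_real ((\<mu> l)\<^sup>2) * u l i"
        unfolding mv_scale Pul[OF that i] by (simp add: power2_eq_square)
      finally show ?thesis using ev[OF that i] \<mu>2[OF that] by simp
    qed
    then show "mv d (ent (P * P)) x i = mv d (ent ?G) x i" by (rule determined)
  qed
  have uniq: "Q = P" if Q: "positive_semidef d Q" "Q * Q = ?G" for Q
  proof (rule mat_eq_mv[OF _ P])
    show Qc: "Q \<in> carrier_mat d d" using Q(1) by (simp add: positive_semidef_def)
    note Q1 = Q(1)[unfolded positive_semidef_iff[OF Qc]]
    fix x i assume i: "i < d"
    have "mv d (ent Q) (u l) i = mv d (ent P) (u l) i" if l: "l < d" for l
    proof -
      have sq: "mv d (ent Q) (mv d (ent Q) (u l)) k = complex_of_real ((\<mu> l)\<^sup>2) * u l k" if "k < d" for k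
        using mv_mult[OF Qc Qc that, of "u l"] ev[OF l that] \<mu>2[OF l] unfolding Q(2) by simp
      have "mv d (ent Q) (u l) i = complex_of_real (\<mu> l) * u l i"
        by (rule positive_sqrt_eigenvector[OF conjunct1[OF Q1, rule_format] conjunct2[OF Q1, rule_format] sq \<mu>0[OF l] i])
      then show ?thesis using Pul[OF l i] by simp
    qed
    then show "mv d (ent Q) x i = mv d (ent P) x i" by (rule determined)
  qed
  have dF: "dim_col F = d" using F by simp
  have abs: "mat_abs F = P"
    unfolding mat_abs_def dF by (rule the_equality) (use psd PP uniq in blast)+
  have "trace_norm F = Re (\<Sum>i<d. \<Sum>l<d. complex_of_real (\<mu> l * (cmod (u l i))\<^sup>2))"
    unfolding trace_norm_def abs dF
  proof (intro arg_cong[where f=Re] sum.cong refl)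
    fix i assume "i \<in> {..<d}"
    then have "P $$ (i, i) = (\<Sum>l<d. complex_of_real (\<mu> l) * (u l i * cnj (u l i)))" by (simp add: P_def mult.assoc)
    also have "\<dots> = (\<Sum>l<d. complex_of_real (\<mu> l * (cmod (u l i))\<^sup>2))"
      by (simp only: complex_norm_square of_real_mult)
    finally show "P $$ (i, i) = (\<Sum>l<d. complex_of_real (\<mu> l * (cmod (u l i))\<^sup>2))" .
  qed
  also have "\<dots> = (\<Sum>i<d. \<Sum>l<d. \<mu> l * (cmod (u l i))\<^sup>2)" by (simp only: of_real_sum[symmetric] Re_complex_of_real)
  also have "\<dots> = (\<Sum>l<d. \<mu> l)" by (subst sum.swap) (simp add: sum_distrib_left[symmetric] uu')
  finally have tn: "trace_norm F = (\<Sum>l<d. \<mu> l)" .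
  define x where "x = (\<lambda>j l. if \<mu> j = 0 then 0 else complex_of_real (sqrt (\<mu> j)) * cnj (u j l))"
  define y where "y = (\<lambda>j k. if \<mu> j = 0 then 0 else mv d (ent F) (u j) k / complex_of_real (sqrt (\<mu> j)))"
  show thesis
  proof (rule that[of \<mu> x y])
    show "(\<Sum>k<d. (cmod (x j k))\<^sup>2) = \<mu> j" if "j < d" for j
      using uu'[OF that] \<mu>0[OF that]
      by (cases "\<mu> j = 0") (simp_all add: x_def norm_mult power_mult_distrib sum_distrib_left[symmetric])
    show "(\<Sum>k<d. (cmod (y j k))\<^sup>2) = \<mu> j" if "j < d" for j
      using \<nu>[OF that, symmetric] \<mu>0[OF that] \<mu>2[OF that, symmetric]
      by (cases "\<mu> j = 0") (simp_all add: y_def norm_divide power_divide sum_divide_distrib[symmetric], simp add: power2_eq_square)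
    show "F $$ (k, l) = (\<Sum>j<d. y j k * x j l)" if "k < d" "l < d" for k l
    proof -
      let ?e = "\<lambda>i. if i = l then 1 else 0 :: complex"
      have "F $$ (k, l) = mv d (ent F) ?e k"
        using that by (simp add: mv_def if_distrib[of "\<lambda>z. _ * z"] cong: if_cong)
      also have "\<dots> = (\<Sum>j<d. ip d ?e (u j) * mv d (ent F) (u j) k)" by (rule expand)
      also have "\<dots> = (\<Sum>j<d. cnj (u j l) * mv d (ent F) (u j) k)"
        using that by (simp add: ip_unit)
      also have "\<dots> = (\<Sum>j<d. y j k * x j l)"
      proof (rule sum.cong)
        fix j assume "j \<in> {..<d}"
        then have j: "j < d" by simp
        show "cnj (u j l) * mv d (ent F) (u j) k = y j k * x j l"
        proof (cases "\<mu> j = 0")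
          case True
          then have "\<nu> j = 0" using \<mu>2[OF j] by simp
          then have "(\<Sum>k<d. (cmod (mv d (ent F) (u j) k))\<^sup>2) = 0" using \<nu>[OF j] by simp
          then have "mv d (ent F) (u j) k = 0" using that(1) by (simp add: sum_nonneg_eq_0_iff)
          with True show ?thesis by (simp add: x_def)
        next
          case False
          then show ?thesis using \<mu>0[OF j] by (simp add: x_def y_def)
        qed
      qed simp
      finally show ?thesis .
    qed
  qed (use \<mu>0 tn in auto)
qed

section \<open>Unitary representations\<close>

lemma unitary_rep_carrier: "unitary_rep P \<Longrightarrow> P t \<in> carrier_mat (rep_dim P) (rep_dim P)"
  by (simp add: unitary_rep_def unitary_mat_def)

lemma unitary_rep_add:
  assumes "unitary_rep P" "i < rep_dim P" "j < rep_dim P"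
  shows "P (s + t) $$ (i, j) = (\<Sum>k<rep_dim P. P s $$ (i, k) * P t $$ (k, j))"
proof -
  have "P (s + t) = P s * P t" using assms(1) by (simp add: unitary_rep_def)
  then show ?thesis
    using mat_mult_index[OF unitary_rep_carrier[OF assms(1)] unitary_rep_carrier[OF assms(1)] assms(2,3)] by simp
qed

lemma unitary_rep_zero:
  assumes "unitary_rep P"
  shows "P 0 = 1\<^sub>m (rep_dim P)"
proof -
  let ?d = "rep_dim P"
  have c: "P 0 \<in> carrier_mat ?d ?d" by (rule unitary_rep_carrier[OF assms])
  have a: "mat_adjoint (P 0) \<in> carrier_mat ?d ?d" by (rule mat_adjoint_carrier[OF c])
  have u: "mat_adjoint (P 0) * P 0 = 1\<^sub>m ?d" using assms by (simp add: unitary_rep_def unitary_mat_def)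
  have m: "P 0 = P 0 * P 0" using assms unfolding unitary_rep_def by (metis add_0)
  have "1\<^sub>m ?d = mat_adjoint (P 0) * (P 0 * P 0)" using u m by simp
  also have "\<dots> = (mat_adjoint (P 0) * P 0) * P 0" by (rule assoc_mult_mat[symmetric, OF a c c])
  also have "\<dots> = P 0" unfolding u using c by simp
  finally show ?thesis ..
qed

lemma unitary_rep_minus_mat:
  assumes "unitary_rep P"
  shows "P (- t) = mat_adjoint (P t)"
proof -
  let ?d = "rep_dim P"
  have c: "P s \<in> carrier_mat ?d ?d" for s by (rule unitary_rep_carrier[OF assms])
  have a: "mat_adjoint (P t) \<in> carrier_mat ?d ?d" by (rule mat_adjoint_carrier[OF c])
  have u: "P t * mat_adjoint (P t) = 1\<^sub>m ?d" using assms by (simp add: unitary_rep_def unitary_mat_def)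
  have m: "P (- t) * P t = 1\<^sub>m ?d" using assms unitary_rep_zero[OF assms] unfolding unitary_rep_def by (metis left_minus)
  have "P (- t) = P (- t) * (P t * mat_adjoint (P t))" unfolding u by (rule right_mult_one_mat[OF c, symmetric])
  also have "\<dots> = (P (- t) * P t) * mat_adjoint (P t)" by (rule assoc_mult_mat[symmetric, OF c c a])
  also have "\<dots> = mat_adjoint (P t)" unfolding m using a by simp
  finally show ?thesis .
qed

lemma unitary_rep_minus:
  assumes "unitary_rep P" "i < rep_dim P" "j < rep_dim P"
  shows "P (- t) $$ (i, j) = cnj (P t $$ (j, i))"
  unfolding unitary_rep_minus_mat[OF assms(1)] using mat_adjoint_index[OF unitary_rep_carrier[OF assms(1)] assms(2,3)] .

lemma unitary_rep_columns:
  assumes "unitary_rep P" "i < rep_dim P" "j < rep_dim P"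
  shows "(\<Sum>k<rep_dim P. P t $$ (k, i) * cnj (P t $$ (k, j))) = (if i = j then 1 else 0)"
proof -
  have "(if i = j then 1 else 0) = P (- t + t) $$ (j, i)"
    using assms unitary_rep_zero[OF assms(1)] by simp
  also have "\<dots> = (\<Sum>k<rep_dim P. P (- t) $$ (j, k) * P t $$ (k, i))"
    by (rule unitary_rep_add[OF assms(1,3,2)])
  also have "\<dots> = (\<Sum>k<rep_dim P. P t $$ (k, i) * cnj (P t $$ (k, j)))"
    using assms by (intro sum.cong) (auto simp: unitary_rep_minus)
  finally show ?thesis ..
qed

lemma unitary_rep_norm:
  assumes "unitary_rep P"
  shows "ip (rep_dim P) (mv (rep_dim P) (ent (P t)) x) (mv (rep_dim P) (ent (P t)) y) = ip (rep_dim P) x y"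
proof -
  let ?d = "rep_dim P"
  have *: "mv ?d (\<lambda>i j. cnj (P t $$ (j, i))) (mv ?d (ent (P t)) y) i = y i" if "i < ?d" for i
  proof -
    have "mv ?d (\<lambda>i j. cnj (P t $$ (j, i))) (mv ?d (ent (P t)) y) i
        = (\<Sum>j<?d. (\<Sum>k<?d. P t $$ (k, j) * cnj (P t $$ (k, i))) * y j)"
      unfolding mv_def sum_distrib_left sum_distrib_right by (subst sum.swap) (simp add: mult_ac)
    also have "\<dots> = (\<Sum>j<?d. if j = i then y i else 0)"
      using that assms by (intro sum.cong) (auto simp: unitary_rep_columns)
    finally show ?thesis using that by simp
  qed
  show ?thesis unfolding ip_mv by (intro ip_cong) (auto simp: *)
qed

lemma unitary_rep_bound:
  assumes "unitary_rep P" "i < rep_dim P" "j < rep_dim P"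
  shows "cmod (P t $$ (i, j)) \<le> 1"
proof -
  have "complex_of_real (\<Sum>k<rep_dim P. (cmod (P t $$ (k, j)))\<^sup>2) = (\<Sum>k<rep_dim P. P t $$ (k, j) * cnj (P t $$ (k, j)))"
    by (simp only: of_real_sum complex_norm_square)
  also have "\<dots> = 1" using unitary_rep_columns[OF assms(1,3,3)] by simp
  finally have "(\<Sum>k<rep_dim P. (cmod (P t $$ (k, j)))\<^sup>2) = 1" by (simp only: of_real_eq_1_iff)
  moreover have "(cmod (P t $$ (i, j)))\<^sup>2 \<le> (\<Sum>k<rep_dim P. (cmod (P t $$ (k, j)))\<^sup>2)"
    using assms(2) by (intro member_le_sum) auto
  ultimately have "(cmod (P t $$ (i, j)))\<^sup>2 \<le> 1\<^sup>2" by simp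
  then show ?thesis by (rule power2_le_imp_le) simp
qed

lemma unitary_rep_continuous:
  "unitary_rep P \<Longrightarrow> i < rep_dim P \<Longrightarrow> j < rep_dim P \<Longrightarrow> continuous_on UNIV (\<lambda>t. P t $$ (i, j))"
  by (simp add: unitary_rep_def)

text \<open>Serves for diagonal blocks and for permutation representations, which arise as families of entries.\<close>

lemma unitary_rep_of_entries:
  fixes c :: "'a::topological_group_add \<Rightarrow> nat \<Rightarrow> nat \<Rightarrow> complex"
  assumes add: "\<And>s t i j. i < d \<Longrightarrow> j < d \<Longrightarrow> c (s + t) i j = (\<Sum>k<d. c s i k * c t k j)"
    and zero: "\<And>i j. i < d \<Longrightarrow> j < d \<Longrightarrow> c 0 i j = (if i = j then 1 else 0)"
    and minus: "\<And>t i j. i < d \<Longrightarrow> j < d \<Longrightarrow> c (- t) i j = cnj (c t j i)"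
    and cont: "\<And>i j. i < d \<Longrightarrow> j < d \<Longrightarrow> continuous_on UNIV (\<lambda>t. c t i j)"
  defines "P \<equiv> \<lambda>t. mat d d (\<lambda>(i, j). c t i j)"
  shows "unitary_rep P" "rep_dim P = d"
proof -
  show d: "rep_dim P = d" by (simp add: rep_dim_def P_def)
  have Pc: "P t \<in> carrier_mat d d" for t by (simp add: P_def)
  have hom: "P (s + t) = P s * P t" for s t
  proof (rule eq_matI)
    fix i j assume "i < dim_row (P s * P t)" "j < dim_col (P s * P t)"
    then have ij: "i < d" "j < d" by (auto simp: P_def)
    show "P (s + t) $$ (i, j) = (P s * P t) $$ (i, j)"
      unfolding mat_mult_index[OF Pc Pc ij] using add[OF ij] ij by (simp add: P_def)
  qed (auto simp: P_def)
  have adj: "mat_adjoint (P t) = P (- t)" for t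
  proof (rule eq_matI)
    fix i j assume "i < dim_row (P (- t))" "j < dim_col (P (- t))"
    then have ij: "i < d" "j < d" by (auto simp: P_def)
    show "mat_adjoint (P t) $$ (i, j) = P (- t) $$ (i, j)"
      unfolding mat_adjoint_index[OF Pc ij] using minus[OF ij, of t] ij by (simp add: P_def)
  qed (use mat_adjoint_carrier[OF Pc, of t] in \<open>auto simp: P_def\<close>)
  have P0: "P 0 = 1\<^sub>m d"
    by (rule eq_matI) (auto simp: P_def zero)
  have "unitary_mat d (P t)" for t
    unfolding unitary_mat_def adj hom[symmetric] using Pc P0 by simp
  then show "unitary_rep P"
    unfolding unitary_rep_def d using hom cont by (simp add: P_def)
qed

text \<open>Near the identity \<open>P\<close> is close to \<open>1\<close>.  On a subgroup on which the entries of \<open>X = P - 1\<close> are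
  bounded by a small \<open>b\<close>, the identity \<open>P (n + n) - 1 = 2 X + X\<^sup>2\<close> improves the bound to \<open>3 b / 4\<close>;
  hence \<open>X = 0\<close>.\<close>

lemma unitary_rep_trivial_on_open_subgroup:
  fixes P :: "'a::{topological_group_add, t2_space} \<Rightarrow> complex mat"
  assumes "compact (UNIV :: 'a set)" "totally_disconnected (UNIV :: 'a set)" and P: "unitary_rep P"
  obtains N where "open N" "add_subgroup N" "\<And>n. n \<in> N \<Longrightarrow> P n = 1\<^sub>m (rep_dim P)"
proof -
  let ?d = "rep_dim P"
  define X where "X = (\<lambda>t i j. P t $$ (i, j) - (if i = j then 1 else 0))"
  \<comment> \<open>so small that \<open>d b\<^sup>2 \<le> b / 2\<close> whenever \<open>b \<le> e\<close>, where \<open>d b\<^sup>2\<close> bounds the entries of \<open>X\<^sup>2\<close>\<close>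
  define e where "e = 1 / (2 * (real ?d + 1))"
  have e: "e > 0" "real ?d * e \<le> 1 / 2" by (auto simp: e_def field_simps)
  define U where "U = (\<Inter>i\<in>{..<?d}. \<Inter>j\<in>{..<?d}. {t. cmod (X t i j) < e})"
  have "open U"
    unfolding U_def
  proof (intro open_INT ballI finite_lessThan)
    fix i j assume "i \<in> {..<?d}" "j \<in> {..<?d}"
    then have "continuous_on UNIV (\<lambda>t. cmod (X t i j))"
      unfolding X_def using unitary_rep_continuous[OF P] by (intro continuous_intros) auto
    then show "open {t. cmod (X t i j) < e}" by (intro open_Collect_less) (auto intro: continuous_intros)
  qed
  moreover have "0 \<in> U" using e(1) by (auto simp: U_def X_def unitary_rep_zero[OF P])
  ultimately obtain N where N: "open N" "add_subgroup N" "N \<subseteq> U"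
    using open_subgroup_in_neighbourhood[OF assms(1,2)] by blast
  have step: "cmod (X n i j) \<le> 3 / 4 * b"
    if b: "\<And>n i j. n \<in> N \<Longrightarrow> i < ?d \<Longrightarrow> j < ?d \<Longrightarrow> cmod (X n i j) \<le> b" "b \<le> e" and n: "n \<in> N" "i < ?d" "j < ?d"
    for b n i j
  proof -
    have "0 \<le> b" using b(1)[OF n] norm_ge_zero order_trans by blast
    have "X (n + n) i j = (\<Sum>k<?d. (X n i k + (if i = k then 1 else 0)) * (X n k j + (if k = j then 1 else 0)))
        - (if i = j then 1 else 0)"
      using unitary_rep_add[OF P n(2,3), of n n] by (simp add: X_def)
    also have "\<dots> = (\<Sum>k<?d. X n i k * X n k j) + (\<Sum>k<?d. if i = k then X n k j else 0)
        + (\<Sum>k<?d. if k = j then X n i k else 0) + (\<Sum>k<?d. if i = k then if k = j then 1 else 0 else 0) - (if i = j then 1 else 0)"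
      unfolding sum.distrib[symmetric] by (intro arg_cong2[where f="(-)"] sum.cong) (auto simp: algebra_simps)
    also have "\<dots> = (\<Sum>k<?d. X n i k * X n k j) + 2 * X n i j" using n by simp
    finally have "2 * X n i j = X (n + n) i j - (\<Sum>k<?d. X n i k * X n k j)" by simp
    then have "cmod (2 * X n i j) \<le> cmod (X (n + n) i j) + cmod (\<Sum>k<?d. X n i k * X n k j)"
      by (simp add: norm_triangle_ineq4)
    also have "cmod (X (n + n) i j) \<le> b" using N(2) n by (intro b(1)) (auto simp: add_subgroup_def)
    also have "cmod (\<Sum>k<?d. X n i k * X n k j) \<le> (\<Sum>k<?d. b * b)"
      using b(1)[OF n(1)] n(2,3) \<open>0 \<le> b\<close> by (intro sum_norm_le) (auto simp: norm_mult intro!: mult_mono)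
    also have "(\<Sum>k<?d. b * b) = (real ?d * b) * b" by simp
    also have "\<dots> \<le> (1 / 2) * b"
      using \<open>0 \<le> b\<close> e(2) mult_left_mono[OF b(2), of "real ?d"] by (intro mult_right_mono) auto
    finally show ?thesis by (simp add: norm_mult)
  qed
  have bd: "cmod (X n i j) \<le> e * (3 / 4) ^ k" if "n \<in> N" "i < ?d" "j < ?d" for n i j k
    using that
  proof (induction k arbitrary: n i j)
    case 0
    then show ?case using N(3) by (force simp: U_def)
  next
    case (Suc k)
    have "cmod (X n i j) \<le> 3 / 4 * (e * (3 / 4) ^ k)"
      using e(1) by (intro step Suc) (auto simp: mult_le_cancel_left1 power_le_one)
    then show ?case by simp
  qed
  have "X n i j = 0" if "n \<in> N" "i < ?d" "j < ?d" for n i j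
  proof -
    have "(\<lambda>k. e * (3 / 4) ^ k) \<longlonglongrightarrow> e * 0" by (intro tendsto_intros LIMSEQ_realpow_zero) auto
    then have "cmod (X n i j) \<le> e * 0" using bd[OF that] by (intro LIMSEQ_le_const) auto
    then show ?thesis by simp
  qed
  then have "P n = 1\<^sub>m ?d" if "n \<in> N" for n
    using that unitary_rep_carrier[OF P, of n] by (intro eq_matI) (auto simp: X_def)
  with N show thesis by (intro that[of N]) auto
qed

lemma unitary_rep_locally_constant:
  fixes P :: "'a::{topological_group_add, t2_space} \<Rightarrow> complex mat"
  assumes "compact (UNIV :: 'a set)" "totally_disconnected (UNIV :: 'a set)" and P: "unitary_rep P"
  shows "locally_constant (\<lambda>t. P t $$ (i, j))"
proof -
  obtain N where N: "open N" "add_subgroup N" "\<And>n. n \<in> N \<Longrightarrow> P n = 1\<^sub>m (rep_dim P)"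
    using unitary_rep_trivial_on_open_subgroup[OF assms] by metis
  have "P (x + n) = P x" if "n \<in> N" for x n
  proof -
    have "P (x + n) = P x * P n" using P by (simp add: unitary_rep_def)
    then show ?thesis using N(3)[OF that] unitary_rep_carrier[OF P, of x] by simp
  qed
  with N(1,2) show ?thesis by (intro locally_constant_subgroup[of N]) (auto simp: add_subgroup_def)
qed

section \<open>Schur's lemma\<close>

lemma subspace_module_vecI:
  assumes "W \<subseteq> carrier_vec d" "0\<^sub>v d \<in> W" "\<And>v w. v \<in> W \<Longrightarrow> w \<in> W \<Longrightarrow> v + w \<in> W"
    "\<And>c v. v \<in> W \<Longrightarrow> c \<cdot>\<^sub>v v \<in> W"
  shows "VectorSpace.subspace class_ring W (module_vec TYPE(complex) d)"
proof -
  interpret vec_space "TYPE(complex)" d .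
  show ?thesis
    unfolding subspace_def submodule_def
    using assms vectorspace_axioms module_axioms by (auto simp: module_vec_simps)
qed

lemma subspace_module_vecD:
  assumes "VectorSpace.subspace class_ring W (module_vec TYPE(complex) d)"
  shows "W \<subseteq> carrier_vec d" "0\<^sub>v d \<in> W" "\<And>v w. v \<in> W \<Longrightarrow> w \<in> W \<Longrightarrow> v + w \<in> W"
    "\<And>c v. v \<in> W \<Longrightarrow> c \<cdot>\<^sub>v v \<in> W"
  using assms unfolding subspace_def submodule_def by (auto simp: module_vec_simps)

text \<open>An eigenspace of \<open>X\<close> is a nonzero invariant subspace.\<close>

lemma schur_scalar:
  assumes P: "unitary_rep P" "irreducible_rep P"
    and X: "X \<in> carrier_mat (rep_dim P) (rep_dim P)" and comm: "\<And>s. X * P s = P s * X"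
  obtains c where "X = c \<cdot>\<^sub>m 1\<^sub>m (rep_dim P)"
proof -
  let ?d = "rep_dim P"
  have d: "0 < ?d" using P(2) by (simp add: irreducible_rep_def)
  obtain l where "eigenvalue X l" using spectrum_non_empty[OF X] d by (auto simp: spectrum_def)
  then obtain w where w: "w \<in> carrier_vec ?d" "w \<noteq> 0\<^sub>v ?d" "X *\<^sub>v w = l \<cdot>\<^sub>v w"
    using X by (auto simp: eigenvalue_def eigenvector_def)
  define W where "W = {v \<in> carrier_vec ?d. X *\<^sub>v v = l \<cdot>\<^sub>v v}"
  have "VectorSpace.subspace class_ring W (module_vec TYPE(complex) ?d)"
  proof (rule subspace_module_vecI)
    show "0\<^sub>v ?d \<in> W" using X by (auto simp: W_def)
    show "v + w \<in> W" if "v \<in> W" "w \<in> W" for v w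
      using that X by (auto simp: W_def mult_add_distrib_mat_vec smult_add_distrib_vec)
    show "c \<cdot>\<^sub>v v \<in> W" if "v \<in> W" for c v
      using that X by (auto simp: W_def mult_mat_vec smult_smult_assoc mult.commute)
  qed (auto simp: W_def)
  moreover have "P t *\<^sub>v v \<in> W" if "v \<in> W" for t v
  proof -
    have Pt: "P t \<in> carrier_mat ?d ?d" by (rule unitary_rep_carrier[OF P(1)])
    have v: "v \<in> carrier_vec ?d" "X *\<^sub>v v = l \<cdot>\<^sub>v v" using that by (auto simp: W_def)
    have "X *\<^sub>v (P t *\<^sub>v v) = (X * P t) *\<^sub>v v" by (rule assoc_mult_mat_vec[symmetric, OF X Pt v(1)])
    also have "\<dots> = P t *\<^sub>v (X *\<^sub>v v)" unfolding comm by (rule assoc_mult_mat_vec[OF Pt X v(1)])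
    also have "\<dots> = l \<cdot>\<^sub>v (P t *\<^sub>v v)" unfolding v(2) by (rule mult_mat_vec[OF Pt v(1)])
    finally show ?thesis using Pt v(1) by (simp add: W_def)
  qed
  moreover have "W \<noteq> {0\<^sub>v ?d}" using w by (auto simp: W_def)
  ultimately have W: "W = carrier_vec ?d" using P(2) unfolding irreducible_rep_def by blast
  have "X = l \<cdot>\<^sub>m 1\<^sub>m ?d"
  proof (rule eq_matI)
    fix i j assume "i < dim_row (l \<cdot>\<^sub>m 1\<^sub>m ?d)" "j < dim_col (l \<cdot>\<^sub>m 1\<^sub>m ?d)"
    then have ij: "i < ?d" "j < ?d" by auto
    have "unit_vec ?d j \<in> W" unfolding W by simp
    then have "X *\<^sub>v unit_vec ?d j = l \<cdot>\<^sub>v unit_vec ?d j" by (simp add: W_def)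
    then have "vec_index (X *\<^sub>v unit_vec ?d j) i = vec_index (l \<cdot>\<^sub>v unit_vec ?d j) i" by simp
    then show "X $$ (i, j) = (l \<cdot>\<^sub>m 1\<^sub>m ?d) $$ (i, j)" using ij X by simp
  qed (use X in auto)
  with that show thesis .
qed

lemma mat_adjoint_adjoint:
  fixes A :: "complex mat"
  assumes "A \<in> carrier_mat n m" shows "mat_adjoint (mat_adjoint A) = A"
  using mat_adjoint_index[OF assms] mat_adjoint_index[OF mat_adjoint_carrier[OF assms]]
    mat_adjoint_carrier[OF assms] mat_adjoint_carrier[OF mat_adjoint_carrier[OF assms]] assms
  by (intro eq_matI) auto

lemma mat_adjoint_mult:
  fixes A B :: "complex mat"
  assumes A: "A \<in> carrier_mat n m" and B: "B \<in> carrier_mat m p"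
  shows "mat_adjoint (A * B) = mat_adjoint B * mat_adjoint A"
proof (rule eq_matI)
  have AB: "A * B \<in> carrier_mat n p" using A B by auto
  note As = mat_adjoint_carrier[OF A] and Bs = mat_adjoint_carrier[OF B]
  show "dim_row (mat_adjoint (A * B)) = dim_row (mat_adjoint B * mat_adjoint A)"
    "dim_col (mat_adjoint (A * B)) = dim_col (mat_adjoint B * mat_adjoint A)"
    using mat_adjoint_carrier[OF AB] As Bs by auto
  fix i j assume "i < dim_row (mat_adjoint B * mat_adjoint A)" "j < dim_col (mat_adjoint B * mat_adjoint A)"
  then have ij: "i < p" "j < n" using As Bs by auto
  show "mat_adjoint (A * B) $$ (i, j) = (mat_adjoint B * mat_adjoint A) $$ (i, j)"
    unfolding mat_adjoint_index[OF AB ij] mat_mult_index[OF A B ij(2,1)] mat_mult_index[OF Bs As ij] cnj_sum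
    using ij by (intro sum.cong) (auto simp: mat_adjoint_index[OF A] mat_adjoint_index[OF B])
qed

lemma intertwiner_adjoint:
  assumes P: "unitary_rep P" and Q: "unitary_rep Q"
    and T: "T \<in> carrier_mat (rep_dim P) (rep_dim Q)" and comm: "\<And>s. P s * T = T * Q s"
  shows "Q s * mat_adjoint T = mat_adjoint T * P s"
proof -
  have "mat_adjoint (P (- s) * T) = mat_adjoint (T * Q (- s))" by (simp only: comm)
  then have "mat_adjoint T * mat_adjoint (P (- s)) = mat_adjoint (Q (- s)) * mat_adjoint T"
    using mat_adjoint_mult[OF unitary_rep_carrier[OF P] T] mat_adjoint_mult[OF T unitary_rep_carrier[OF Q]] by simp
  then show ?thesis
    using unitary_rep_minus_mat[OF P, of "- s"] unitary_rep_minus_mat[OF Q, of "- s"] by simp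
qed

text \<open>By Schur's lemma \<open>T\<^sup>* T\<close> and \<open>T T\<^sup>*\<close> are scalar.  The scalars agree because \<open>(T T\<^sup>*) T = T (T\<^sup>* T)\<close>, and
  then so do the dimensions, because the two products have the same trace.  Hence a multiple of \<open>T\<close> is unitary.\<close>

lemma schur_equiv:
  assumes P: "P \<in> irreps" and Q: "Q \<in> irreps"
    and T: "T \<in> carrier_mat (rep_dim P) (rep_dim Q)" and comm: "\<And>s. P s * T = T * Q s"
    and nz: "i0 < rep_dim P" "k0 < rep_dim Q" "T $$ (i0, k0) \<noteq> 0"
  shows "equiv_rep Q P"
proof -
  let ?d = "rep_dim P" and ?e = "rep_dim Q" and ?S = "mat_adjoint T"
  have uP: "unitary_rep P" "irreducible_rep P" and uQ: "unitary_rep Q" "irreducible_rep Q"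
    using P Q by (auto simp: irreps_def)
  have Pc: "P s \<in> carrier_mat ?d ?d" and Qc: "Q s \<in> carrier_mat ?e ?e" for s
    using unitary_rep_carrier uP uQ by auto
  have S: "?S \<in> carrier_mat ?e ?d" by (rule mat_adjoint_carrier[OF T])
  have comm': "Q s * ?S = ?S * P s" for s by (rule intertwiner_adjoint[OF uP(1) uQ(1) T comm])
  have "(?S * T) * Q s = Q s * (?S * T)" for s
  proof -
    have "(?S * T) * Q s = ?S * (T * Q s)" by (rule assoc_mult_mat[OF S T Qc])
    also have "\<dots> = (?S * P s) * T" unfolding comm[symmetric] by (rule assoc_mult_mat[symmetric, OF S Pc T])
    also have "\<dots> = Q s * (?S * T)" unfolding comm'[symmetric] by (rule assoc_mult_mat[OF Qc S T])
    finally show ?thesis .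
  qed
  then obtain a where a: "?S * T = a \<cdot>\<^sub>m 1\<^sub>m ?e"
    using schur_scalar[OF uQ, of "?S * T"] S T by auto
  have "(T * ?S) * P s = P s * (T * ?S)" for s
  proof -
    have "(T * ?S) * P s = T * (?S * P s)" by (rule assoc_mult_mat[OF T S Pc])
    also have "\<dots> = (T * Q s) * ?S" unfolding comm'[symmetric] by (rule assoc_mult_mat[symmetric, OF T Qc S])
    also have "\<dots> = P s * (T * ?S)" unfolding comm[symmetric] by (rule assoc_mult_mat[OF Pc T S])
    finally show ?thesis .
  qed
  then obtain b where b: "T * ?S = b \<cdot>\<^sub>m 1\<^sub>m ?d"
    using schur_scalar[OF uP, of "T * ?S"] S T by auto
  have STT: "(T * ?S) * T = T * (?S * T)" by (rule assoc_mult_mat[OF T S T])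
  have "(b \<cdot>\<^sub>m 1\<^sub>m ?d) * T = b \<cdot>\<^sub>m T" "T * (a \<cdot>\<^sub>m 1\<^sub>m ?e) = a \<cdot>\<^sub>m T" using T by auto
  then have "b \<cdot>\<^sub>m T = a \<cdot>\<^sub>m T" using STT unfolding a b by simp
  then have "(b \<cdot>\<^sub>m T) $$ (i0, k0) = (a \<cdot>\<^sub>m T) $$ (i0, k0)" by simp
  with nz T have ab: "a = b" by simp
  define s where "s = (\<Sum>i<?d. \<Sum>k<?e. (cmod (T $$ (i, k)))\<^sup>2)"
  have "0 < (cmod (T $$ (i0, k0)))\<^sup>2" using nz by simp
  also have "\<dots> \<le> (\<Sum>k<?e. (cmod (T $$ (i0, k)))\<^sup>2)" using nz by (intro member_le_sum) auto
  also have "\<dots> \<le> s" unfolding s_def using nz by (intro member_le_sum[of i0]) (auto intro: sum_nonneg)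
  finally have s0: "s > 0" .
  have "of_nat ?e * a = (\<Sum>k<?e. (?S * T) $$ (k, k))" unfolding a by simp
  also have "\<dots> = (\<Sum>k<?e. \<Sum>i<?d. complex_of_real ((cmod (T $$ (i, k)))\<^sup>2))"
  proof (rule sum.cong)
    fix k assume "k \<in> {..<?e}"
    then have k: "k < ?e" by simp
    have "(?S * T) $$ (k, k) = (\<Sum>i<?d. T $$ (i, k) * cnj (T $$ (i, k)))"
      unfolding mat_mult_index[OF S T k k] using k by (intro sum.cong) (auto simp: mat_adjoint_index[OF T])
    then show "(?S * T) $$ (k, k) = (\<Sum>i<?d. complex_of_real ((cmod (T $$ (i, k)))\<^sup>2))"
      by (simp only: complex_norm_square)
  qed simp
  also have "\<dots> = of_real s" unfolding s_def of_real_sum by (rule sum.swap)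
  finally have es: "of_nat ?e * a = of_real s" .
  have "of_nat ?d * b = (\<Sum>i<?d. (T * ?S) $$ (i, i))" unfolding b by simp
  also have "\<dots> = (\<Sum>i<?d. \<Sum>k<?e. complex_of_real ((cmod (T $$ (i, k)))\<^sup>2))"
  proof (rule sum.cong)
    fix i assume "i \<in> {..<?d}"
    then have i: "i < ?d" by simp
    have "(T * ?S) $$ (i, i) = (\<Sum>k<?e. T $$ (i, k) * cnj (T $$ (i, k)))"
      unfolding mat_mult_index[OF T S i i] using i by (intro sum.cong) (auto simp: mat_adjoint_index[OF T])
    then show "(T * ?S) $$ (i, i) = (\<Sum>k<?e. complex_of_real ((cmod (T $$ (i, k)))\<^sup>2))"
      by (simp only: complex_norm_square)
  qed simp
  also have "\<dots> = of_real s" unfolding s_def of_real_sum ..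
  finally have ds: "of_nat ?d * b = of_real s" .
  have e0: "0 < ?e" using nz by auto
  have a0: "a \<noteq> 0" using es s0 by auto
  have de: "?d = ?e" using es ds ab a0 by (metis mult_cancel_right of_nat_eq_iff)
  have aval: "a = complex_of_real (s / ?e)"
    using es e0 by (simp add: field_simps)
  have apos: "s / ?e > 0" using s0 e0 by simp
  define c where "c = complex_of_real (1 / sqrt (s / ?e))"
  have "1 / sqrt r * (1 / sqrt r) * r = 1" if "r > 0" for r :: real
    using that by (simp add: field_simps)
  from this[OF apos] have "1 / sqrt (s / ?e) * (1 / sqrt (s / ?e)) * (s / ?e) = 1" .
  then have ca: "c * c * a = 1" "cnj c = c"
    unfolding aval c_def of_real_mult[symmetric] by (simp_all only: of_real_1 complex_cnj_complex_of_real)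
  have ca': "c * (c * a) = 1" using ca(1) by (simp add: mult.assoc)
  define U where "U = c \<cdot>\<^sub>m T"
  have U: "U \<in> carrier_mat ?d ?e" using T by (simp add: U_def)
  have Ua: "mat_adjoint U = c \<cdot>\<^sub>m ?S"
    using mat_adjoint_index[OF U] mat_adjoint_index[OF T] mat_adjoint_carrier[OF U] S T ca(2)
    by (intro eq_matI) (auto simp: U_def)
  have "mat_adjoint U * U = c \<cdot>\<^sub>m (?S * (c \<cdot>\<^sub>m T))"
    unfolding Ua unfolding U_def by (rule mult_smult_assoc_mat[OF S smult_carrier_mat[OF T]])
  also have "?S * (c \<cdot>\<^sub>m T) = c \<cdot>\<^sub>m (?S * T)" by (rule mult_smult_distrib[OF S T])
  also have "c \<cdot>\<^sub>m (c \<cdot>\<^sub>m (?S * T)) = 1\<^sub>m ?e" unfolding a using ca' by (intro eq_matI) auto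
  finally have U1: "mat_adjoint U * U = 1\<^sub>m ?e" .
  have "U * mat_adjoint U = c \<cdot>\<^sub>m (T * (c \<cdot>\<^sub>m ?S))"
    unfolding Ua unfolding U_def by (rule mult_smult_assoc_mat[OF T smult_carrier_mat[OF S]])
  also have "T * (c \<cdot>\<^sub>m ?S) = c \<cdot>\<^sub>m (T * ?S)" by (rule mult_smult_distrib[OF T S])
  also have "c \<cdot>\<^sub>m (c \<cdot>\<^sub>m (T * ?S)) = 1\<^sub>m ?d" unfolding b using ca' ab by (intro eq_matI) auto
  finally have U2: "U * mat_adjoint U = 1\<^sub>m ?d" .
  have "U * Q t = P t * U" for t
    unfolding U_def using mult_smult_assoc_mat[OF T Qc] mult_smult_distrib[OF Pc T] comm by simp
  then show ?thesis
    unfolding equiv_rep_def unitary_mat_def using U U1 U2 de by auto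
qed

section \<open>The dual\<close>

abbreviation irr_dim :: "('a::topological_group_add \<Rightarrow> complex mat) set \<Rightarrow> nat" where
  "irr_dim P \<equiv> rep_dim (rep_of P)"

lemma equiv_rep_refl: "unitary_rep P \<Longrightarrow> equiv_rep P P"
  unfolding equiv_rep_def unitary_mat_def
proof (intro conjI exI[of _ "1\<^sub>m (rep_dim P)"] allI)
  assume P: "unitary_rep P"
  have "mat_adjoint (1\<^sub>m (rep_dim P) :: complex mat) = 1\<^sub>m (rep_dim P)"
    using mat_adjoint_index[of "1\<^sub>m (rep_dim P)" "rep_dim P" "rep_dim P"]
      mat_adjoint_carrier[of "1\<^sub>m (rep_dim P) :: complex mat" "rep_dim P" "rep_dim P"]
    by (intro eq_matI) auto
  then show "mat_adjoint (1\<^sub>m (rep_dim P) :: complex mat) * 1\<^sub>m (rep_dim P) = 1\<^sub>m (rep_dim P)"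
    "1\<^sub>m (rep_dim P) * mat_adjoint (1\<^sub>m (rep_dim P) :: complex mat) = 1\<^sub>m (rep_dim P)" by auto
  show "1\<^sub>m (rep_dim P) * P t = P t * 1\<^sub>m (rep_dim P)" for t
    using unitary_rep_carrier[OF P, of t] by auto
qed auto

lemma equiv_rep_sym:
  assumes "unitary_rep P" "unitary_rep Q" "equiv_rep P Q" shows "equiv_rep Q P"
proof -
  obtain U where d: "rep_dim P = rep_dim Q" and U: "unitary_mat (rep_dim P) U" and c: "\<And>t. U * P t = Q t * U"
    using assms(3) by (auto simp: equiv_rep_def)
  have Uc: "U \<in> carrier_mat (rep_dim P) (rep_dim P)" using U by (simp add: unitary_mat_def)
  have "mat_adjoint U * Q t = P t * mat_adjoint U" for t
    using intertwiner_adjoint[OF assms(2,1), of U t] Uc c d by simp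
  then show ?thesis
    using U mat_adjoint_carrier[OF Uc] d mat_adjoint_adjoint[OF Uc] unfolding equiv_rep_def unitary_mat_def by auto
qed

text \<open>The product of the two unitaries is a nonzero intertwiner.\<close>

lemma equiv_rep_trans:
  assumes P: "P \<in> irreps" and Q: "Q \<in> irreps" and R: "R \<in> irreps" and PQ: "equiv_rep P Q" and QR: "equiv_rep Q R"
  shows "equiv_rep P R"
proof -
  let ?d = "rep_dim P"
  obtain U where d: "?d = rep_dim Q" and U: "unitary_mat ?d U" and cU: "\<And>t. U * P t = Q t * U"
    using PQ by (auto simp: equiv_rep_def)
  obtain V where d': "rep_dim Q = rep_dim R" and V: "unitary_mat ?d V" and cV: "\<And>t. V * Q t = R t * V"
    using QR d by (auto simp: equiv_rep_def)
  have Uc: "U \<in> carrier_mat ?d ?d" and Vc: "V \<in> carrier_mat ?d ?d" using U V by (auto simp: unitary_mat_def)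
  note Va = mat_adjoint_carrier[OF Vc]
  have c: "P t \<in> carrier_mat ?d ?d" "Q t \<in> carrier_mat ?d ?d" "R t \<in> carrier_mat ?d ?d" for t
    using unitary_rep_carrier[of P] unitary_rep_carrier[of Q] unitary_rep_carrier[of R] P Q R d d' by (auto simp: irreps_def)
  have VU: "V * U \<in> carrier_mat ?d ?d" by (rule mult_carrier_mat[OF Vc Uc])
  have comm: "R t * (V * U) = (V * U) * P t" for t
  proof -
    have "(V * U) * P t = V * (Q t * U)" unfolding cU[symmetric] by (rule assoc_mult_mat[OF Vc Uc c(1)])
    also have "\<dots> = (R t * V) * U" unfolding cV[symmetric] by (rule assoc_mult_mat[symmetric, OF Vc c(2) Uc])
    also have "\<dots> = R t * (V * U)" by (rule assoc_mult_mat[OF c(3) Vc Uc])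
    finally show ?thesis ..
  qed
  have "\<exists>i<?d. \<exists>k<?d. (V * U) $$ (i, k) \<noteq> 0"
  proof (rule ccontr)
    assume "\<not> ?thesis"
    then have 0: "V * U = 0\<^sub>m ?d ?d" using VU by (intro eq_matI) auto
    have "U = (mat_adjoint V * V) * U" using V left_mult_one_mat[OF Uc] by (simp add: unitary_mat_def)
    also have "\<dots> = mat_adjoint V * (V * U)" by (rule assoc_mult_mat[OF Va Vc Uc])
    also have "\<dots> = 0\<^sub>m ?d ?d" unfolding 0 by (rule right_mult_zero_mat[OF Va])
    finally have "(1\<^sub>m ?d :: complex mat) = mat_adjoint (0\<^sub>m ?d ?d) * 0\<^sub>m ?d ?d" using U by (simp add: unitary_mat_def)
    also have "\<dots> = 0\<^sub>m ?d ?d" by (rule right_mult_zero_mat[OF mat_adjoint_carrier]) simp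
    finally have "(1\<^sub>m ?d :: complex mat) $$ (0, 0) = 0\<^sub>m ?d ?d $$ (0, 0)" by simp
    moreover have "0 < ?d" using P by (simp add: irreps_def irreducible_rep_def)
    ultimately show False by simp
  qed
  then obtain i k where "i < rep_dim R" "k < ?d" "(V * U) $$ (i, k) \<noteq> 0" using d d' by auto
  then show ?thesis using schur_equiv[OF R P _ comm] VU d d' by simp
qed

abbreviation equiv_rel :: "(('a::topological_group_add \<Rightarrow> complex mat) \<times> ('a \<Rightarrow> complex mat)) set" where
  "equiv_rel \<equiv> {(\<pi>, \<sigma>). \<pi> \<in> irreps \<and> \<sigma> \<in> irreps \<and> equiv_rep \<pi> \<sigma>}"

lemma equiv_equiv_rel: "equiv (irreps :: ('a::topological_group_add \<Rightarrow> complex mat) set) equiv_rel"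
proof (rule equivI)
  let ?r = "equiv_rel :: (('a \<Rightarrow> complex mat) \<times> ('a \<Rightarrow> complex mat)) set"
  show "?r \<subseteq> irreps \<times> irreps" by auto
  show "refl_on irreps ?r"
    unfolding refl_on_def using equiv_rep_refl by (auto simp: irreps_def)
  show "sym ?r"
  proof (rule symI)
    fix P Q :: "'a \<Rightarrow> complex mat" assume "(P, Q) \<in> ?r"
    then have *: "P \<in> irreps" "Q \<in> irreps" "equiv_rep P Q" by auto
    then have "unitary_rep P" "unitary_rep Q" by (auto simp: irreps_def)
    from equiv_rep_sym[OF this *(3)] * show "(Q, P) \<in> ?r" by simp
  qed
  show "trans ?r"
  proof (rule transI)
    fix P Q R :: "'a \<Rightarrow> complex mat" assume "(P, Q) \<in> ?r" "(Q, R) \<in> ?r"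
    then have *: "P \<in> irreps" "Q \<in> irreps" "R \<in> irreps" "equiv_rep P Q" "equiv_rep Q R" by auto
    from equiv_rep_trans[OF *] * show "(P, R) \<in> ?r" by simp
  qed
qed

lemma rep_of_mem: assumes "P \<in> dual_group" shows "rep_of P \<in> P"
proof -
  have "P \<noteq> {}"
    using in_quotient_imp_non_empty[OF equiv_equiv_rel] assms unfolding dual_group_def by auto
  then show ?thesis unfolding rep_of_def by (intro someI_ex[of "\<lambda>\<pi>. \<pi> \<in> P"]) auto
qed

lemma rep_of_irrep: assumes "P \<in> dual_group" shows "rep_of P \<in> irreps"
proof -
  have "P \<subseteq> irreps" using in_quotient_imp_subset[OF equiv_equiv_rel] assms unfolding dual_group_def .
  with rep_of_mem[OF assms] show ?thesis by (rule rev_subsetD)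
qed

lemma unitary_rep_rep_of: "P \<in> dual_group \<Longrightarrow> unitary_rep (rep_of P)"
  using rep_of_irrep by (auto simp: irreps_def)

lemma irr_dim_pos: "P \<in> dual_group \<Longrightarrow> 0 < irr_dim P"
  using rep_of_irrep by (auto simp: irreps_def irreducible_rep_def)

lemma dual_group_eqI:
  assumes "P \<in> dual_group" "Q \<in> dual_group" "equiv_rep (rep_of P) (rep_of Q)" shows "P = Q"
proof (rule quotient_eqI[OF equiv_equiv_rel])
  show "P \<in> irreps // equiv_rel" "Q \<in> irreps // equiv_rel" using assms by (simp_all add: dual_group_def)
  show "rep_of P \<in> P" "rep_of Q \<in> Q" using assms by (simp_all add: rep_of_mem)
  show "(rep_of P, rep_of Q) \<in> equiv_rel" using assms by (simp add: rep_of_irrep)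
qed

lemma dual_group_rep:
  assumes "\<pi> \<in> irreps" obtains P where "P \<in> dual_group" "equiv_rep \<pi> (rep_of P)"
proof -
  let ?P = "equiv_rel `` {\<pi>}"
  have P: "?P \<in> dual_group" unfolding dual_group_def using assms by (rule quotientI)
  have "equiv_rep \<pi> \<sigma>" if "\<sigma> \<in> ?P" for \<sigma> using that by auto
  from this[OF rep_of_mem[OF P]] have "equiv_rep \<pi> (rep_of ?P)" .
  with P show thesis by (rule that)
qed

section \<open>Haar measure and Schur orthogonality\<close>

locale profinite_group =
  fixes M :: "'a::{topological_group_add, t2_space} measure"
  assumes compact_UNIV: "compact (UNIV :: 'a set)"
    and totally_disconnected_UNIV: "totally_disconnected (UNIV :: 'a set)"
    and haar: "haar_probability M"
begin

lemma sets_M: "sets M = sets borel"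
  using haar by (simp add: haar_probability_def)

lemma space_M: "space M = UNIV"
  using sets_eq_imp_space_eq[OF sets_M] by simp

sublocale prob_space M
  using haar by (simp add: haar_probability_def)

lemma continuous_measurable:
  fixes f :: "'a \<Rightarrow> 'b::topological_space"
  assumes "continuous_on UNIV f" shows "f \<in> borel_measurable M"
  using borel_measurable_continuous_onI[OF assms] measurable_cong_sets[OF sets_M refl] by blast

lemma translate_measurable: "(\<lambda>t. s + t) \<in> measurable M M"
proof -
  have "(\<lambda>t. s + t) \<in> borel_measurable M" by (intro continuous_measurable continuous_intros)
  then show ?thesis using measurable_cong_sets[OF refl sets_M] by blast
qed

lemma distr_translate: "distr M M (\<lambda>t. s + t) = M"
  using haar by (simp add: haar_probability_def)

lemma integral_translate:
  fixes f :: "'a \<Rightarrow> 'b::{banach, second_countable_topology}"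
  assumes "f \<in> borel_measurable M"
  shows "(LINT t|M. f (s + t)) = (LINT t|M. f t)"
  using integral_distr[OF translate_measurable assms, of s] by (simp add: distr_translate)

lemma integrable_translate:
  fixes f :: "'a \<Rightarrow> 'b::{banach, second_countable_topology}"
  assumes "integrable M f"
  shows "integrable M (\<lambda>t. f (s + t))"
  using integrable_distr[OF translate_measurable, of s f] assms by (simp add: distr_translate)

lemma measure_translate: "A \<in> sets M \<Longrightarrow> measure M {t. s + t \<in> A} = measure M A"
  using measure_distr[OF translate_measurable, of A s] by (simp add: distr_translate space_M vimage_def)

lemma open_sets: "open A \<Longrightarrow> A \<in> sets M"
  by (simp add: sets_M)

lemma continuous_bounded:
  fixes f :: "'a \<Rightarrow> complex"
  assumes "continuous_on UNIV f" obtains B where "\<And>t. cmod (f t) \<le> B"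
proof -
  have "bounded (range f)"
    by (rule compact_imp_bounded[OF compact_continuous_image[OF assms compact_UNIV]])
  then obtain B where "\<forall>x\<in>range f. norm x \<le> B" unfolding bounded_iff by blast
  then show thesis by (intro that[of B]) auto
qed

lemma continuous_integrable:
  fixes f :: "'a \<Rightarrow> complex"
  assumes "continuous_on UNIV f" shows "integrable M f"
proof -
  obtain B where "\<And>t. cmod (f t) \<le> B" using continuous_bounded[OF assms] by metis
  then show ?thesis by (intro integrable_const_bound[of _ B]) (auto intro: continuous_measurable assms)
qed

text \<open>Finitely many translates of \<open>C\<close> cover the group and have the same measure.\<close>

lemma measure_open_pos:
  assumes "open C" "x \<in> C" shows "measure M C > 0"
proof -
  have op: "open {t. y + t \<in> C}" for y by (rule open_left_translate[OF assms(1)])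
  have "t \<in> {u. (x + - t) + u \<in> C}" for t using assms(2) by (simp add: add.assoc)
  then have "UNIV \<subseteq> (\<Union>y\<in>UNIV. {t. y + t \<in> C})" by blast
  with op obtain F where F: "finite F" "UNIV \<subseteq> (\<Union>y\<in>F. {t. y + t \<in> C})"
    using compactE_image[OF compact_UNIV, of UNIV "\<lambda>y. {t. y + t \<in> C}"] by metis
  have "1 = measure M (\<Union>y\<in>F. {t. y + t \<in> C})"
    using F(2) prob_space space_M by (metis top.extremum_uniqueI)
  also have "\<dots> \<le> (\<Sum>y\<in>F. measure M {t. y + t \<in> C})"
    using F(1) op by (intro finite_measure_subadditive_finite) (auto intro: open_sets)
  also have "\<dots> = card F * measure M C" using assms by (simp add: measure_translate open_sets)
  finally have "measure M C \<noteq> 0" by auto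
  then show ?thesis by (simp add: zero_less_measure_iff)
qed

lemma coef_product_integrable:
  assumes "unitary_rep P" "unitary_rep Q" "i < rep_dim P" "j < rep_dim P" "k < rep_dim Q" "l < rep_dim Q"
  shows "integrable M (\<lambda>t. P t $$ (i, j) * cnj (Q t $$ (k, l)))"
  using unitary_rep_continuous assms by (intro continuous_integrable continuous_intros) auto

text \<open>Left invariance allows the substitution of \<open>s + t\<close> for \<open>t\<close> in the integral.\<close>

lemma schur_intertwiner:
  fixes P Q :: "'a \<Rightarrow> complex mat"
  assumes P: "unitary_rep P" and Q: "unitary_rep Q" and j: "j < rep_dim P" and l: "l < rep_dim Q"
  defines "T \<equiv> mat (rep_dim P) (rep_dim Q) (\<lambda>(i, k). LINT t|M. P t $$ (i, j) * cnj (Q t $$ (k, l)))"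
  shows "P s * T = T * Q s"
proof -
  let ?d = "rep_dim P" and ?e = "rep_dim Q"
  have T: "T \<in> carrier_mat ?d ?e" by (simp add: T_def)
  have Pc: "P s \<in> carrier_mat ?d ?d" and Qc: "Q s \<in> carrier_mat ?e ?e"
    using unitary_rep_carrier P Q by auto
  show ?thesis
  proof (rule eq_matI)
    fix a k assume "a < dim_row (T * Q s)" "k < dim_col (T * Q s)"
    then have ak: "a < ?d" "k < ?e" using T Qc by auto
    have cont: "continuous_on UNIV (\<lambda>t. P t $$ (a, j) * cnj (Q (- s + t) $$ (k, l)))"
    proof -
      have "continuous_on UNIV (\<lambda>t. Q (- s + t) $$ (k, l))"
        using unitary_rep_continuous[OF Q ak(2) l] by (rule continuous_on_compose2) (auto intro!: continuous_intros)
      then show ?thesis using unitary_rep_continuous[OF P ak(1) j] by (intro continuous_intros)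
    qed
    have "(P s * T) $$ (a, k) = (\<Sum>i<?d. P s $$ (a, i) * (LINT t|M. P t $$ (i, j) * cnj (Q t $$ (k, l))))"
      unfolding mat_mult_index[OF Pc T ak] using ak by (simp add: T_def)
    also have "\<dots> = (LINT t|M. (\<Sum>i<?d. P s $$ (a, i) * (P t $$ (i, j) * cnj (Q t $$ (k, l)))))"
      using coef_product_integrable[OF P Q _ j ak(2) l] by (subst Bochner_Integration.integral_sum) auto
    also have "\<dots> = (LINT t|M. P (s + t) $$ (a, j) * cnj (Q (- s + (s + t)) $$ (k, l)))"
      by (simp add: unitary_rep_add[OF P ak(1) j] sum_distrib_right mult.assoc add.assoc[symmetric])
    also have "\<dots> = (LINT t|M. P t $$ (a, j) * cnj (Q (- s + t) $$ (k, l)))"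
      using integral_translate[OF continuous_measurable[OF cont], of s] .
    also have "\<dots> = (LINT t|M. (\<Sum>m<?e. (P t $$ (a, j) * cnj (Q t $$ (m, l))) * Q s $$ (m, k)))"
    proof (rule Bochner_Integration.integral_cong[OF refl])
      fix t
      have "cnj (Q (- s + t) $$ (k, l)) = (\<Sum>m<?e. Q s $$ (m, k) * cnj (Q t $$ (m, l)))"
        unfolding unitary_rep_add[OF Q ak(2) l] cnj_sum
        using ak(2) by (intro sum.cong) (auto simp: unitary_rep_minus[OF Q])
      then show "P t $$ (a, j) * cnj (Q (- s + t) $$ (k, l)) = (\<Sum>m<?e. (P t $$ (a, j) * cnj (Q t $$ (m, l))) * Q s $$ (m, k))"
        by (simp add: sum_distrib_left mult_ac)
    qed
    also have "\<dots> = (\<Sum>m<?e. (LINT t|M. P t $$ (a, j) * cnj (Q t $$ (m, l))) * Q s $$ (m, k))"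
      using coef_product_integrable[OF P Q ak(1) j _ l] by (subst Bochner_Integration.integral_sum) auto
    also have "\<dots> = (T * Q s) $$ (a, k)"
      unfolding mat_mult_index[OF T Qc ak] using ak by (simp add: T_def)
    finally show "(P s * T) $$ (a, k) = (T * Q s) $$ (a, k)" .
  qed (use T Pc Qc in auto)
qed

lemma schur_orthogonality:
  assumes P: "P \<in> irreps" and Q: "Q \<in> irreps" and ne: "\<not> equiv_rep Q P"
    and ij: "i < rep_dim P" "j < rep_dim P" "k < rep_dim Q" "l < rep_dim Q"
  shows "(LINT t|M. P t $$ (i, j) * cnj (Q t $$ (k, l))) = 0"
proof (rule ccontr)
  assume nz: "\<not> ?thesis"
  let ?T = "mat (rep_dim P) (rep_dim Q) (\<lambda>(i, k). LINT t|M. P t $$ (i, j) * cnj (Q t $$ (k, l)))"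
  have "equiv_rep Q P"
  proof (rule schur_equiv[OF P Q, of ?T i k])
    show "P s * ?T = ?T * Q s" for s
      using P Q ij by (intro schur_intertwiner) (auto simp: irreps_def)
  qed (use nz ij in auto)
  with ne show False ..
qed

text \<open>The intertwiner of \<open>schur_intertwiner\<close> is a scalar, found by taking its trace: the columns of \<open>P t\<close> are
  orthonormal.\<close>

lemma schur_orthogonality_self:
  assumes P: "P \<in> irreps"
    and ij: "i < rep_dim P" "j < rep_dim P" "k < rep_dim P" "l < rep_dim P"
  shows "(LINT t|M. P t $$ (i, j) * cnj (P t $$ (k, l))) = (if i = k \<and> j = l then 1 / of_nat (rep_dim P) else 0)"
proof -
  let ?d = "rep_dim P"
  let ?T = "mat ?d ?d (\<lambda>(i, k). LINT t|M. P t $$ (i, j) * cnj (P t $$ (k, l)))"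
  have uP: "unitary_rep P" "irreducible_rep P" using P by (auto simp: irreps_def)
  have "?T * P s = P s * ?T" for s
    using schur_intertwiner[OF uP(1) uP(1) ij(2,4), of s] by simp
  then obtain c where c: "?T = c \<cdot>\<^sub>m 1\<^sub>m ?d"
    using schur_scalar[OF uP, of ?T] by auto
  have T: "(LINT t|M. P t $$ (a, j) * cnj (P t $$ (b, l))) = (if a = b then c else 0)" if "a < ?d" "b < ?d" for a b
  proof -
    have "?T $$ (a, b) = (c \<cdot>\<^sub>m 1\<^sub>m ?d) $$ (a, b)" by (simp only: c)
    with that show ?thesis by (auto split: if_splits)
  qed
  have "of_nat ?d * c = (\<Sum>a<?d. LINT t|M. P t $$ (a, j) * cnj (P t $$ (a, l)))" by (simp add: T)
  also have "\<dots> = (LINT t|M. (\<Sum>a<?d. P t $$ (a, j) * cnj (P t $$ (a, l))))"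
    using coef_product_integrable[OF uP(1) uP(1) _ ij(2) _ ij(4)] by (subst Bochner_Integration.integral_sum) auto
  also have "\<dots> = (if j = l then 1 else 0)"
    unfolding unitary_rep_columns[OF uP(1) ij(2,4)] by (simp add: prob_space)
  finally have "c = (if j = l then 1 / of_nat ?d else 0)"
    using ij by (auto simp: field_simps)
  with T[OF ij(1,3)] show ?thesis by auto
qed

lemma fourier_carrier: "fourier M f P \<in> carrier_mat (irr_dim P) (irr_dim P)"
  by (simp add: fourier_def)

lemma fourier_index:
  "i < irr_dim P \<Longrightarrow> j < irr_dim P \<Longrightarrow>
    fourier M f P $$ (i, j) = (LINT t|M. f t * cnj (rep_of P t $$ (i, j)))"
  by (simp add: fourier_def)

lemma fourier_integrable:
  assumes "continuous_on UNIV f" "P \<in> dual_group" "i < irr_dim P" "j < irr_dim P"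
  shows "integrable M (\<lambda>t. f t * cnj (rep_of P t $$ (i, j)))"
  using unitary_rep_continuous[OF unitary_rep_rep_of[OF assms(2)] assms(3,4)] assms(1)
  by (intro continuous_integrable continuous_intros)

lemma fourier_lin:
  assumes "continuous_on UNIV f" "continuous_on UNIV g" "P \<in> dual_group"
  shows "fourier M (\<lambda>t. a * f t + b * g t) P = a \<cdot>\<^sub>m fourier M f P + b \<cdot>\<^sub>m fourier M g P"
proof (rule eq_matI)
  let ?d = "irr_dim P"
  fix i j assume "i < dim_row (a \<cdot>\<^sub>m fourier M f P + b \<cdot>\<^sub>m fourier M g P)" "j < dim_col (a \<cdot>\<^sub>m fourier M f P + b \<cdot>\<^sub>m fourier M g P)"
  then have ij: "i < ?d" "j < ?d" by (auto simp: fourier_def)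
  have "(LINT t|M. (a * f t + b * g t) * cnj (rep_of P t $$ (i, j)))
    = (LINT t|M. a * (f t * cnj (rep_of P t $$ (i, j))) + b * (g t * cnj (rep_of P t $$ (i, j))))"
    by (simp add: algebra_simps)
  also have "\<dots> = a * (LINT t|M. f t * cnj (rep_of P t $$ (i, j))) + b * (LINT t|M. g t * cnj (rep_of P t $$ (i, j)))"
    using fourier_integrable[OF assms(1,3) ij] fourier_integrable[OF assms(2,3) ij] by simp
  finally show "fourier M (\<lambda>t. a * f t + b * g t) P $$ (i, j) = (a \<cdot>\<^sub>m fourier M f P + b \<cdot>\<^sub>m fourier M g P) $$ (i, j)"
    using ij by (simp add: fourier_def)
qed (auto simp: fourier_def)

lemma fourier_coef:
  assumes "P \<in> dual_group" "Q \<in> dual_group" "k < irr_dim Q" "l < irr_dim Q"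
    "i < irr_dim P" "j < irr_dim P"
  shows "fourier M (\<lambda>t. rep_of Q t $$ (k, l)) P $$ (i, j)
    = (if P = Q \<and> i = k \<and> j = l then 1 / of_nat (irr_dim P) else 0)"
proof (cases "P = Q")
  case True
  then show ?thesis
    using schur_orthogonality_self[OF rep_of_irrep[OF assms(2)] assms(3,4), of i j] assms(5,6)
    by (auto simp: fourier_index)
next
  case False
  then have "\<not> equiv_rep (rep_of P) (rep_of Q)" using dual_group_eqI[OF assms(1,2)] by blast
  then show ?thesis
    using schur_orthogonality[OF rep_of_irrep[OF assms(2)] rep_of_irrep[OF assms(1)] _ assms(3,4,5,6)] False assms(5,6)
    by (simp add: fourier_index)
qed

end

section \<open>Trigonometric polynomials\<close>

text \<open>The span of the matrix entries of the irreducible representations; for a profinite group it turns out to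
  consist of the locally constant functions.\<close>

inductive_set trig :: "('a::topological_group_add \<Rightarrow> complex) set" where
  coef: "P \<in> dual_group \<Longrightarrow> i < irr_dim P \<Longrightarrow> j < irr_dim P \<Longrightarrow> (\<lambda>t. rep_of P t $$ (i, j)) \<in> trig"
| zero: "(\<lambda>t. 0) \<in> trig"
| lin: "f \<in> trig \<Longrightarrow> g \<in> trig \<Longrightarrow> (\<lambda>t. a * f t + b * g t) \<in> trig"

lemma trig_sum:
  assumes "\<And>i. i \<in> I \<Longrightarrow> f i \<in> trig"
  shows "(\<lambda>t. \<Sum>i\<in>I. c i * f i t) \<in> trig"
  using assms
proof (induction I rule: infinite_finite_induct)
  case (insert x F)
  then have "(\<lambda>t. c x * f x t + 1 * (\<Sum>i\<in>F. c i * f i t)) \<in> trig" by (intro trig.lin) auto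
  with insert show ?case by simp
qed (auto intro: trig.zero)

lemma trig_continuous: "f \<in> trig \<Longrightarrow> continuous_on UNIV f"
proof (induction rule: trig.induct)
  case (coef P i j)
  then show ?case by (intro unitary_rep_continuous unitary_rep_rep_of)
qed (auto intro!: continuous_intros)

lemma irrep_coef_trig:
  assumes "\<pi> \<in> irreps" "i < rep_dim \<pi>" "j < rep_dim \<pi>"
  shows "(\<lambda>t. \<pi> t $$ (i, j)) \<in> trig"
proof -
  let ?d = "rep_dim \<pi>"
  obtain P where P: "P \<in> dual_group" "equiv_rep \<pi> (rep_of P)" using dual_group_rep[OF assms(1)] by metis
  then obtain U where U: "unitary_mat ?d U" "\<And>t. U * \<pi> t = rep_of P t * U" and d: "irr_dim P = ?d"
    unfolding equiv_rep_def by metis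
  have Uc: "U \<in> carrier_mat ?d ?d" using U(1) by (simp add: unitary_mat_def)
  have pc: "\<pi> t \<in> carrier_mat ?d ?d" and Pc: "rep_of P t \<in> carrier_mat ?d ?d" for t
    using unitary_rep_carrier[of \<pi>] unitary_rep_carrier[OF unitary_rep_rep_of[OF P(1)]] assms(1) d by (auto simp: irreps_def)
  note Ua = mat_adjoint_carrier[OF Uc]
  have e: "\<pi> t $$ (i, j) = (\<Sum>k<?d. mat_adjoint U $$ (i, k) * (\<Sum>l<?d. U $$ (l, j) * rep_of P t $$ (k, l)))" for t
  proof -
    have PU: "rep_of P t * U \<in> carrier_mat ?d ?d" by (rule mult_carrier_mat[OF Pc Uc])
    have "\<pi> t = (mat_adjoint U * U) * \<pi> t" using U(1) left_mult_one_mat[OF pc] by (simp add: unitary_mat_def)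
    also have "\<dots> = mat_adjoint U * (rep_of P t * U)" unfolding U(2)[symmetric] by (rule assoc_mult_mat[OF Ua Uc pc])
    finally have eq: "\<pi> t = mat_adjoint U * (rep_of P t * U)" .
    have "\<pi> t $$ (i, j) = (mat_adjoint U * (rep_of P t * U)) $$ (i, j)" using eq by (rule arg_cong)
    also have "\<dots> = (\<Sum>k<?d. mat_adjoint U $$ (i, k) * (rep_of P t * U) $$ (k, j))"
      by (rule mat_mult_index[OF Ua PU assms(2,3)])
    also have "\<dots> = (\<Sum>k<?d. mat_adjoint U $$ (i, k) * (\<Sum>l<?d. U $$ (l, j) * rep_of P t $$ (k, l)))"
      using mat_mult_index[OF Pc Uc _ assms(3)] by (intro sum.cong) (auto simp: mult.commute simp del: index_mult_mat)
    finally show ?thesis .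
  qed
  show ?thesis unfolding e using P(1) d by (intro trig_sum trig.coef) auto
qed

text \<open>A reducible unitary representation is, in an orthonormal basis adapted to an invariant subspace
  and its orthogonal complement, block diagonal; so induction on the dimension applies.\<close>

lemma unitary_rep_coef_trig:
  fixes \<rho> :: "'a::topological_group_add \<Rightarrow> complex mat"
  assumes "unitary_rep \<rho>" "i < rep_dim \<rho>" "j < rep_dim \<rho>"
  shows "(\<lambda>t. \<rho> t $$ (i, j)) \<in> trig"
  using assms
proof (induction "rep_dim \<rho>" arbitrary: \<rho> i j rule: less_induct)
  case (less \<rho> i j)
  let ?d = "rep_dim \<rho>"
  have u: "unitary_rep \<rho>" by (rule less.prems(1))
  show ?case
  proof (cases "irreducible_rep \<rho>")
    case True
    with less.prems show ?thesis by (intro irrep_coef_trig) (auto simp: irreps_def)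
  next
    case False
    have "0 < ?d" using less.prems by auto
    with False obtain W where W: "VectorSpace.subspace class_ring W (module_vec TYPE(complex) ?d)"
      "\<And>t v. v \<in> W \<Longrightarrow> \<rho> t *\<^sub>v v \<in> W" "W \<noteq> {0\<^sub>v ?d}" "W \<noteq> carrier_vec ?d"
      unfolding irreducible_rep_def by blast
    note Ws = subspace_module_vecD[OF W(1)]
    define S where "S = (\<lambda>x. vec ?d x \<in> W)"
    have Slin: "S (\<lambda>k. a * x k + b * y k)" if "S x" "S y" for x y a b
    proof -
      have "vec ?d (\<lambda>k. a * x k + b * y k) = a \<cdot>\<^sub>v vec ?d x + b \<cdot>\<^sub>v vec ?d y" by (rule eq_vecI) auto
      then show ?thesis using that Ws(3,4) by (simp add: S_def)
    qed
    have S0: "S (\<lambda>k. 0)"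
    proof -
      have "vec ?d (\<lambda>k. 0 :: complex) = 0\<^sub>v ?d" by (rule eq_vecI) auto
      then show ?thesis using Ws(2) by (simp add: S_def)
    qed
    have Srep: "S (mv ?d (ent (\<rho> t)) x)" if "S x" for t x
    proof -
      have c: "\<rho> t \<in> carrier_mat ?d ?d" by (rule unitary_rep_carrier[OF u])
      have "vec ?d (mv ?d (ent (\<rho> t)) x) = \<rho> t *\<^sub>v vec ?d x"
      proof (rule eq_vecI)
        fix k assume "k < dim_vec (\<rho> t *\<^sub>v vec ?d x)"
        then have k: "k < ?d" using c by simp
        have "vec_index (\<rho> t *\<^sub>v vec ?d x) k = mv ?d (ent (\<rho> t)) (vec_index (vec ?d x)) k"
          by (rule mv_ent[OF c _ k]) simp
        also have "mv ?d (ent (\<rho> t)) (vec_index (vec ?d x)) = mv ?d (ent (\<rho> t)) x" by (rule mv_cong) simp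
        finally show "vec_index (vec ?d (mv ?d (ent (\<rho> t)) x)) k = vec_index (\<rho> t *\<^sub>v vec ?d x) k" using k by simp
      qed (use c in simp)
      with W(2) that show ?thesis by (simp add: S_def)
    qed
    obtain m w where w: "orthonormal ?d m w" "\<And>i. i < m \<Longrightarrow> S (w i)" "\<And>x k. S x \<Longrightarrow> k < ?d \<Longrightarrow> x k = proj ?d m w x k"
      by (rule orthonormal_spanning_extension[of ?d 0 "\<lambda>_ _. 0" S, OF _ _ Slin]) (auto simp: orthonormal_def)
    obtain v where v: "orthonormal ?d ?d v" "\<And>i. i < m \<Longrightarrow> v i = w i" "\<And>x k. k < ?d \<Longrightarrow> x k = proj ?d ?d v x k"
      using orthonormal_completion[OF w(1)] by metis
    have Ssum: "S (\<lambda>k. \<Sum>l<n. c l * w l k)" if "n \<le> m" for n c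
      using that
    proof (induction n)
      case 0 show ?case using S0 by simp
    next
      case (Suc n)
      then have "S (\<lambda>k. 1 * (\<Sum>l<n. c l * w l k) + c n * w n k)" using w(2) by (intro Slin) auto
      then show ?case by simp
    qed
    have m0: "0 < m"
    proof (rule ccontr)
      assume "\<not> 0 < m"
      then have z: "x k = 0" if "S x" "k < ?d" for x k using w(3)[OF that] by (simp add: proj_def)
      have "y = 0\<^sub>v ?d" if "y \<in> W" for y
      proof (rule eq_vecI)
        have yc: "y \<in> carrier_vec ?d" using that Ws(1) by auto
        then show "dim_vec y = dim_vec (0\<^sub>v ?d)" by simp
        have "vec ?d (vec_index y) = y" using yc by (intro eq_vecI) auto
        then have "S (vec_index y)" using that by (simp add: S_def)
        then show "vec_index y k = vec_index (0\<^sub>v ?d) k" if "k < dim_vec (0\<^sub>v ?d :: complex vec)" for k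
          using z that by simp
      qed
      with W(3) Ws(2) show False by blast
    qed
    have md: "m < ?d"
    proof (rule ccontr)
      assume "\<not> m < ?d"
      with orthonormal_card_le[OF w(1)] have md: "m = ?d" by simp
      have "y \<in> W" if y: "y \<in> carrier_vec ?d" for y
      proof -
        have "S (\<lambda>k. \<Sum>l<m. ip ?d (vec_index y) (w l) * w l k)" by (rule Ssum) simp
        moreover have "vec ?d (\<lambda>k. \<Sum>l<m. ip ?d (vec_index y) (w l) * w l k) = y"
        proof (rule eq_vecI)
          fix k assume "k < dim_vec y"
          then have "k < ?d" using y by simp
          from v(3)[OF this, of "vec_index y"] show "vec_index (vec ?d (\<lambda>k. \<Sum>l<m. ip ?d (vec_index y) (w l) * w l k)) k = vec_index y k"
            using \<open>k < ?d\<close> v(2) by (simp add: proj_def md)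
        qed (use y in simp)
        ultimately show ?thesis by (simp add: S_def)
      qed
      with W(4) Ws(1) show False by blast
    qed
    \<comment> \<open>the matrix of \<open>\<rho> t\<close> in the basis \<open>v\<close>, the first \<open>m\<close> members of which span the invariant subspace\<close>
    define c where "c = (\<lambda>t a b. ip ?d (mv ?d (ent (\<rho> t)) (v b)) (v a))"
    have mvadd: "mv ?d (ent (\<rho> (s + t))) x k = mv ?d (ent (\<rho> s)) (mv ?d (ent (\<rho> t)) x) k" if "k < ?d" for s t x k
    proof -
      have "\<rho> (s + t) = \<rho> s * \<rho> t" using u by (simp add: unitary_rep_def)
      then show ?thesis using mv_mult[OF unitary_rep_carrier[OF u] unitary_rep_carrier[OF u] that] by simp
    qed
    have expand: "mv ?d (ent (\<rho> t)) (v b) k = (\<Sum>l<?d. c t l b * v l k)" if "k < ?d" for t b k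
      using v(3)[OF that, of "mv ?d (ent (\<rho> t)) (v b)"] by (simp add: proj_def c_def)
    have cadd: "c (s + t) a b = (\<Sum>l<?d. c s a l * c t l b)" for s t a b
    proof -
      have "c (s + t) a b = ip ?d (mv ?d (ent (\<rho> s)) (mv ?d (ent (\<rho> t)) (v b))) (v a)"
        unfolding c_def by (intro ip_cong mvadd) auto
      also have "mv ?d (ent (\<rho> s)) (mv ?d (ent (\<rho> t)) (v b)) = mv ?d (ent (\<rho> s)) (\<lambda>k. \<Sum>l<?d. c t l b * v l k)"
        using expand by (rule mv_cong)
      also have "ip ?d \<dots> (v a) = (\<Sum>l<?d. c t l b * c s a l)"
        unfolding mv_sum ip_sum_left by (simp add: c_def)
      finally show ?thesis by (simp add: mult.commute)
    qed
    have rid: "mv ?d (ent (\<rho> 0)) x k = x k" if "k < ?d" for x k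
      unfolding unitary_rep_zero[OF u] mv_def using that by (simp add: if_distrib[of "\<lambda>z. z * _"] cong: if_cong)
    have czero: "c 0 a b = (if a = b then 1 else 0)" if "a < ?d" "b < ?d" for a b
    proof -
      have "c 0 a b = ip ?d (v b) (v a)" unfolding c_def using rid by (intro ip_cong) auto
      then show ?thesis using v(1) that by (auto simp: orthonormal_def)
    qed
    have cminus: "c (- t) a b = cnj (c t b a)" for t a b
    proof -
      have "c (- t) a b = ip ?d (mv ?d (ent (\<rho> t)) (mv ?d (ent (\<rho> (- t))) (v b))) (mv ?d (ent (\<rho> t)) (v a))"
        unfolding c_def by (rule unitary_rep_norm[OF u, symmetric])
      also have "\<dots> = ip ?d (v b) (mv ?d (ent (\<rho> t)) (v a))"
      proof (rule ip_cong)
        fix k assume k: "k < ?d"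
        have "mv ?d (ent (\<rho> t)) (mv ?d (ent (\<rho> (- t))) (v b)) k = mv ?d (ent (\<rho> (t + - t))) (v b) k"
          by (rule mvadd[OF k, symmetric])
        then show "mv ?d (ent (\<rho> t)) (mv ?d (ent (\<rho> (- t))) (v b)) k = v b k" using rid[OF k] by simp
      qed simp
      finally show ?thesis unfolding c_def by (simp add: cnj_ip)
    qed
    have ccont: "continuous_on UNIV (\<lambda>t. c t a b)" for a b
      unfolding c_def ip_def mv_def using unitary_rep_continuous[OF u]
      by (intro continuous_on_sum continuous_on_mult continuous_on_const) auto
    have block: "c t a b = 0" if "b < m" "m \<le> a" "a < ?d" for t a b
    proof -
      have "S (mv ?d (ent (\<rho> t)) (v b))" using that w(2) v(2) by (intro Srep) simp
      note e = w(3)[OF this]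
      have "c t a b = ip ?d (proj ?d m w (mv ?d (ent (\<rho> t)) (v b))) (v a)"
        unfolding c_def using e by (intro ip_cong) auto
      also have "\<dots> = (\<Sum>l<m. ip ?d (mv ?d (ent (\<rho> t)) (v b)) (w l) * ip ?d (v l) (v a))"
        unfolding proj_def ip_sum_left using v(2) by simp
      also have "\<dots> = 0" using v(1) that md by (intro sum.neutral) (auto simp: orthonormal_def)
      finally show ?thesis .
    qed
    have block': "c t a b = 0" if "a < m" "m \<le> b" "b < ?d" for t a b
      using block[of a b "- t"] that cminus[of t b a] by simp
    define \<sigma> where "\<sigma> = (\<lambda>t. mat m m (\<lambda>(i, j). c t i j))"
    define \<tau> where "\<tau> = (\<lambda>t. mat (?d - m) (?d - m) (\<lambda>(i, j). c t (m + i) (m + j)))"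
    have split: "(\<Sum>l<?d. f l) = (\<Sum>l<m. f l) + (\<Sum>l<?d-m. f (m + l))" for f :: "nat \<Rightarrow> complex"
    proof -
      have "{..<?d} = {..<m} \<union> {m..<?d}" using md by auto
      then have "(\<Sum>l<?d. f l) = (\<Sum>l<m. f l) + (\<Sum>l\<in>{m..<?d}. f l)" by (simp add: sum.union_disjoint ivl_disj_int)
      also have "(\<Sum>l\<in>{m..<?d}. f l) = (\<Sum>l<?d-m. f (m + l))"
        by (rule sum.reindex_bij_witness[of _ "\<lambda>l. m + l" "\<lambda>l. l - m"]) auto
      finally show ?thesis .
    qed
    have \<sigma>d: "rep_dim \<sigma> = m" by (simp add: rep_dim_def \<sigma>_def)
    have \<sigma>: "unitary_rep \<sigma>"
      unfolding \<sigma>_def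
    proof (rule unitary_rep_of_entries[of m c])
      fix s t i j assume "i < m" "j < m"
      then show "c (s + t) i j = (\<Sum>k<m. c s i k * c t k j)"
        unfolding cadd split using md by (simp add: block block')
    qed (use md czero cminus ccont in auto)
    have \<tau>d: "rep_dim \<tau> = ?d - m" by (simp add: rep_dim_def \<tau>_def)
    have \<tau>: "unitary_rep \<tau>"
      unfolding \<tau>_def
    proof (rule unitary_rep_of_entries[of "?d - m" "\<lambda>t i j. c t (m + i) (m + j)"])
      fix s t i j assume "i < ?d - m" "j < ?d - m"
      then show "c (s + t) (m + i) (m + j) = (\<Sum>k<?d-m. c s (m + i) (m + k) * c t (m + k) (m + j))"
        unfolding cadd split using md by (simp add: block block')
    qed (use md czero cminus ccont in auto)
    have ctrig: "(\<lambda>t. c t a b) \<in> trig" if "a < ?d" "b < ?d" for a b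
    proof (cases "a < m \<longleftrightarrow> b < m")
      case True
      show ?thesis
      proof (cases "a < m")
        case True
        with \<open>a < m \<longleftrightarrow> b < m\<close> have ab: "a < m" "b < m" by auto
        have "(\<lambda>t. \<sigma> t $$ (a, b)) \<in> trig" using less.hyps[of \<sigma> a b] \<sigma> \<sigma>d md ab by simp
        then show ?thesis using ab by (simp add: \<sigma>_def)
      next
        case False
        with \<open>a < m \<longleftrightarrow> b < m\<close> that have ab: "a - m < ?d - m" "b - m < ?d - m" "m + (a - m) = a" "m + (b - m) = b" by auto
        have "(\<lambda>t. \<tau> t $$ (a - m, b - m)) \<in> trig" using less.hyps[of \<tau> "a - m" "b - m"] \<tau> \<tau>d m0 md ab by simp
        then show ?thesis using ab by (simp add: \<tau>_def)
      qed
    next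
      case False
      then have "(\<lambda>t. c t a b) = (\<lambda>t. 0)" using that block block' by (cases "a < m") auto
      then show ?thesis by (simp add: trig.zero)
    qed
    have e: "\<rho> t $$ (i, j) = (\<Sum>b<?d. cnj (v b j) * (\<Sum>a<?d. v a i * c t a b))" for t
    proof -
      let ?e = "\<lambda>k. if k = j then 1 else 0 :: complex"
      have "\<rho> t $$ (i, j) = mv ?d (ent (\<rho> t)) ?e i"
        using less.prems by (simp add: mv_def if_distrib[of "\<lambda>z. _ * z"] cong: if_cong)
      also have "mv ?d (ent (\<rho> t)) ?e = mv ?d (ent (\<rho> t)) (proj ?d ?d v ?e)"
        by (rule mv_cong) (rule v(3))
      also have "\<dots> i = (\<Sum>b<?d. ip ?d ?e (v b) * mv ?d (ent (\<rho> t)) (v b) i)"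
        unfolding proj_def mv_sum ..
      also have "\<dots> = (\<Sum>b<?d. cnj (v b j) * (\<Sum>a<?d. v a i * c t a b))"
        using less.prems by (simp add: ip_unit expand mult.commute)
      finally show ?thesis .
    qed
    show ?thesis unfolding e using ctrig by (intro trig_sum) auto
  qed
qed

text \<open>For an open subgroup \<open>N\<close> with \<open>C + N = C\<close>, the indicator of \<open>C\<close> is a sum of matrix entries of
  the permutation representation of the group on the finite set of cosets of \<open>N\<close>.\<close>

lemma clopen_indicator_trig:
  fixes C :: "'a::{topological_group_add, t2_space} set"
  assumes "compact (UNIV :: 'a set)" "open C" "closed C"
  shows "indicator C \<in> trig"
proof -
  obtain N where N: "open N" "add_subgroup N" "\<And>c n. n \<in> N \<Longrightarrow> c + n \<in> C \<longleftrightarrow> c \<in> C"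
    using clopen_stabilizer[OF assms] by metis
  have N0: "0 \<in> N" and Nadd: "\<And>x y. x \<in> N \<Longrightarrow> y \<in> N \<Longrightarrow> x + y \<in> N" and Nm: "\<And>x. x \<in> N \<Longrightarrow> - x \<in> N"
    using N(2) by (auto simp: add_subgroup_def)
  \<comment> \<open>the coset \<open>x + N\<close>\<close>
  define K where "K = (\<lambda>x. {z. - x + z \<in> N})"
  have Kop: "open (K x)" for x unfolding K_def by (rule open_left_translate[OF N(1)])
  have Kself: "x \<in> K x" for x using N0 by (simp add: K_def)
  have Keq: "K x = K y \<longleftrightarrow> - x + y \<in> N" for x y
  proof
    assume "K x = K y"
    have "y \<in> K x" unfolding \<open>K x = K y\<close> by (rule Kself)
    then show "- x + y \<in> N" by (simp add: K_def)
  next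
    assume h: "- x + y \<in> N"
    have "- x + z \<in> N \<longleftrightarrow> - y + z \<in> N" for z
    proof
      assume "- x + z \<in> N"
      from Nadd[OF Nm[OF h] this] show "- y + z \<in> N" by (simp add: minus_add add.assoc)
    next
      assume "- y + z \<in> N"
      from Nadd[OF h this] show "- x + z \<in> N" by (simp add: add.assoc)
    qed
    then show "K x = K y" by (simp add: K_def)
  qed
  have cov: "UNIV \<subseteq> (\<Union>x\<in>UNIV. K x)" using Kself by auto
  obtain F where F: "F \<subseteq> UNIV" "finite F" "UNIV \<subseteq> (\<Union>x\<in>F. K x)"
    by (rule compactE_image[OF assms(1) Kop cov]) auto
  have rK: "range K \<subseteq> K ` F"
  proof
    fix A assume "A \<in> range K"
    then obtain y where y: "A = K y" by auto
    obtain x where "x \<in> F" "y \<in> K x" using F(3) by blast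
    then have "K x = K y" unfolding Keq by (simp add: K_def)
    with y \<open>x \<in> F\<close> show "A \<in> K ` F" by auto
  qed
  have fin: "finite (range K)" using finite_subset[OF rK] F(2) by simp
  define m where "m = card (range K)"
  obtain h where h: "bij_betw h {..<m} (range K)"
    using ex_bij_betw_nat_finite[OF fin] by (auto simp: m_def lessThan_atLeast0)
  have "\<exists>x. \<forall>a<m. h a = K (x a)"
  proof -
    have "h ` {..<m} = range K" using h by (simp add: bij_betw_def)
    then have "\<forall>a\<in>{..<m}. \<exists>y. h a = K y" by blast
    then obtain x where "\<forall>a\<in>{..<m}. h a = K (x a)" unfolding bchoice_iff by blast
    then show ?thesis by (intro exI[of _ x]) auto
  qed
  then obtain x where x: "\<And>a. a < m \<Longrightarrow> h a = K (x a)" by blast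
  have ex1: "\<exists>!a. a < m \<and> K (x a) = K y" for y
  proof -
    have "K y \<in> h ` {..<m}" using h by (auto simp: bij_betw_def)
    then obtain a where "a < m" "h a = K y" by auto
    with x h show ?thesis
      by (intro ex1I[of _ a]) (auto simp: bij_betw_def inj_on_def)
  qed
  have sumK: "(\<Sum>a<m. if K (x a) = K y then f a else 0) = f (THE a. a < m \<and> K (x a) = K y)" for y and f :: "nat \<Rightarrow> complex"
  proof -
    let ?a = "THE a. a < m \<and> K (x a) = K y"
    have a: "?a < m" "K (x ?a) = K y" using theI'[OF ex1[of y]] by auto
    have "(\<Sum>a<m. if K (x a) = K y then f a else 0) = (\<Sum>a<m. if a = ?a then f a else 0)"
      using ex1[of y] a by (intro sum.cong) auto
    with a show ?thesis by simp
  qed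
  have Ktr: "K (s + y) = K (s + z) \<longleftrightarrow> K y = K z" for s y z
    unfolding Keq by (simp add: minus_add add.assoc del: add_uminus_conv_diff)
  define c where "c = (\<lambda>t a b. if K (x a) = K (t + x b) then 1 else 0 :: complex)"
  define \<rho> where "\<rho> = (\<lambda>t. mat m m (\<lambda>(i, j). c t i j))"
  have \<rho>d: "rep_dim \<rho> = m" by (simp add: rep_dim_def \<rho>_def)
  have \<rho>: "unitary_rep \<rho>"
    unfolding \<rho>_def
  proof (rule unitary_rep_of_entries[of m c])
    fix s t i j assume ij: "i < m" "j < m"
    let ?a = "THE a. a < m \<and> K (x a) = K (t + x j)"
    have a: "K (x ?a) = K (t + x j)" using theI'[OF ex1[of "t + x j"]] by auto
    have "(\<Sum>k<m. c s i k * c t k j) = (\<Sum>k<m. if K (x k) = K (t + x j) then c s i k else 0)"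
      by (intro sum.cong) (simp_all add: c_def)
    also have "\<dots> = c s i ?a" by (rule sumK)
    also have "\<dots> = c (s + t) i j"
      unfolding c_def using Ktr[of s "x ?a" "t + x j"] a by (simp add: add.assoc)
    finally show "c (s + t) i j = (\<Sum>k<m. c s i k * c t k j)" ..
  next
    fix i j assume ij: "i < m" "j < m"
    then have "i = j" if "K (x i) = K (x j)" using ex1[of "x j"] that by blast
    then show "c 0 i j = (if i = j then 1 else 0)" unfolding c_def by auto
  next
    fix t i j
    have "K (x i) = K (- t + x j) \<longleftrightarrow> K (t + x i) = K (t + (- t + x j))" by (rule Ktr[symmetric])
    then show "c (- t) i j = cnj (c t j i)" by (auto simp: c_def add.assoc[symmetric])
  next
    fix i j
    have lc: "locally_constant K"
    proof (rule locally_constant_subgroup[OF N(1) N0])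
      show "K (x + n) = K x" if "n \<in> N" for x n
        using Nm[OF that] by (simp add: Keq minus_add add.assoc)
    qed
    have cr: "continuous_on UNIV (\<lambda>t. t + x j)" by (intro continuous_intros)
    have "locally_constant (\<lambda>t. K (t + x j))"
      unfolding locally_constant_def
    proof
      fix A
      have "open ((\<lambda>t. t + x j) -` (K -` {A}))"
        using lc by (intro open_vimage[OF _ cr]) (simp add: locally_constant_def)
      then show "open ((\<lambda>t. K (t + x j)) -` {A})" by (simp add: vimage_def)
    qed
    then show "continuous_on UNIV (\<lambda>t. c t i j)"
      unfolding c_def
      using locally_constant_binop[of "\<lambda>t. K (t + x j)" "\<lambda>t. K (t + x j)" "\<lambda>A B. if K (x i) = A then 1 else 0"]
      by (intro locally_constant_continuous) auto
  qed
  \<comment> \<open>\<open>t\<close> moves the coset of \<open>0\<close> to that of \<open>t\<close>, so column \<open>b\<close> of the representation records the coset of \<open>t\<close>\<close>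
  obtain b where b: "b < m" "K (x b) = K 0" using theI'[OF ex1[of 0]] by metis
  have cb: "c t a b = (if K (x a) = K t then 1 else 0)" for t a
    using Ktr[of t "x b" 0] b(2) by (simp add: c_def)
  have KC: "y \<in> C \<longleftrightarrow> z \<in> C" if "K y = K z" for y z
  proof -
    have "- y + z \<in> N" using that by (simp add: Keq)
    from N(3)[OF this, of y] show ?thesis by (simp add: add.assoc[symmetric])
  qed
  have "indicator C t = (\<Sum>a<m. (if x a \<in> C then 1 else 0) * \<rho> t $$ (a, b))" for t
  proof -
    let ?a = "THE a. a < m \<and> K (x a) = K t"
    have a: "K (x ?a) = K t" using theI'[OF ex1[of t]] by auto
    have "(\<Sum>a<m. (if x a \<in> C then 1 else 0) * \<rho> t $$ (a, b)) = (\<Sum>a<m. if K (x a) = K t then if x a \<in> C then 1 else 0 else 0)"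
      using b(1) by (intro sum.cong) (auto simp: \<rho>_def cb)
    also have "\<dots> = (if x ?a \<in> C then 1 else 0)" by (rule sumK)
    also have "\<dots> = indicator C t" using KC[OF a] by (simp add: indicator_def)
    finally show ?thesis ..
  qed
  then have "indicator C = (\<lambda>t. \<Sum>a<m. (if x a \<in> C then 1 else 0) * \<rho> t $$ (a, b))" by auto
  also have "\<dots> \<in> trig" using \<rho> \<rho>d b(1) by (intro trig_sum unitary_rep_coef_trig) auto
  finally show ?thesis .
qed

lemma locally_constant_trig:
  fixes f :: "'a::{topological_group_add, t2_space} \<Rightarrow> complex"
  assumes "compact (UNIV :: 'a set)" "locally_constant f"
  shows "f \<in> trig"
  using assms
proof (induction rule: locally_constant_induct)
  case (indicator C)
  then show ?case using clopen_indicator_trig[OF assms(1)] by blast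
next
  case (lin f g a b)
  then show ?case by (intro trig.lin)
qed

context profinite_group
begin

section \<open>Completeness of the irreducible representations\<close>

lemma fourier_eq_0_iff:
  "fourier M f P = 0\<^sub>m (irr_dim P) (irr_dim P) \<longleftrightarrow>
    (\<forall>i<irr_dim P. \<forall>j<irr_dim P. fourier M f P $$ (i, j) = 0)"
  using fourier_carrier[of f P] by (auto intro!: eq_matI)

text \<open>By orthogonality an entry of \<open>Q\<close> has no Fourier coefficient outside \<open>Q\<close>.\<close>

lemma trig_fourier_finite:
  assumes "f \<in> trig"
  shows "finite {P \<in> dual_group. fourier M f P \<noteq> 0\<^sub>m (irr_dim P) (irr_dim P)}"
  using assms
proof (induction rule: trig.induct)
  case (coef Q k l)
  have "fourier M (\<lambda>t. rep_of Q t $$ (k, l)) P = 0\<^sub>m (irr_dim P) (irr_dim P)"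
    if "P \<in> dual_group" "P \<noteq> Q" for P
    unfolding fourier_eq_0_iff using fourier_coef[OF that(1) coef] that(2) by simp
  then have "{P \<in> dual_group. fourier M (\<lambda>t. rep_of Q t $$ (k, l)) P \<noteq> 0\<^sub>m (irr_dim P) (irr_dim P)} \<subseteq> {Q}"
    by blast
  then show ?case by (rule finite_subset) simp
next
  case zero
  have "{P \<in> dual_group. fourier M (\<lambda>t. 0) P \<noteq> 0\<^sub>m (irr_dim P) (irr_dim P)} = {}"
    by (auto simp: fourier_eq_0_iff fourier_index)
  then show ?case by (simp only: finite.emptyI)
next
  case (lin f g a b)
  have "{P \<in> dual_group. fourier M (\<lambda>t. a * f t + b * g t) P \<noteq> 0\<^sub>m (irr_dim P) (irr_dim P)}
    \<subseteq> {P \<in> dual_group. fourier M f P \<noteq> 0\<^sub>m (irr_dim P) (irr_dim P)}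
      \<union> {P \<in> dual_group. fourier M g P \<noteq> 0\<^sub>m (irr_dim P) (irr_dim P)}"
    using fourier_lin[OF trig_continuous[OF lin.hyps(1)] trig_continuous[OF lin.hyps(2)]] by auto
  with lin.IH show ?case by (auto intro: finite_subset)
qed

lemma fourier_zero_integral_trig:
  assumes \<psi>: "continuous_on UNIV \<psi>"
    and z: "\<And>P. P \<in> dual_group \<Longrightarrow> fourier M \<psi> P = 0\<^sub>m (irr_dim P) (irr_dim P)"
    and f: "f \<in> trig"
  shows "(LINT t|M. \<psi> t * cnj (f t)) = 0"
  using f
proof (induction rule: trig.induct)
  case (coef P i j)
  then have "fourier M \<psi> P $$ (i, j) = 0" using z[OF coef(1)] by simp
  with coef show ?case by (simp add: fourier_index)
next
  case (lin f g a b)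
  have i: "integrable M (\<lambda>t. \<psi> t * cnj (f t))" "integrable M (\<lambda>t. \<psi> t * cnj (g t))"
    using \<psi> trig_continuous lin.hyps by (auto intro!: continuous_integrable continuous_intros)
  have "(LINT t|M. \<psi> t * cnj (a * f t + b * g t)) = (LINT t|M. cnj a * (\<psi> t * cnj (f t)) + cnj b * (\<psi> t * cnj (g t)))"
    by (simp add: algebra_simps)
  also have "\<dots> = 0" using i lin.IH by simp
  finally show ?case .
qed simp

text \<open>If \<open>\<psi>(x) \<noteq> 0\<close>, then \<open>\<psi>\<close> has nonzero integral over a small clopen neighbourhood of \<open>x\<close>, the
  indicator of which is a trigonometric polynomial.\<close>

lemma fourier_injective:
  assumes \<psi>: "continuous_on UNIV \<psi>"
    and z: "\<And>P. P \<in> dual_group \<Longrightarrow> fourier M \<psi> P = 0\<^sub>m (irr_dim P) (irr_dim P)"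
  shows "\<psi> x = 0"
proof (rule ccontr)
  assume nz: "\<psi> x \<noteq> 0"
  define U where "U = {t. cmod (\<psi> t - \<psi> x) < cmod (\<psi> x) / 2}"
  have "open U" unfolding U_def using \<psi> by (intro open_Collect_less continuous_intros)
  moreover have "x \<in> U" using nz by (simp add: U_def)
  ultimately obtain C where C: "open C" "closed C" "{x} \<subseteq> C" "C \<subseteq> U"
    using clopen_between[OF compact_UNIV totally_disconnected_UNIV, of "{x}" U] by auto
  let ?i = "indicator C :: 'a \<Rightarrow> complex"
  have ic: "continuous_on UNIV ?i" by (rule locally_constant_continuous[OF locally_constant_indicator[OF C(1,2)]])
  have pos: "measure M C > 0" using C(1,3) by (intro measure_open_pos) auto
  have "(LINT t|M. \<psi> t * cnj (?i t)) = 0"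
    by (rule fourier_zero_integral_trig[OF \<psi> z clopen_indicator_trig[OF compact_UNIV C(1,2)]])
  moreover have "cnj (?i t) = ?i t" for t by (cases "t \<in> C") auto
  ultimately have 0: "(LINT t|M. \<psi> t * ?i t) = 0" by simp
  have int: "integrable M (\<lambda>t. \<psi> t * ?i t)" "integrable M ?i"
    using \<psi> ic by (auto intro!: continuous_integrable continuous_intros)
  have "(LINT t|M. (\<psi> t - \<psi> x) * ?i t) = (LINT t|M. \<psi> t * ?i t - \<psi> x * ?i t)" by (simp add: algebra_simps)
  also have "\<dots> = - (\<psi> x * (LINT t|M. ?i t))" using int 0 by simp
  also have "(LINT t|M. ?i t) = (LINT t|M. complex_of_real (indicator C t))"
    by (intro Bochner_Integration.integral_cong) (auto simp: indicator_def)
  also have "\<dots> = of_real (measure M C)" using open_sets[OF C(1)] by (simp add: space_M)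
  finally have "cmod (\<psi> x) * measure M C = cmod (LINT t|M. (\<psi> t - \<psi> x) * ?i t)" by (simp add: norm_mult)
  also have "\<dots> \<le> (LINT t|M. cmod ((\<psi> t - \<psi> x) * ?i t))" by (rule integral_norm_bound)
  also have "\<dots> \<le> (LINT t|M. cmod (\<psi> x) / 2 * indicator C t)"
  proof (rule integral_mono)
    have "integrable M (\<lambda>t. (\<psi> t - \<psi> x) * ?i t)"
      using \<psi> ic by (auto intro!: continuous_integrable continuous_intros)
    then show "integrable M (\<lambda>t. cmod ((\<psi> t - \<psi> x) * ?i t))" by (rule integrable_norm)
    show "integrable M (\<lambda>t. cmod (\<psi> x) / 2 * indicator C t)"
      using open_sets[OF C(1)] by (simp add: emeasure_eq_measure)
    show "cmod ((\<psi> t - \<psi> x) * ?i t) \<le> cmod (\<psi> x) / 2 * indicator C t" for t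
      using C(4) by (auto simp: U_def indicator_def)
  qed
  also have "\<dots> = cmod (\<psi> x) / 2 * measure M C" using open_sets[OF C(1)] by (simp add: space_M)
  finally show False using pos nz by simp
qed

end

section \<open>Square integrable functions\<close>

lemma L2_measurable: "\<xi> \<in> L2 M \<Longrightarrow> \<xi> \<in> borel_measurable M"
  by (simp add: L2_def)

lemma L2_square_integrable: "\<xi> \<in> L2 M \<Longrightarrow> integrable M (\<lambda>t. (cmod (\<xi> t))\<^sup>2)"
  by (simp add: L2_def)

lemma L2_norm_nonneg: "0 \<le> L2_norm M \<xi>"
  by (simp add: L2_norm_def)

lemma L2_norm_sq: "(L2_norm M \<xi>)\<^sup>2 = (LINT t|M. (cmod (\<xi> t))\<^sup>2)"
  by (simp add: L2_norm_def)

lemma L2_add_sq_bound: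
  "(cmod (a * x + b * y))\<^sup>2 \<le> 2 * (cmod a)\<^sup>2 * (cmod x)\<^sup>2 + 2 * (cmod b)\<^sup>2 * (cmod y)\<^sup>2"
proof -
  have "(cmod (a * x + b * y))\<^sup>2 \<le> (cmod (a * x) + cmod (b * y))\<^sup>2"
    by (intro power_mono norm_triangle_ineq) auto
  also have "\<dots> \<le> 2 * (cmod (a * x))\<^sup>2 + 2 * (cmod (b * y))\<^sup>2"
    using sum_squares_bound[of "cmod (a * x)" "cmod (b * y)"] by (simp add: power2_sum)
  finally show ?thesis by (simp add: norm_mult power_mult_distrib mult.assoc)
qed

lemma L2_lin:
  assumes "\<xi> \<in> L2 M" "\<eta> \<in> L2 M" shows "(\<lambda>t. a * \<xi> t + b * \<eta> t) \<in> L2 M"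
proof -
  note [measurable] = L2_measurable[OF assms(1)] L2_measurable[OF assms(2)]
  have i: "integrable M (\<lambda>t. 2 * (cmod a)\<^sup>2 * (cmod (\<xi> t))\<^sup>2 + 2 * (cmod b)\<^sup>2 * (cmod (\<eta> t))\<^sup>2)"
    using L2_square_integrable[OF assms(1)] L2_square_integrable[OF assms(2)] by simp
  have "integrable M (\<lambda>t. (cmod (a * \<xi> t + b * \<eta> t))\<^sup>2)"
  proof (rule Bochner_Integration.integrable_bound[OF i])
    show "AE t in M. norm ((cmod (a * \<xi> t + b * \<eta> t))\<^sup>2) \<le> norm (2 * (cmod a)\<^sup>2 * (cmod (\<xi> t))\<^sup>2 + 2 * (cmod b)\<^sup>2 * (cmod (\<eta> t))\<^sup>2)"
      using L2_add_sq_bound by (intro AE_I2) auto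
  qed measurable
  then show ?thesis by (simp add: L2_def)
qed

lemma L2_zero: "(\<lambda>t. 0) \<in> L2 M"
  by (simp add: L2_def)

lemma L2_scale: "\<xi> \<in> L2 M \<Longrightarrow> (\<lambda>t. a * \<xi> t) \<in> L2 M"
  using L2_lin[of \<xi> M \<xi> a 0] by simp

lemma L2_sum: "(\<And>i. i \<in> I \<Longrightarrow> \<xi> i \<in> L2 M) \<Longrightarrow> (\<lambda>t. \<Sum>i\<in>I. c i * \<xi> i t) \<in> L2 M"
proof (induction I rule: infinite_finite_induct)
  case (insert i I)
  then have "(\<lambda>t. c i * \<xi> i t + 1 * (\<Sum>i\<in>I. c i * \<xi> i t)) \<in> L2 M" by (intro L2_lin) auto
  with insert show ?case by simp
qed (auto intro: L2_zero)

lemma measurable_cnj [measurable (raw)]: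
  "f \<in> borel_measurable M \<Longrightarrow> (\<lambda>t. cnj (f t)) \<in> borel_measurable M"
  by (rule measurable_compose[OF _ borel_measurable_continuous_onI[OF linear_continuous_on[OF bounded_linear_cnj]]])

lemma L2_product_integrable:
  assumes "\<xi> \<in> L2 M" "\<eta> \<in> L2 M" shows "integrable M (\<lambda>t. \<xi> t * cnj (\<eta> t))"
proof -
  note [measurable] = L2_measurable[OF assms(1)] L2_measurable[OF assms(2)]
  have i: "integrable M (\<lambda>t. (cmod (\<xi> t))\<^sup>2 + (cmod (\<eta> t))\<^sup>2)"
    using L2_square_integrable[OF assms(1)] L2_square_integrable[OF assms(2)] by simp
  show ?thesis
  proof (rule Bochner_Integration.integrable_bound[OF i])
    have "cmod x * cmod y \<le> (cmod x)\<^sup>2 + (cmod y)\<^sup>2" for x y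
    proof -
      have "2 * (cmod x * cmod y) \<le> (cmod x)\<^sup>2 + (cmod y)\<^sup>2" using sum_squares_bound[of "cmod x" "cmod y"] by simp
      moreover have "0 \<le> cmod x * cmod y" by simp
      ultimately show ?thesis by linarith
    qed
    then show "AE t in M. norm (\<xi> t * cnj (\<eta> t)) \<le> norm ((cmod (\<xi> t))\<^sup>2 + (cmod (\<eta> t))\<^sup>2)"
      by (intro AE_I2) (simp add: norm_mult)
  qed measurable
qed

lemma L2_cauchy_schwarz:
  assumes "\<xi> \<in> L2 M" "\<eta> \<in> L2 M" shows "cmod (L2_inner M \<xi> \<eta>) \<le> L2_norm M \<xi> * L2_norm M \<eta>"
proof -
  note [measurable] = L2_measurable[OF assms(1)] L2_measurable[OF assms(2)]
  have ip: "integrable M (\<lambda>t. cmod (\<xi> t) * cmod (\<eta> t))"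
    using integrable_norm[OF L2_product_integrable[OF assms]] by (simp add: norm_mult)
  define I where "I = (LINT t|M. cmod (\<xi> t) * cmod (\<eta> t))"
  have I0: "0 \<le> I" unfolding I_def by simp
  have sq: "(\<integral>\<^sup>+t. ennreal (cmod (\<zeta> t)) ^ 2 \<partial>M) = ennreal ((L2_norm M \<zeta>)\<^sup>2)" if "\<zeta> \<in> L2 M" for \<zeta>
    unfolding L2_norm_sq using nn_integral_eq_integral[OF L2_square_integrable[OF that]] by (simp add: ennreal_power)
  have "(\<integral>\<^sup>+t. ennreal (cmod (\<xi> t)) * ennreal (cmod (\<eta> t)) \<partial>M)\<^sup>2
      \<le> (\<integral>\<^sup>+t. ennreal (cmod (\<xi> t)) ^ 2 \<partial>M) * (\<integral>\<^sup>+t. ennreal (cmod (\<eta> t)) ^ 2 \<partial>M)"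
    by (rule Cauchy_Schwarz_nn_integral) measurable
  also have "(\<integral>\<^sup>+t. ennreal (cmod (\<xi> t)) * ennreal (cmod (\<eta> t)) \<partial>M) = ennreal I"
    unfolding I_def using nn_integral_eq_integral[OF ip] by (simp add: ennreal_mult)
  finally have "ennreal (I\<^sup>2) \<le> ennreal ((L2_norm M \<xi>)\<^sup>2 * (L2_norm M \<eta>)\<^sup>2)"
    using I0 unfolding sq[OF assms(1)] sq[OF assms(2)] by (simp add: ennreal_power ennreal_mult)
  then have "I\<^sup>2 \<le> (L2_norm M \<xi> * L2_norm M \<eta>)\<^sup>2" by (simp add: power_mult_distrib)
  then have "I \<le> L2_norm M \<xi> * L2_norm M \<eta>"
    by (rule power2_le_imp_le) (simp add: L2_norm_nonneg)
  moreover have "cmod (L2_inner M \<xi> \<eta>) \<le> I"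
    unfolding L2_inner_def I_def using integral_norm_bound[of M "\<lambda>t. \<xi> t * cnj (\<eta> t)"] by (simp add: norm_mult)
  ultimately show ?thesis by simp
qed

lemma L2_inner_lin:
  assumes "\<xi> \<in> L2 M" "\<eta> \<in> L2 M" "\<zeta> \<in> L2 M"
  shows "L2_inner M (\<lambda>t. a * \<xi> t + b * \<eta> t) \<zeta> = a * L2_inner M \<xi> \<zeta> + b * L2_inner M \<eta> \<zeta>"
proof -
  have "L2_inner M (\<lambda>t. a * \<xi> t + b * \<eta> t) \<zeta> = (LINT t|M. a * (\<xi> t * cnj (\<zeta> t)) + b * (\<eta> t * cnj (\<zeta> t)))"
    unfolding L2_inner_def by (simp add: algebra_simps)
  then show ?thesis
    using L2_product_integrable[OF assms(1,3)] L2_product_integrable[OF assms(2,3)] by (simp add: L2_inner_def)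
qed

lemma L2_inner_sum:
  assumes "\<And>i. i \<in> I \<Longrightarrow> \<xi> i \<in> L2 M" "\<zeta> \<in> L2 M"
  shows "L2_inner M (\<lambda>t. \<Sum>i\<in>I. c i * \<xi> i t) \<zeta> = (\<Sum>i\<in>I. c i * L2_inner M (\<xi> i) \<zeta>)"
  using assms(1)
proof (induction I rule: infinite_finite_induct)
  case (insert i I)
  have "L2_inner M (\<lambda>t. c i * \<xi> i t + 1 * (\<Sum>i\<in>I. c i * \<xi> i t)) \<zeta> = c i * L2_inner M (\<xi> i) \<zeta> + 1 * L2_inner M (\<lambda>t. \<Sum>i\<in>I. c i * \<xi> i t) \<zeta>"
    using insert.prems assms(2) by (intro L2_inner_lin L2_sum) auto
  with insert show ?case by simp
qed (auto simp: L2_inner_def)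

lemma L2_norm_scale: "L2_norm M (\<lambda>t. a * \<xi> t) = cmod a * L2_norm M \<xi>"
proof -
  have "(LINT t|M. (cmod (a * \<xi> t))\<^sup>2) = (cmod a)\<^sup>2 * (LINT t|M. (cmod (\<xi> t))\<^sup>2)"
    by (simp add: norm_mult power_mult_distrib)
  then show ?thesis by (simp add: L2_norm_def real_sqrt_mult)
qed

lemma L2_norm_AE_cong:
  assumes "\<xi> \<in> L2 M" "\<xi>' \<in> L2 M" "AE t in M. \<xi> t = \<xi>' t"
  shows "L2_norm M \<xi> = L2_norm M \<xi>'"
proof -
  note [measurable] = L2_measurable[OF assms(1)] L2_measurable[OF assms(2)]
  have "(LINT t|M. (cmod (\<xi> t))\<^sup>2) = (LINT t|M. (cmod (\<xi>' t))\<^sup>2)"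
    using assms(3) by (intro integral_cong_AE) auto
  then show ?thesis by (simp add: L2_norm_def)
qed

section \<open>Normal functionals\<close>

lemma bounded_opsD:
  assumes "T \<in> bounded_ops M"
  obtains B where "0 \<le> B" "\<And>\<xi>. \<xi> \<in> L2 M \<Longrightarrow> T \<xi> \<in> L2 M" "\<And>\<xi>. \<xi> \<in> L2 M \<Longrightarrow> L2_norm M (T \<xi>) \<le> B * L2_norm M \<xi>"
    "\<And>\<xi> \<eta> a b. \<xi> \<in> L2 M \<Longrightarrow> \<eta> \<in> L2 M \<Longrightarrow> AE t in M. T (\<lambda>x. a * \<xi> x + b * \<eta> x) t = a * T \<xi> t + b * T \<eta> t"
proof -
  from assms obtain B where B: "\<forall>\<xi>\<in>L2 M. L2_norm M (T \<xi>) \<le> B * L2_norm M \<xi>" by (auto simp: bounded_ops_def)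
  have "L2_norm M (T \<xi>) \<le> \<bar>B\<bar> * L2_norm M \<xi>" if "\<xi> \<in> L2 M" for \<xi>
    using B that mult_right_mono[of B "\<bar>B\<bar>" "L2_norm M \<xi>"] L2_norm_nonneg[of M \<xi>] by force
  with assms show thesis by (intro that[of "\<bar>B\<bar>"]) (auto simp: bounded_ops_def)
qed

text \<open>Names the sequences of vectors that \<open>normal_functionals\<close> hides behind a quantifier; the bounds below are in
  terms of their norms.\<close>

definition normal_functional :: "'a measure \<Rightarrow> (nat \<Rightarrow> 'a \<Rightarrow> complex) \<Rightarrow> (nat \<Rightarrow> 'a \<Rightarrow> complex) \<Rightarrow> 'a op \<Rightarrow> complex" where
  "normal_functional M \<xi> \<eta> = (\<lambda>T. \<Sum>k. L2_inner M (T (\<xi> k)) (\<eta> k))"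

definition l2_sequence :: "'a measure \<Rightarrow> (nat \<Rightarrow> 'a \<Rightarrow> complex) \<Rightarrow> bool" where
  "l2_sequence M \<xi> \<longleftrightarrow> (\<forall>k. \<xi> k \<in> L2 M) \<and> summable (\<lambda>k. (L2_norm M (\<xi> k))\<^sup>2)"

lemma normal_functionals_iff:
  "\<phi> \<in> normal_functionals M \<longleftrightarrow> (\<exists>\<xi> \<eta>. \<phi> = normal_functional M \<xi> \<eta> \<and> l2_sequence M \<xi> \<and> l2_sequence M \<eta>)"
  unfolding normal_functionals_def normal_functional_def l2_sequence_def by blast

lemma l2_sequence_product_summable:
  assumes "l2_sequence M \<xi>" "l2_sequence M \<eta>"
  shows "summable (\<lambda>k. L2_norm M (\<xi> k) * L2_norm M (\<eta> k))"
proof (rule summable_comparison_test')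
  show "summable (\<lambda>k. (L2_norm M (\<xi> k))\<^sup>2 + (L2_norm M (\<eta> k))\<^sup>2)"
    using assms by (intro summable_add) (auto simp: l2_sequence_def)
  fix k
  have "2 * (L2_norm M (\<xi> k) * L2_norm M (\<eta> k)) \<le> (L2_norm M (\<xi> k))\<^sup>2 + (L2_norm M (\<eta> k))\<^sup>2"
    using sum_squares_bound[of "L2_norm M (\<xi> k)" "L2_norm M (\<eta> k)"] by simp
  moreover have "0 \<le> L2_norm M (\<xi> k) * L2_norm M (\<eta> k)" by (simp add: L2_norm_nonneg)
  ultimately show "norm (L2_norm M (\<xi> k) * L2_norm M (\<eta> k)) \<le> (L2_norm M (\<xi> k))\<^sup>2 + (L2_norm M (\<eta> k))\<^sup>2"
    unfolding real_norm_def by linarith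
qed

lemma normal_functional_summable:
  assumes "l2_sequence M \<xi>" "l2_sequence M \<eta>"
    and "\<And>\<zeta>. \<zeta> \<in> L2 M \<Longrightarrow> T \<zeta> \<in> L2 M" "\<And>\<zeta>. \<zeta> \<in> L2 M \<Longrightarrow> L2_norm M (T \<zeta>) \<le> B * L2_norm M \<zeta>"
  shows "summable (\<lambda>k. L2_inner M (T (\<xi> k)) (\<eta> k))"
proof (rule summable_comparison_test')
  show "summable (\<lambda>k. B * (L2_norm M (\<xi> k) * L2_norm M (\<eta> k)))"
    by (intro summable_mult l2_sequence_product_summable assms)
  fix k
  have *: "\<xi> k \<in> L2 M" "\<eta> k \<in> L2 M" using assms by (auto simp: l2_sequence_def)
  have "cmod (L2_inner M (T (\<xi> k)) (\<eta> k)) \<le> L2_norm M (T (\<xi> k)) * L2_norm M (\<eta> k)"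
    using * assms by (intro L2_cauchy_schwarz) auto
  also have "\<dots> \<le> (B * L2_norm M (\<xi> k)) * L2_norm M (\<eta> k)"
    using * assms by (intro mult_right_mono) (auto simp: L2_norm_nonneg)
  finally show "norm (L2_inner M (T (\<xi> k)) (\<eta> k)) \<le> B * (L2_norm M (\<xi> k) * L2_norm M (\<eta> k))"
    by (simp add: mult.assoc)
qed

context profinite_group
begin

lemma left_regular_L2: assumes "\<xi> \<in> L2 M" shows "left_regular s \<xi> \<in> L2 M"
proof -
  note [measurable] = L2_measurable[OF assms] translate_measurable
  have "(\<lambda>t. \<xi> (- s + t)) \<in> borel_measurable M" by measurable
  then show ?thesis
    using integrable_translate[OF L2_square_integrable[OF assms], of "- s"] by (simp add: L2_def left_regular_def)
qed

lemma left_regular_norm: assumes "\<xi> \<in> L2 M" shows "L2_norm M (left_regular s \<xi>) = L2_norm M \<xi>"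
proof -
  note [measurable] = L2_measurable[OF assms]
  show ?thesis
    unfolding L2_norm_def left_regular_def using integral_translate[of "\<lambda>t. (cmod (\<xi> t))\<^sup>2" "- s"] by simp
qed

lemma normal_functional_left_regular_summable:
  assumes "l2_sequence M \<xi>" "l2_sequence M \<eta>"
  shows "summable (\<lambda>k. L2_inner M (left_regular s (\<xi> k)) (\<eta> k))"
  by (rule normal_functional_summable[OF assms, where B=1]) (simp_all add: left_regular_L2 left_regular_norm)

lemma normal_functional_span:
  assumes "l2_sequence M \<xi>" "l2_sequence M \<eta>"
  shows "normal_functional M \<xi> \<eta> (\<lambda>\<zeta> t. \<Sum>s\<in>F. c s * left_regular s \<zeta> t)
    = (\<Sum>s\<in>F. c s * normal_functional M \<xi> \<eta> (left_regular s))"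
proof -
  have "normal_functional M \<xi> \<eta> (\<lambda>\<zeta> t. \<Sum>s\<in>F. c s * left_regular s \<zeta> t)
      = (\<Sum>k. \<Sum>s\<in>F. c s * L2_inner M (left_regular s (\<xi> k)) (\<eta> k))"
    unfolding normal_functional_def using assms
    by (intro suminf_cong L2_inner_sum left_regular_L2) (auto simp: l2_sequence_def)
  also have "\<dots> = (\<Sum>s\<in>F. \<Sum>k. c s * L2_inner M (left_regular s (\<xi> k)) (\<eta> k))"
    by (intro suminf_sum summable_mult normal_functional_left_regular_summable assms)
  also have "\<dots> = (\<Sum>s\<in>F. c s * normal_functional M \<xi> \<eta> (left_regular s))"
    unfolding normal_functional_def
    by (intro sum.cong suminf_mult normal_functional_left_regular_summable assms refl)
  finally show ?thesis .
qed

text \<open>By definition, the span of the left translations is \<open>\<sigma>\<close>-weakly dense in \<open>VN M\<close>.\<close>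

lemma normal_functional_VN_unique:
  assumes "\<phi> \<in> normal_functionals M" "\<psi> \<in> normal_functionals M" "\<And>s. \<phi> (left_regular s) = \<psi> (left_regular s)"
    and T: "T \<in> VN M"
  shows "\<phi> T = \<psi> T"
proof -
  have span: "\<phi> S = \<psi> S" if "S \<in> left_regular_span" for S
    using that assms unfolding left_regular_span_def normal_functionals_iff by (auto simp: normal_functional_span)
  have "cmod (\<phi> T - \<psi> T) \<le> e" if e: "e > 0" for e
  proof -
    have "finite {\<phi>, \<psi>} \<and> {\<phi>, \<psi>} \<subseteq> normal_functionals M \<and> 0 < e / 2" using assms e by auto
    then obtain S where S: "S \<in> left_regular_span" "\<forall>f\<in>{\<phi>, \<psi>}. cmod (f T - f S) < e / 2"
      using T unfolding VN_def by blast
    have "\<phi> T - \<psi> T = (\<phi> T - \<phi> S) - (\<psi> T - \<psi> S)" using span[OF S(1)] by simp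
    then have "cmod (\<phi> T - \<psi> T) \<le> cmod (\<phi> T - \<phi> S) + cmod (\<psi> T - \<psi> S)" by (metis norm_triangle_ineq4)
    with S(2) show ?thesis by auto
  qed
  then have "cmod (\<phi> T - \<psi> T) \<le> 0" by (rule field_le_epsilon[of _ 0, simplified])
  then show ?thesis by simp
qed

lemma fourier_pairing_eq:
  assumes "\<phi> \<in> normal_functionals M" "\<And>s. \<phi> (left_regular s) = f s" "T \<in> VN M"
  shows "fourier_pairing M f T = \<phi> T"
  unfolding fourier_pairing_def
proof (rule the_equality)
  show "\<exists>\<psi>\<in>normal_functionals M. (\<forall>s. \<psi> (left_regular s) = f s) \<and> \<phi> T = \<psi> T" using assms by blast
next
  fix c assume "\<exists>\<psi>\<in>normal_functionals M. (\<forall>s. \<psi> (left_regular s) = f s) \<and> c = \<psi> T"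
  then obtain \<psi> where "\<psi> \<in> normal_functionals M" "\<forall>s. \<psi> (left_regular s) = f s" "c = \<psi> T" by blast
  with assms show "c = \<phi> T" using normal_functional_VN_unique[of \<psi> \<phi> T] by simp
qed

end

section \<open>Normal functionals are completely bounded\<close>

text \<open>Apply \<open>T\<close> to the vector \<open>v \<otimes> \<xi> / c\<close>, of norm at most \<open>1\<close>, for each \<open>c > \<parallel>\<xi>\<parallel>\<close>; letting \<open>c\<close> tend to \<open>\<parallel>\<xi>\<parallel>\<close>
  covers the case \<open>\<parallel>\<xi>\<parallel> = 0\<close> as well.\<close>

lemma op_mnorm_tensor_bound:
  assumes T: "\<And>p q. p < k \<Longrightarrow> q < k \<Longrightarrow> T p q \<in> bounded_ops M" and n: "op_mnorm M k T \<le> 1"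
    and \<xi>: "\<xi> \<in> L2 M" and v: "(\<Sum>q<k. (cmod (v q))\<^sup>2) \<le> 1"
  shows "sqrt (\<Sum>p<k. (L2_norm M (\<lambda>t. \<Sum>q<k. v q * T p q \<xi> t))\<^sup>2) \<le> L2_norm M \<xi>"
proof (rule dense_ge)
  fix c assume c: "L2_norm M \<xi> < c"
  then have c0: "0 < c" using L2_norm_nonneg[of M \<xi>] by linarith
  define \<zeta> where "\<zeta> = (\<lambda>q t. (v q / of_real c) * \<xi> t)"
  have \<zeta>L: "\<zeta> q \<in> L2 M" for q unfolding \<zeta>_def by (rule L2_scale[OF \<xi>])
  have "(\<Sum>q<k. (L2_norm M (\<zeta> q))\<^sup>2) = (\<Sum>q<k. (cmod (v q))\<^sup>2) * (L2_norm M \<xi> / c)\<^sup>2"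
    unfolding \<zeta>_def L2_norm_scale using c0
    by (simp add: sum_distrib_right norm_divide power_mult_distrib power_divide sum_divide_distrib)
  also have "\<dots> \<le> 1 * 1\<^sup>2"
    using c c0 L2_norm_nonneg[of M \<xi>] v by (intro mult_mono power_mono) (auto simp: sum_nonneg)
  finally have le: "(\<Sum>q<k. (L2_norm M (\<zeta> q))\<^sup>2) \<le> 1" by simp
  have TL: "T p q \<eta> \<in> L2 M" if "p < k" "q < k" "\<eta> \<in> L2 M" for p q \<eta>
    using T[OF that(1,2)] that(3) by (simp add: bounded_ops_def)
  have eq: "L2_norm M (\<lambda>t. \<Sum>q<k. T p q (\<zeta> q) t) = L2_norm M (\<lambda>t. \<Sum>q<k. v q * T p q \<xi> t) / c" if p: "p < k" for p
  proof -
    have "AE t in M. T p q (\<zeta> q) t = (v q / of_real c) * T p q \<xi> t" if q: "q < k" for q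
    proof -
      have "AE t in M. T p q (\<lambda>x. (v q / of_real c) * \<xi> x + 0 * \<xi> x) t = (v q / of_real c) * T p q \<xi> t + 0 * T p q \<xi> t"
        using T[OF p q] \<xi> unfolding bounded_ops_def by blast
      then show ?thesis by (simp add: \<zeta>_def)
    qed
    then have "AE t in M. \<forall>q\<in>{..<k}. T p q (\<zeta> q) t = (v q / of_real c) * T p q \<xi> t"
      by (intro AE_finite_allI) auto
    then have ae: "AE t in M. (\<Sum>q<k. T p q (\<zeta> q) t) = (1 / of_real c) * (\<Sum>q<k. v q * T p q \<xi> t)"
      by eventually_elim (simp add: sum_distrib_left)
    have L1: "(\<lambda>t. \<Sum>q<k. 1 * T p q (\<zeta> q) t) \<in> L2 M" by (rule L2_sum) (use TL[OF p] \<zeta>L in auto)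
    have L2: "(\<lambda>t. (1 / of_real c) * (\<Sum>q<k. v q * T p q \<xi> t)) \<in> L2 M"
      by (intro L2_scale L2_sum) (use TL[OF p] \<xi> in auto)
    have "L2_norm M (\<lambda>t. \<Sum>q<k. T p q (\<zeta> q) t) = L2_norm M (\<lambda>t. (1 / of_real c) * (\<Sum>q<k. v q * T p q \<xi> t))"
      using L1 by (intro L2_norm_AE_cong[OF _ L2 ae]) simp
    also have "\<dots> = L2_norm M (\<lambda>t. \<Sum>q<k. v q * T p q \<xi> t) / c"
      unfolding L2_norm_scale using c0 by (simp add: norm_divide)
    finally show ?thesis .
  qed
  have "ennreal (sqrt (\<Sum>p<k. (L2_norm M (\<lambda>t. \<Sum>q<k. T p q (\<zeta> q) t))\<^sup>2)) \<le> op_mnorm M k T"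
    unfolding op_mnorm_def by (intro SUP_upper2[of \<zeta>]) (use \<zeta>L le in auto)
  also note n
  finally have "sqrt (\<Sum>p<k. (L2_norm M (\<lambda>t. \<Sum>q<k. T p q (\<zeta> q) t))\<^sup>2) \<le> 1" by simp
  moreover have "(\<Sum>p<k. (L2_norm M (\<lambda>t. \<Sum>q<k. T p q (\<zeta> q) t))\<^sup>2) = (\<Sum>p<k. (L2_norm M (\<lambda>t. \<Sum>q<k. v q * T p q \<xi> t))\<^sup>2) / c\<^sup>2"
    using eq by (simp add: power_divide sum_divide_distrib)
  ultimately show "sqrt (\<Sum>p<k. (L2_norm M (\<lambda>t. \<Sum>q<k. v q * T p q \<xi> t))\<^sup>2) \<le> c"
    using c0 by (simp add: real_sqrt_divide)
qed

lemma sum_singleton_times: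
  "(\<Sum>x\<in>{..<1::nat} \<times> {..<k::nat}. F x) = (\<Sum>q<k. F (0, q))"
  by (rule sum.reindex_bij_witness[of _ "\<lambda>q. (0, q)" snd]) auto

lemma idx_opnorm_row_le:
  assumes "\<And>v. (\<Sum>q<k. (cmod (v q))\<^sup>2) \<le> 1 \<Longrightarrow> sqrt (\<Sum>p<k. (cmod (\<Sum>q<k. A p q * v q))\<^sup>2) \<le> B"
    and "\<And>p q. p < k \<Longrightarrow> q < k \<Longrightarrow> A' (0, p) (0, q) = A p q"
  shows "idx_opnorm ({..<1::nat} \<times> {..<k::nat}) A' \<le> ennreal B"
  unfolding idx_opnorm_def sum_singleton_times
proof (rule SUP_least, clarify)
  fix v :: "nat \<times> nat \<Rightarrow> complex" assume v: "(\<Sum>q<k. (cmod (v (0, q)))\<^sup>2) \<le> 1"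
  have "(\<Sum>p<k. (cmod (\<Sum>q<k. A' (0, p) (0, q) * v (0, q)))\<^sup>2) = (\<Sum>p<k. (cmod (\<Sum>q<k. A p q * v (0, q)))\<^sup>2)"
    using assms(2) by simp
  with assms(1)[OF v] show "ennreal (sqrt (\<Sum>p<k. (cmod (\<Sum>q<k. A' (0, p) (0, q) * v (0, q)))\<^sup>2)) \<le> ennreal B"
    by (intro ennreal_leI) simp
qed

context profinite_group
begin

text \<open>For \<open>w\<^sub>p = \<Sum>\<^sub>q \<phi>(T\<^sub>p\<^sub>q) v\<^sub>q\<close> expand \<open>\<parallel>w\<parallel>\<^sup>2 = \<langle>w, w\<rangle>\<close> into the series that defines \<open>\<phi>\<close>.  The \<open>n\<close>-th term is a pairing of
  \<open>T (v \<otimes> \<xi>\<^sub>n)\<close> with \<open>w \<otimes> \<eta>\<^sub>n\<close>, hence at most \<open>\<parallel>w\<parallel> \<parallel>\<xi>\<^sub>n\<parallel> \<parallel>\<eta>\<^sub>n\<parallel>\<close>.\<close>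

lemma fourier_mnorm_le:
  assumes \<xi>: "l2_sequence M \<xi>" and \<eta>: "l2_sequence M \<eta>"
    and f: "\<And>s. normal_functional M \<xi> \<eta> (left_regular s) = f s"
  shows "fourier_mnorm M 1 (\<lambda>_ _. f) \<le> ennreal (\<Sum>n. L2_norm M (\<xi> n) * L2_norm M (\<eta> n))"
  unfolding fourier_mnorm_def
proof (rule SUP_least, clarify)
  fix k and T :: "nat \<Rightarrow> nat \<Rightarrow> 'a op"
  assume TV: "\<forall>i<k. \<forall>j<k. T i j \<in> VN M" and Tn: "op_mnorm M k T \<le> 1"
  let ?\<phi> = "normal_functional M \<xi> \<eta>"
  let ?B = "\<Sum>n. L2_norm M (\<xi> n) * L2_norm M (\<eta> n)"
  have \<phi>: "?\<phi> \<in> normal_functionals M" using \<xi> \<eta> normal_functionals_iff by blast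
  have pair: "fourier_pairing M f (T p q) = ?\<phi> (T p q)" if "p < k" "q < k" for p q
    using TV that by (intro fourier_pairing_eq[OF \<phi> f]) auto
  have Tb: "T p q \<in> bounded_ops M" if "p < k" "q < k" for p q using TV that by (auto simp: VN_def)
  have TL: "T p q \<zeta> \<in> L2 M" if "p < k" "q < k" "\<zeta> \<in> L2 M" for p q \<zeta>
    using Tb[OF that(1,2)] that(3) by (simp add: bounded_ops_def)
  have \<xi>L: "\<xi> n \<in> L2 M" and \<eta>L: "\<eta> n \<in> L2 M" for n using \<xi> \<eta> by (auto simp: l2_sequence_def)
  have sm: "summable (\<lambda>n. L2_norm M (\<xi> n) * L2_norm M (\<eta> n))" by (rule l2_sequence_product_summable[OF \<xi> \<eta>])
  have sT: "summable (\<lambda>n. L2_inner M (T p q (\<xi> n)) (\<eta> n))" if pq: "p < k" "q < k" for p q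
  proof -
    obtain C where "\<And>\<zeta>. \<zeta> \<in> L2 M \<Longrightarrow> L2_norm M (T p q \<zeta>) \<le> C * L2_norm M \<zeta>"
      using bounded_opsD[OF Tb[OF pq]] by metis
    then show ?thesis using TL[OF pq] by (intro normal_functional_summable[OF \<xi> \<eta>]) auto
  qed
  show "idx_opnorm ({..<1::nat} \<times> {..<k}) (\<lambda>(i, p) (j, q). fourier_pairing M f (T p q)) \<le> ennreal ?B"
  proof (rule idx_opnorm_row_le[where A = "\<lambda>p q. ?\<phi> (T p q)"])
    fix v :: "nat \<Rightarrow> complex" assume v: "(\<Sum>q<k. (cmod (v q))\<^sup>2) \<le> 1"
    define w where "w = (\<lambda>p. \<Sum>q<k. ?\<phi> (T p q) * v q)"
    define d where "d = (\<lambda>n p t. \<Sum>q<k. v q * T p q (\<xi> n) t)"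
    define W where "W = sqrt (\<Sum>p<k. (cmod (w p))\<^sup>2)"
    have W0: "0 \<le> W" by (simp add: W_def sum_nonneg)
    have W2: "W\<^sup>2 = (\<Sum>p<k. (cmod (w p))\<^sup>2)" by (simp add: W_def sum_nonneg)
    have dL: "d n p \<in> L2 M" if "p < k" for n p
      unfolding d_def by (intro L2_sum TL \<xi>L that) auto
    have dn: "sqrt (\<Sum>p<k. (L2_norm M (d n p))\<^sup>2) \<le> L2_norm M (\<xi> n)" for n
      unfolding d_def by (rule op_mnorm_tensor_bound[OF Tb Tn \<xi>L v])
    have din: "L2_inner M (d n p) (\<eta> n) = (\<Sum>q<k. v q * L2_inner M (T p q (\<xi> n)) (\<eta> n))" if "p < k" for n p
      unfolding d_def by (intro L2_inner_sum TL \<xi>L \<eta>L that) auto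
    have wsum: "w p = (\<Sum>n. L2_inner M (d n p) (\<eta> n))" and ds: "summable (\<lambda>n. L2_inner M (d n p) (\<eta> n))" if p: "p < k" for p
    proof -
      have "w p = (\<Sum>q<k. \<Sum>n. v q * L2_inner M (T p q (\<xi> n)) (\<eta> n))"
        unfolding w_def normal_functional_def using sT[OF p]
        by (intro sum.cong refl) (simp add: suminf_mult mult.commute)
      also have "\<dots> = (\<Sum>n. \<Sum>q<k. v q * L2_inner M (T p q (\<xi> n)) (\<eta> n))"
        using sT[OF p] by (intro suminf_sum[symmetric] summable_mult) auto
      finally show "w p = (\<Sum>n. L2_inner M (d n p) (\<eta> n))" by (simp only: din[OF p])
      show "summable (\<lambda>n. L2_inner M (d n p) (\<eta> n))"
        unfolding din[OF p] using sT[OF p] by (intro summable_sum summable_mult) auto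
    qed
    have "complex_of_real (W\<^sup>2) = (\<Sum>p<k. cnj (w p) * w p)"
      unfolding W2 of_real_sum by (intro sum.cong refl) (simp only: complex_norm_square mult.commute)
    also have "\<dots> = (\<Sum>p<k. \<Sum>n. cnj (w p) * L2_inner M (d n p) (\<eta> n))"
      using ds by (intro sum.cong refl) (simp add: suminf_mult wsum[symmetric])
    also have "\<dots> = (\<Sum>n. \<Sum>p<k. cnj (w p) * L2_inner M (d n p) (\<eta> n))"
      using ds by (intro suminf_sum[symmetric] summable_mult) auto
    finally have "W\<^sup>2 = cmod (\<Sum>n. \<Sum>p<k. cnj (w p) * L2_inner M (d n p) (\<eta> n))"
      by (metis norm_of_real abs_of_nonneg zero_le_power2)
    also have "\<dots> \<le> (\<Sum>n. W * (L2_norm M (\<xi> n) * L2_norm M (\<eta> n)))"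
    proof (rule norm_suminf_le)
      show "summable (\<lambda>n. W * (L2_norm M (\<xi> n) * L2_norm M (\<eta> n)))" using sm by (rule summable_mult)
      fix n
      have "cmod (\<Sum>p<k. cnj (w p) * L2_inner M (d n p) (\<eta> n)) \<le> (\<Sum>p<k. cmod (w p) * (L2_norm M (d n p) * L2_norm M (\<eta> n)))"
        by (intro sum_norm_le) (auto simp: norm_mult intro!: mult_left_mono L2_cauchy_schwarz dL \<eta>L)
      also have "\<dots> = (\<Sum>p<k. cmod (w p) * L2_norm M (d n p)) * L2_norm M (\<eta> n)"
        by (simp add: sum_distrib_right mult.assoc)
      also have "\<dots> \<le> (W * L2_norm M (\<xi> n)) * L2_norm M (\<eta> n)"
      proof (rule mult_right_mono[OF _ L2_norm_nonneg])
        have "(\<Sum>p<k. cmod (w p) * L2_norm M (d n p))\<^sup>2 \<le> (\<Sum>p<k. (cmod (w p))\<^sup>2) * (\<Sum>p<k. (L2_norm M (d n p))\<^sup>2)"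
          by (rule Cauchy_Schwarz_ineq_sum)
        then have "\<bar>\<Sum>p<k. cmod (w p) * L2_norm M (d n p)\<bar> \<le> W * sqrt (\<Sum>p<k. (L2_norm M (d n p))\<^sup>2)"
          unfolding W_def real_sqrt_mult[symmetric] by (metis real_sqrt_abs real_sqrt_le_mono)
        also have "\<dots> \<le> W * L2_norm M (\<xi> n)" using dn W0 by (rule mult_left_mono)
        finally show "(\<Sum>p<k. cmod (w p) * L2_norm M (d n p)) \<le> W * L2_norm M (\<xi> n)" by linarith
      qed
      finally show "norm (\<Sum>p<k. cnj (w p) * L2_inner M (d n p) (\<eta> n)) \<le> W * (L2_norm M (\<xi> n) * L2_norm M (\<eta> n))"
        by (simp add: mult.assoc)
    qed
    also have "\<dots> = W * ?B" using sm by (rule suminf_mult)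
    finally have "W * W \<le> W * ?B" by (simp add: power2_eq_square)
    moreover have "0 \<le> ?B" using sm by (intro suminf_nonneg) (auto simp: L2_norm_nonneg)
    ultimately have "W \<le> ?B" using W0 by (cases "W = 0") auto
    then show "sqrt (\<Sum>p<k. (cmod (\<Sum>q<k. ?\<phi> (T p q) * v q))\<^sup>2) \<le> ?B"
      by (simp add: W_def w_def)
  qed (simp add: pair)
qed

section \<open>Continuity of the elements of the Fourier algebra\<close>

text \<open>The vectors with weakly continuous orbits; in the end these are all vectors.\<close>

definition translation_continuous :: "('a \<Rightarrow> complex) set" where
  "translation_continuous = {\<xi> \<in> L2 M. \<forall>\<eta>\<in>L2 M. continuous_on UNIV (\<lambda>s. L2_inner M (left_regular s \<xi>) \<eta>)}"

lemma left_regular_lin: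
  "left_regular s (\<lambda>t. a * \<xi> t + b * \<eta> t) = (\<lambda>t. a * left_regular s \<xi> t + b * left_regular s \<eta> t)"
  by (simp add: left_regular_def)

lemma translation_continuous_lin:
  assumes "\<xi> \<in> translation_continuous" "\<theta> \<in> translation_continuous"
  shows "(\<lambda>t. a * \<xi> t + b * \<theta> t) \<in> translation_continuous"
proof -
  have L: "\<xi> \<in> L2 M" "\<theta> \<in> L2 M" using assms by (auto simp: translation_continuous_def)
  have "continuous_on UNIV (\<lambda>s. L2_inner M (left_regular s (\<lambda>t. a * \<xi> t + b * \<theta> t)) \<eta>)" if "\<eta> \<in> L2 M" for \<eta>
    unfolding left_regular_lin L2_inner_lin[OF left_regular_L2[OF L(1)] left_regular_L2[OF L(2)] that]
    using assms that by (intro continuous_on_add continuous_on_mult continuous_on_const) (auto simp: translation_continuous_def)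
  with L2_lin[OF L] show ?thesis by (simp add: translation_continuous_def)
qed

lemma translation_continuous_sum:
  assumes "finite I" "\<And>i. i \<in> I \<Longrightarrow> \<xi> i \<in> translation_continuous"
  shows "(\<lambda>t. \<Sum>i\<in>I. c i * \<xi> i t) \<in> translation_continuous"
  using assms
proof (induction I)
  case empty
  have "continuous_on UNIV (\<lambda>s. L2_inner M (left_regular s (\<lambda>t. 0)) \<eta>)" for \<eta>
    by (simp add: left_regular_def)
  then show ?case using L2_zero by (simp add: translation_continuous_def)
next
  case (insert i I)
  then have "(\<lambda>t. c i * \<xi> i t + 1 * (\<Sum>i\<in>I. c i * \<xi> i t)) \<in> translation_continuous"
    by (intro translation_continuous_lin) auto
  with insert show ?case by simp
qed

text \<open>Translations are isometric, so the coefficient functions converge uniformly.\<close>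

lemma translation_continuous_limit:
  assumes \<xi>: "\<xi> \<in> L2 M"
    and ap: "\<And>e. 0 < e \<Longrightarrow> \<exists>\<theta>\<in>translation_continuous. L2_norm M (\<lambda>t. \<xi> t - \<theta> t) \<le> e"
  shows "\<xi> \<in> translation_continuous"
proof -
  have "\<forall>n. \<exists>\<theta>. \<theta> \<in> translation_continuous \<and> L2_norm M (\<lambda>t. \<xi> t - \<theta> t) \<le> 1 / real (Suc n)"
    using ap[of "1 / real (Suc n)" for n] by (metis of_nat_0_less_iff zero_less_Suc zero_less_divide_1_iff)
  then obtain \<theta> where \<theta>: "\<And>n. \<theta> n \<in> translation_continuous" "\<And>n. L2_norm M (\<lambda>t. \<xi> t - \<theta> n t) \<le> 1 / real (Suc n)"
    by metis
  have "continuous_on UNIV (\<lambda>s. L2_inner M (left_regular s \<xi>) \<eta>)" if \<eta>: "\<eta> \<in> L2 M" for \<eta>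
  proof (rule uniform_limit_theorem)
    show "\<forall>\<^sub>F n in sequentially. continuous_on UNIV (\<lambda>s. L2_inner M (left_regular s (\<theta> n)) \<eta>)"
      using \<theta>(1) \<eta> by (intro always_eventually) (auto simp: translation_continuous_def)
    have b: "dist (L2_inner M (left_regular s (\<theta> n)) \<eta>) (L2_inner M (left_regular s \<xi>) \<eta>) \<le> (1 / real (Suc n)) * L2_norm M \<eta>" for s n
    proof -
      have \<theta>L: "\<theta> n \<in> L2 M" using \<theta>(1) by (auto simp: translation_continuous_def)
      have dL: "(\<lambda>t. \<xi> t - \<theta> n t) \<in> L2 M" using L2_lin[OF \<xi> \<theta>L, of 1 "- 1"] by simp
      have "L2_inner M (left_regular s (\<lambda>t. 1 * \<xi> t + (- 1) * \<theta> n t)) \<eta>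
          = 1 * L2_inner M (left_regular s \<xi>) \<eta> + (- 1) * L2_inner M (left_regular s (\<theta> n)) \<eta>"
        unfolding left_regular_lin by (rule L2_inner_lin[OF left_regular_L2[OF \<xi>] left_regular_L2[OF \<theta>L] \<eta>])
      then have "dist (L2_inner M (left_regular s (\<theta> n)) \<eta>) (L2_inner M (left_regular s \<xi>) \<eta>)
          = cmod (L2_inner M (left_regular s (\<lambda>t. \<xi> t - \<theta> n t)) \<eta>)"
        by (simp add: dist_norm norm_minus_commute)
      also have "\<dots> \<le> L2_norm M (left_regular s (\<lambda>t. \<xi> t - \<theta> n t)) * L2_norm M \<eta>"
        by (rule L2_cauchy_schwarz[OF left_regular_L2[OF dL] \<eta>])
      also have "\<dots> \<le> (1 / real (Suc n)) * L2_norm M \<eta>"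
        unfolding left_regular_norm[OF dL] by (intro mult_right_mono \<theta>(2) L2_norm_nonneg)
      finally show ?thesis .
    qed
    show "uniform_limit UNIV (\<lambda>n s. L2_inner M (left_regular s (\<theta> n)) \<eta>) (\<lambda>s. L2_inner M (left_regular s \<xi>) \<eta>) sequentially"
    proof (rule uniform_limitI)
      fix e :: real assume e: "0 < e"
      have "(\<lambda>n. (1 / real (Suc n)) * L2_norm M \<eta>) \<longlonglongrightarrow> 0 * L2_norm M \<eta>"
        by (intro tendsto_mult tendsto_const LIMSEQ_Suc lim_1_over_n)
      then have "\<forall>\<^sub>F n in sequentially. (1 / real (Suc n)) * L2_norm M \<eta> < e"
        using e by (intro order_tendstoD(2)[of _ 0]) auto
      then show "\<forall>\<^sub>F n in sequentially. \<forall>s\<in>UNIV. dist (L2_inner M (left_regular s (\<theta> n)) \<eta>) (L2_inner M (left_regular s \<xi>) \<eta>) < e"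
        by eventually_elim (use b in \<open>blast intro: le_less_trans\<close>)
    qed
  qed simp
  with \<xi> show ?thesis by (simp add: translation_continuous_def)
qed

lemma bounded_L2:
  assumes "f \<in> borel_measurable M" "\<And>t. cmod (f t) \<le> B" shows "f \<in> L2 M"
proof -
  have "integrable M (\<lambda>t. (cmod (f t))\<^sup>2)"
    using assms by (intro integrable_const_bound[of _ "B\<^sup>2"]) (auto intro!: power_mono)
  with assms show ?thesis by (simp add: L2_def)
qed

lemma continuous_L2:
  assumes "continuous_on UNIV f" shows "f \<in> L2 M"
proof -
  obtain B where "\<And>t. cmod (f t) \<le> B" using continuous_bounded[OF assms] by metis
  then show ?thesis using continuous_measurable[OF assms] by (rule bounded_L2[rotated])
qed

text \<open>The orbit map of the indicator is locally constant: left translation by the elements of an open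
  subgroup, the right stabilizer of \<open>- C\<close>, leaves \<open>C\<close> unchanged.\<close>

lemma clopen_translation_continuous:
  assumes C: "open C" "closed C"
  shows "indicator C \<in> translation_continuous"
proof -
  have cu: "continuous_on UNIV (\<lambda>x::'a. - x)" by (rule continuous_on_minus[OF continuous_on_id])
  have "open ((\<lambda>x. - x) -` C)" "closed ((\<lambda>x. - x) -` C)"
    using open_vimage[OF C(1) cu] closed_vimage[OF C(2) cu] .
  then obtain N where N: "open N" "add_subgroup N" "\<And>c n. n \<in> N \<Longrightarrow> c + n \<in> (\<lambda>x. - x) -` C \<longleftrightarrow> c \<in> (\<lambda>x. - x) -` C"
    using clopen_stabilizer[OF compact_UNIV] by metis
  have "left_regular (s + n) (indicator C) = (left_regular s (indicator C) :: 'a \<Rightarrow> complex)" if n: "n \<in> N" for s n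
  proof
    fix t
    have "- (- (- s + t) + n) \<in> C \<longleftrightarrow> - (- (- s + t)) \<in> C" using N(3)[OF n, of "- (- s + t)"] by simp
    moreover have "- (- (- s + t) + n) = - (s + n) + t" by (simp add: minus_add add.assoc del: add_uminus_conv_diff)
    ultimately have "- (s + n) + t \<in> C \<longleftrightarrow> - s + t \<in> C" by simp
    then show "left_regular (s + n) (indicator C) t = (left_regular s (indicator C) t :: complex)"
      by (simp add: left_regular_def indicator_def)
  qed
  then have "continuous_on UNIV (\<lambda>s. L2_inner M (left_regular s (indicator C)) \<eta>)" for \<eta>
    using N(1,2) by (intro locally_constant_continuous locally_constant_subgroup[of N]) (auto simp: add_subgroup_def)
  moreover have "indicator C \<in> L2 M" by (intro continuous_L2 locally_constant_continuous locally_constant_indicator C)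
  ultimately show ?thesis by (simp add: translation_continuous_def)
qed

lemma outer_regular:
  assumes "A \<in> sets M" "0 < e" obtains U where "open U" "A \<subseteq> U" "measure M U < measure M A + e"
proof -
  have "emeasure M A < ennreal (measure M A + e)"
    unfolding emeasure_eq_measure using assms(2) by (intro ennreal_lessI) (auto simp: add_nonneg_pos)
  moreover have "emeasure M A = (INF U\<in>{U. open U \<and> A \<subseteq> U}. emeasure M U)"
    using haar assms(1) by (simp add: haar_probability_def)
  ultimately have "(INF U\<in>{U. open U \<and> A \<subseteq> U}. emeasure M U) < ennreal (measure M A + e)" by simp
  then obtain U where U: "open U" "A \<subseteq> U" "emeasure M U < ennreal (measure M A + e)"
    unfolding INF_less_iff by blast
  then have "measure M U < measure M A + e" by (simp add: emeasure_eq_measure ennreal_less_iff)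
  with U show thesis by (intro that[of U])
qed

text \<open>Regularity squeezes \<open>A\<close> between a compact set \<open>- V\<close> and an open set \<open>U\<close> of nearly the same measure, and a
  clopen set fits between these.\<close>

lemma indicator_translation_continuous:
  assumes A: "A \<in> sets M" shows "indicator A \<in> translation_continuous"
proof (rule translation_continuous_limit)
  have meas: "(indicator S :: 'a \<Rightarrow> complex) \<in> borel_measurable M" if "S \<in> sets M" for S using that by simp
  show "indicator A \<in> L2 M" by (rule bounded_L2[OF meas[OF A], of 1]) (simp add: indicator_def)
  fix e :: real assume e: "0 < e"
  \<comment> \<open>the \<open>L\<^sup>2\<close> distance of two indicators is the square root of the measure of the symmetric difference\<close>
  define d where "d = e\<^sup>2 / 2"
  have d: "0 < d" using e by (simp add: d_def)
  obtain U where U: "open U" "A \<subseteq> U" "measure M U < measure M A + d" using outer_regular[OF A d] .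
  have A': "space M - A \<in> sets M" using A by simp
  obtain V where V: "open V" "space M - A \<subseteq> V" "measure M V < measure M (space M - A) + d" using outer_regular[OF A' d] .
  have K: "compact (- V)" using compact_UNIV V(1) by (intro closed_Int_compact[of "- V" UNIV, simplified]) auto
  have KA: "- V \<subseteq> A" using V(2) space_M by auto
  obtain C where C: "open C" "closed C" "- V \<subseteq> C" "C \<subseteq> U"
    using clopen_between[OF compact_UNIV totally_disconnected_UNIV K U(1)] KA U(2) by blast
  let ?D = "U \<inter> V"
  have DS: "U \<in> sets M" "V \<in> sets M" using U(1) V(1) open_sets by auto
  have mD: "measure M ?D \<le> e\<^sup>2"
  proof -
    have "measure M (U \<union> V) = 1"
    proof -
      have "U \<union> V = space M" using U(2) V(2) space_M by auto
      then show ?thesis by (simp add: prob_space)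
    qed
    moreover have "measure M (U \<union> V) = measure M U + measure M V - measure M ?D"
      using measure_Un3[of U M V] DS by (simp add: fmeasurable_eq_sets)
    moreover have "measure M (space M - A) = 1 - measure M A" by (rule prob_compl[OF A])
    ultimately show ?thesis using U(3) V(3) by (simp add: d_def)
  qed
  have "(LINT t|M. (cmod (indicator A t - indicator C t))\<^sup>2) \<le> (LINT t|M. indicator ?D t)"
  proof (rule integral_mono)
    show "(cmod (indicator A t - indicator C t))\<^sup>2 \<le> (indicator ?D t :: real)" for t
      using U(2) KA C(3,4) by (auto simp: indicator_def)
    show "integrable M (\<lambda>t. (cmod (indicator A t - indicator C t))\<^sup>2)"
      using A open_sets[OF C(1)] by (intro integrable_const_bound[of _ 1]) (auto simp: indicator_def)
  qed (use DS in \<open>simp add: emeasure_eq_measure\<close>)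
  also have "\<dots> = measure M ?D" using DS by (simp add: space_M)
  finally have "L2_norm M (\<lambda>t. indicator A t - indicator C t) \<le> sqrt (e\<^sup>2)"
    unfolding L2_norm_def using mD by (intro real_sqrt_le_mono) linarith
  then show "\<exists>\<theta>\<in>translation_continuous. L2_norm M (\<lambda>t. indicator A t - \<theta> t) \<le> e"
    using e clopen_translation_continuous[OF C(1,2)] by (intro bexI[of _ "indicator C"]) auto
qed

text \<open>Simple functions are dense.\<close>

lemma L2_translation_continuous:
  assumes \<xi>: "\<xi> \<in> L2 M" shows "\<xi> \<in> translation_continuous"
proof (rule translation_continuous_limit[OF \<xi>])
  fix e :: real assume e: "0 < e"
  note [measurable] = L2_measurable[OF \<xi>]
  obtain F where F: "\<And>i. simple_function M (F i)" "\<And>x. (\<lambda>i. F i x) \<longlonglongrightarrow> \<xi> x" "\<And>i x. cmod (F i x) \<le> 2 * cmod (\<xi> x)"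
    using borel_measurable_implies_sequence_metric[OF L2_measurable[OF \<xi>], of 0] space_M by (auto simp: dist_norm)
  have [measurable]: "F i \<in> borel_measurable M" for i using F(1) by (rule borel_measurable_simple_function)
  have good: "F i \<in> translation_continuous" for i
  proof -
    have fin: "finite (range (F i))" using F(1)[of i] by (simp add: simple_function_def space_M)
    have "F i -` {y} \<inter> space M \<in> sets M" for y by (rule simple_functionD(2)[OF F(1)])
    then have "(\<lambda>t. \<Sum>y\<in>range (F i). y * indicator (F i -` {y}) t) \<in> translation_continuous"
      by (intro translation_continuous_sum fin indicator_translation_continuous) (simp add: space_M)
    moreover have "(\<Sum>y\<in>range (F i). y * indicator (F i -` {y}) t) = F i t" for t
      using fin by (subst sum.remove[of _ "F i t"]) (auto simp: indicator_def intro!: sum.neutral)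
    ultimately show ?thesis by simp
  qed
  have "(\<lambda>i. LINT t|M. (cmod (\<xi> t - F i t))\<^sup>2) \<longlonglongrightarrow> (LINT t|M. 0)"
  proof (rule integral_dominated_convergence)
    show "integrable M (\<lambda>t. 9 * (cmod (\<xi> t))\<^sup>2)" using L2_square_integrable[OF \<xi>] by simp
    show "AE t in M. (\<lambda>i. (cmod (\<xi> t - F i t))\<^sup>2) \<longlonglongrightarrow> 0"
    proof (rule AE_I2)
      fix t
      have "(\<lambda>i. (cmod (\<xi> t - F i t))\<^sup>2) \<longlonglongrightarrow> (cmod (\<xi> t - \<xi> t))\<^sup>2"
        by (intro tendsto_power tendsto_norm tendsto_diff tendsto_const F(2))
      then show "(\<lambda>i. (cmod (\<xi> t - F i t))\<^sup>2) \<longlonglongrightarrow> 0" by simp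
    qed
    show "AE t in M. norm ((cmod (\<xi> t - F i t))\<^sup>2) \<le> 9 * (cmod (\<xi> t))\<^sup>2" for i
    proof (rule AE_I2)
      fix t
      have "cmod (\<xi> t - F i t) \<le> 3 * cmod (\<xi> t)"
        using norm_triangle_ineq4[of "\<xi> t" "F i t"] F(3)[of i t] by linarith
      then have "(cmod (\<xi> t - F i t))\<^sup>2 \<le> (3 * cmod (\<xi> t))\<^sup>2" by (intro power_mono) auto
      then show "norm ((cmod (\<xi> t - F i t))\<^sup>2) \<le> 9 * (cmod (\<xi> t))\<^sup>2" by (simp add: power_mult_distrib)
    qed
  qed measurable
  then have "\<forall>\<^sub>F i in sequentially. (LINT t|M. (cmod (\<xi> t - F i t))\<^sup>2) < e\<^sup>2"
    using e by (intro order_tendstoD(2)[of _ 0]) auto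
  then obtain i where "(LINT t|M. (cmod (\<xi> t - F i t))\<^sup>2) < e\<^sup>2" by (auto simp: eventually_sequentially)
  then have "L2_norm M (\<lambda>t. \<xi> t - F i t) \<le> sqrt (e\<^sup>2)"
    unfolding L2_norm_def by (intro real_sqrt_le_mono) simp
  then show "\<exists>\<theta>\<in>translation_continuous. L2_norm M (\<lambda>t. \<xi> t - \<theta> t) \<le> e"
    using e good[of i] by (intro bexI[of _ "F i"]) auto
qed

lemma normal_functional_continuous:
  assumes \<xi>: "l2_sequence M \<xi>" and \<eta>: "l2_sequence M \<eta>"
  shows "continuous_on UNIV (\<lambda>s. normal_functional M \<xi> \<eta> (left_regular s))"
proof -
  have L: "\<xi> k \<in> L2 M" "\<eta> k \<in> L2 M" for k using assms by (auto simp: l2_sequence_def)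
  have "uniform_limit UNIV (\<lambda>n s. \<Sum>k<n. L2_inner M (left_regular s (\<xi> k)) (\<eta> k)) (\<lambda>s. \<Sum>k. L2_inner M (left_regular s (\<xi> k)) (\<eta> k)) sequentially"
  proof (rule Weierstrass_m_test[OF _ l2_sequence_product_summable[OF assms]])
    fix k s
    show "norm (L2_inner M (left_regular s (\<xi> k)) (\<eta> k)) \<le> L2_norm M (\<xi> k) * L2_norm M (\<eta> k)"
      using L2_cauchy_schwarz[OF left_regular_L2[OF L(1)] L(2), of s k k] left_regular_norm[OF L(1)] by simp
  qed
  moreover have "continuous_on UNIV (\<lambda>s. \<Sum>k<n. L2_inner M (left_regular s (\<xi> k)) (\<eta> k))" for n
    using L2_translation_continuous[OF L(1)] L(2) by (intro continuous_on_sum) (auto simp: translation_continuous_def)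
  ultimately show ?thesis
    unfolding normal_functional_def
    by (intro uniform_limit_theorem[of _ "\<lambda>n s. \<Sum>k<n. L2_inner M (left_regular s (\<xi> k)) (\<eta> k)"]) auto
qed

lemma fourier_algebra_continuous: "f \<in> fourier_algebra M \<Longrightarrow> continuous_on UNIV f"
  unfolding fourier_algebra_def normal_functionals_iff by (auto intro: normal_functional_continuous)

end

section \<open>The isometry onto the Fourier algebra\<close>

text \<open>The dual may be uncountable, while normal functionals are series indexed by natural numbers; a summable
  family has countable support, and an enumeration of the support turns its sum into a series.\<close>

lemma sums_of_has_sum:
  fixes g :: "'i \<Rightarrow> 'b::{comm_monoid_add, topological_space}" and h :: "nat \<Rightarrow> 'i"
  assumes h: "bij_betw h K J" and J: "J \<subseteq> I" and g: "(g has_sum S) I" and z: "\<And>i. i \<in> I \<Longrightarrow> i \<notin> J \<Longrightarrow> g i = 0"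
  shows "(\<lambda>k. if k \<in> K then g (h k) else 0) sums S"
proof -
  have "(g has_sum S) J"
    using g J z has_sum_cong_neutral[where S = J and T = I and f = g and g = g] by blast
  then have "((\<lambda>k. g (h k)) has_sum S) K" by (simp only: has_sum_reindex_bij_betw[OF h])
  then have "((\<lambda>k. if k \<in> K then g (h k) else 0) has_sum S) UNIV"
    using has_sum_cong_neutral[where S = K and T = UNIV and f = "\<lambda>k. g (h k)" and g = "\<lambda>k. if k \<in> K then g (h k) else 0"] by simp
  then show ?thesis by (rule has_sum_imp_sums)
qed

lemma countable_support_enumeration:
  fixes r :: "'i \<Rightarrow> real"
  assumes "r summable_on I"
  obtains h :: "nat \<Rightarrow> 'i" and K where "bij_betw h K {i\<in>I. r i \<noteq> 0}"
proof -
  obtain f :: "'i \<Rightarrow> nat" where "inj_on f {i\<in>I. r i \<noteq> 0}"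
    using summable_countable_real[OF assms] unfolding countable_def by blast
  from bij_betw_inv_into[OF inj_on_imp_bij_betw[OF this]] show thesis by (rule that)
qed

lemma has_sum_Sigma_finite:
  fixes r :: "'i \<times> nat \<Rightarrow> real"
  assumes nn: "\<And>i j. i \<in> A \<Longrightarrow> j < d i \<Longrightarrow> 0 \<le> r (i, j)" and s: "((\<lambda>i. \<Sum>j<d i. r (i, j)) has_sum S) A"
  shows "(r has_sum S) (Sigma A (\<lambda>i. {..<d i}))"
proof (rule has_sum_SigmaI[OF _ s])
  show "((\<lambda>j. r (i, j)) has_sum (\<Sum>j<d i. r (i, j))) {..<d i}" for i by (rule has_sum_finite) simp
  have eq: "norm (\<Sum>\<^sub>\<infinity>j\<in>{..<d i}. norm (r (i, j))) = (\<Sum>j<d i. r (i, j))" if "i \<in> A" for i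
  proof -
    have "(\<Sum>\<^sub>\<infinity>j\<in>{..<d i}. norm (r (i, j))) = (\<Sum>j<d i. r (i, j))"
      using nn[OF that] by (subst infsum_finite) (auto intro!: sum.cong)
    moreover have "0 \<le> (\<Sum>j<d i. r (i, j))" using nn[OF that] by (intro sum_nonneg) simp
    ultimately show ?thesis by simp
  qed
  have "(\<lambda>i. norm (\<Sum>\<^sub>\<infinity>j\<in>{..<d i}. norm (r (i, j)))) summable_on A \<longleftrightarrow> (\<lambda>i. \<Sum>j<d i. r (i, j)) summable_on A"
    by (rule summable_on_cong) (rule eq)
  with has_sum_imp_summable[OF s]
  have "(\<lambda>i. norm (\<Sum>\<^sub>\<infinity>j\<in>{..<d i}. norm (r (i, j)))) summable_on A" by blast
  moreover have "(\<lambda>j. norm (r (i, j))) summable_on {..<d i}" for i by (rule summable_on_finite) simp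
  ultimately have "(\<lambda>x. norm (r x)) summable_on Sigma A (\<lambda>i. {..<d i})"
    unfolding Infinite_Sum.abs_summable_on_Sigma_iff by (intro conjI ballI)
  then show "r summable_on Sigma A (\<lambda>i. {..<d i})" by (rule Infinite_Sum.abs_summable_summable)
qed

lemma integral_double_sum:
  fixes g :: "nat \<Rightarrow> nat \<Rightarrow> 'a \<Rightarrow> complex"
  assumes "\<And>k l. k < n \<Longrightarrow> l < m \<Longrightarrow> integrable M (g k l)"
  shows "(LINT t|M. (\<Sum>k<n. \<Sum>l<m. c k l * g k l t)) = (\<Sum>k<n. \<Sum>l<m. c k l * (LINT t|M. g k l t))"
proof -
  have i: "integrable M (\<lambda>t. c k l * g k l t)" if "k < n" "l < m" for k l
    using assms[OF that] by simp
  have "(LINT t|M. (\<Sum>k<n. \<Sum>l<m. c k l * g k l t)) = (\<Sum>k<n. LINT t|M. (\<Sum>l<m. c k l * g k l t))"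
    by (rule Bochner_Integration.integral_sum) (auto intro!: Bochner_Integration.integrable_sum i)
  also have "\<dots> = (\<Sum>k<n. \<Sum>l<m. LINT t|M. c k l * g k l t)"
    by (rule sum.cong[OF refl]) (rule Bochner_Integration.integral_sum, auto intro: i)
  finally show ?thesis by simp
qed

context profinite_group
begin

text \<open>The first row of \<open>\<pi>(t\<^sup>-\<^sup>1)\<close> applied to \<open>x\<close>, suitably scaled: by Schur orthogonality an isometric
  embedding of \<open>\<pi>\<close> into the left regular representation.\<close>

definition embed :: "('a \<Rightarrow> complex mat) set \<Rightarrow> (nat \<Rightarrow> complex) \<Rightarrow> 'a \<Rightarrow> complex" where
  "embed P x = (\<lambda>t. complex_of_real (sqrt (real (irr_dim P))) * (\<Sum>l<irr_dim P. x l * cnj (rep_of P t $$ (l, 0))))"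

lemma embed_L2:
  assumes P: "P \<in> dual_group" shows "embed P x \<in> L2 M"
  unfolding embed_def
  using unitary_rep_continuous[OF unitary_rep_rep_of[OF P]] irr_dim_pos[OF P]
  by (intro continuous_L2 continuous_on_mult continuous_on_const continuous_on_sum continuous_on_cnj) auto

lemma embed_inner:
  assumes P: "P \<in> dual_group"
  shows "L2_inner M (embed P x) (embed P z) = ip (irr_dim P) x z"
proof -
  let ?d = "irr_dim P" and ?\<pi> = "rep_of P"
  note u = unitary_rep_rep_of[OF P] and d0 = irr_dim_pos[OF P]
  have int: "integrable M (\<lambda>t. ?\<pi> t $$ (m, 0) * cnj (?\<pi> t $$ (l, 0)))" if "l < ?d" "m < ?d" for l m
    using coef_product_integrable[OF u u that(2) d0 that(1) d0] .
  have "embed P x t * cnj (embed P z t)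
      = (\<Sum>l<?d. \<Sum>m<?d. (of_nat ?d * x l * cnj (z m)) * (?\<pi> t $$ (m, 0) * cnj (?\<pi> t $$ (l, 0))))" for t
  proof -
    have "complex_of_real (sqrt (real ?d)) * complex_of_real (sqrt (real ?d)) = of_nat ?d"
      by (simp add: of_real_mult[symmetric] del: of_real_mult)
    then have 1: "embed P x t * cnj (embed P z t)
       = of_nat ?d * ((\<Sum>l<?d. x l * cnj (?\<pi> t $$ (l, 0))) * (\<Sum>m<?d. cnj (z m) * ?\<pi> t $$ (m, 0)))"
      unfolding embed_def by (simp add: mult_ac)
    show ?thesis unfolding 1 sum_product unfolding sum_distrib_left by (simp add: mult_ac)
  qed
  then have "L2_inner M (embed P x) (embed P z)
      = (LINT t|M. (\<Sum>l<?d. \<Sum>m<?d. (of_nat ?d * x l * cnj (z m)) * (?\<pi> t $$ (m, 0) * cnj (?\<pi> t $$ (l, 0)))))"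
    unfolding L2_inner_def by (simp only:)
  also have "\<dots> = (\<Sum>l<?d. \<Sum>m<?d. (of_nat ?d * x l * cnj (z m)) * (LINT t|M. ?\<pi> t $$ (m, 0) * cnj (?\<pi> t $$ (l, 0))))"
    by (rule integral_double_sum) (rule int)
  also have "\<dots> = (\<Sum>l<?d. \<Sum>m<?d. if m = l then x l * cnj (z l) else 0)"
    using d0 by (intro sum.cong refl) (auto simp: schur_orthogonality_self[OF rep_of_irrep[OF P]])
  also have "\<dots> = ip ?d x z" by (simp add: ip_def)
  finally show ?thesis .
qed

lemma embed_norm:
  assumes P: "P \<in> dual_group"
  shows "(L2_norm M (embed P x))\<^sup>2 = (\<Sum>k<irr_dim P. (cmod (x k))\<^sup>2)"
proof -
  have "complex_of_real ((L2_norm M (embed P x))\<^sup>2) = L2_inner M (embed P x) (embed P x)"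
    unfolding L2_norm_sq L2_inner_def integral_complex_of_real[symmetric]
    by (intro Bochner_Integration.integral_cong refl) (simp only: complex_norm_square)
  also have "\<dots> = complex_of_real (\<Sum>k<irr_dim P. (cmod (x k))\<^sup>2)"
    unfolding embed_inner[OF P] ip_self ..
  finally show ?thesis unfolding of_real_eq_iff .
qed

lemma left_regular_embed:
  assumes P: "P \<in> dual_group"
  shows "left_regular s (embed P x) = embed P (mv (irr_dim P) (ent (rep_of P s)) x)"
proof
  fix t
  let ?d = "irr_dim P" and ?\<pi> = "rep_of P"
  note u = unitary_rep_rep_of[OF P] and d0 = irr_dim_pos[OF P]
  have "(\<Sum>l<?d. x l * cnj (?\<pi> (- s + t) $$ (l, 0))) = (\<Sum>l<?d. x l * (\<Sum>m<?d. ?\<pi> s $$ (m, l) * cnj (?\<pi> t $$ (m, 0))))"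
  proof (rule sum.cong[OF refl])
    fix l assume "l \<in> {..<?d}"
    then have l: "l < ?d" by simp
    have "cnj (?\<pi> (- s + t) $$ (l, 0)) = (\<Sum>m<?d. ?\<pi> s $$ (m, l) * cnj (?\<pi> t $$ (m, 0)))"
      unfolding unitary_rep_add[OF u l d0] cnj_sum using l by (intro sum.cong refl) (simp add: unitary_rep_minus[OF u])
    then show "x l * cnj (?\<pi> (- s + t) $$ (l, 0)) = x l * (\<Sum>m<?d. ?\<pi> s $$ (m, l) * cnj (?\<pi> t $$ (m, 0)))" by simp
  qed
  also have "\<dots> = (\<Sum>m<?d. mv ?d (ent (?\<pi> s)) x m * cnj (?\<pi> t $$ (m, 0)))"
    unfolding mv_def sum_distrib_left sum_distrib_right by (subst sum.swap) (simp add: mult_ac)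
  finally show "left_regular s (embed P x) t = embed P (mv ?d (ent (?\<pi> s)) x) t"
    by (simp add: left_regular_def embed_def)
qed

lemma coef_fourier:
  assumes P: "P \<in> dual_group" and Q: "Q \<in> dual_group" and ab: "a < irr_dim Q" "b < irr_dim Q"
  shows "(LINT s|M. ip (irr_dim P) (mv (irr_dim P) (ent (rep_of P s)) x) z * cnj (rep_of Q s $$ (a, b)))
    = (if P = Q then x b * cnj (z a) / of_nat (irr_dim P) else 0)"
proof -
  let ?d = "irr_dim P" and ?\<pi> = "rep_of P"
  note u = unitary_rep_rep_of[OF P]
  have int: "integrable M (\<lambda>t. ?\<pi> t $$ (k, l) * cnj (rep_of Q t $$ (a, b)))" if "k < ?d" "l < ?d" for k l
    using coef_product_integrable[OF u unitary_rep_rep_of[OF Q] that ab] .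
  have val: "(LINT t|M. ?\<pi> t $$ (k, l) * cnj (rep_of Q t $$ (a, b))) = (if P = Q \<and> a = k \<and> b = l then 1 / of_nat ?d else 0)"
    if "k < ?d" "l < ?d" for k l
    using fourier_coef[OF Q P that ab] fourier_index[OF ab, of "\<lambda>t. ?\<pi> t $$ (k, l)"] by auto
  have "ip ?d (mv ?d (ent (?\<pi> s)) x) z * cnj (rep_of Q s $$ (a, b))
      = (\<Sum>k<?d. \<Sum>l<?d. (x l * cnj (z k)) * (?\<pi> s $$ (k, l) * cnj (rep_of Q s $$ (a, b))))" for s
    unfolding ip_def mv_def sum_distrib_right by (simp add: mult_ac)
  then have "(LINT s|M. ip ?d (mv ?d (ent (?\<pi> s)) x) z * cnj (rep_of Q s $$ (a, b)))
      = (LINT s|M. (\<Sum>k<?d. \<Sum>l<?d. (x l * cnj (z k)) * (?\<pi> s $$ (k, l) * cnj (rep_of Q s $$ (a, b)))))"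
    by (simp only:)
  also have "\<dots> = (\<Sum>k<?d. \<Sum>l<?d. (x l * cnj (z k)) * (LINT t|M. ?\<pi> t $$ (k, l) * cnj (rep_of Q t $$ (a, b))))"
    by (rule integral_double_sum) (rule int)
  also have "\<dots> = (\<Sum>k<?d. \<Sum>l<?d. if P = Q \<and> a = k \<and> b = l then x l * cnj (z k) / of_nat ?d else 0)"
    using val by (intro sum.cong refl) auto
  also have "\<dots> = (if P = Q then x b * cnj (z a) / of_nat ?d else 0)"
  proof (cases "P = Q")
    case True
    have "(\<Sum>k<?d. \<Sum>l<?d. if P = Q \<and> a = k \<and> b = l then x l * cnj (z k) / of_nat ?d else 0)
      = (\<Sum>k<?d. if k = a then (\<Sum>l<?d. if l = b then x l * cnj (z k) / of_nat ?d else 0) else 0)"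
      using True by (intro sum.cong refl) (auto intro!: sum.cong)
    then show ?thesis using True ab by simp
  qed simp
  finally show ?thesis .
qed

text \<open>Elements of the Fourier algebra are continuous, hence determined by their Fourier coefficients.\<close>

lemma weight_map_eqI:
  assumes "\<phi> \<in> fourier_algebra M"
    and "\<And>P. P \<in> dual_group \<Longrightarrow> fourier M \<phi> P = complex_of_real (\<omega> P) \<cdot>\<^sub>m fourier M f P"
  shows "weight_map M \<omega> f = \<phi>"
  unfolding weight_map_def
proof (rule the_equality)
  show "\<phi> \<in> fourier_algebra M \<and> (\<forall>P\<in>dual_group. fourier M \<phi> P = complex_of_real (\<omega> P) \<cdot>\<^sub>m fourier M f P)"
    using assms by blast
next
  fix \<psi> assume \<psi>: "\<psi> \<in> fourier_algebra M \<and> (\<forall>P\<in>dual_group. fourier M \<psi> P = complex_of_real (\<omega> P) \<cdot>\<^sub>m fourier M f P)"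
  have c: "continuous_on UNIV \<phi>" "continuous_on UNIV \<psi>" using assms(1) \<psi> fourier_algebra_continuous by auto
  have "fourier M (\<lambda>t. 1 * \<psi> t + (- 1) * \<phi> t) P = 0\<^sub>m (irr_dim P) (irr_dim P)" if P: "P \<in> dual_group" for P
    unfolding fourier_lin[OF c(2,1) P] using \<psi> assms(2)[OF P] P fourier_carrier[of f P] by (intro eq_matI) auto
  moreover have "continuous_on UNIV (\<lambda>t. 1 * \<psi> t + (- 1) * \<phi> t)"
    by (intro continuous_on_add continuous_on_mult continuous_on_const c)
  ultimately have "1 * \<psi> t + (- 1) * \<phi> t = 0" for t by (rule fourier_injective[rotated])
  then show "\<psi> = \<phi>" by (intro ext) (metis add_neg_numeral_special(7) eq_neg_iff_add_eq_0 minus_minus mult_1 mult_minus1)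
qed

text \<open>Let \<open>F\<close> be the Fourier coefficient of \<open>f\<close> at \<open>P\<close>.  The image of \<open>f\<close> in the Fourier algebra is the sum, over all \<open>P\<close>,
  of \<open>d\<^sub>P \<omega>(P) \<Sum>\<^sub>k\<^sub>l F\<^sub>k\<^sub>l P\<^sub>k\<^sub>l\<close>.  Write \<open>F = \<Sum>\<^sub>j y\<^sub>j x\<^sub>j\<^sup>T\<close> so as to realize the trace norm: the embeddings of \<open>x\<^sub>j\<close> and of
  the conjugate of \<open>y\<^sub>j\<close> into \<open>L\<^sup>2\<close> represent the sum as a normal functional.\<close>

lemma weight_map_normal_functional:
  assumes f: "f \<in> beurling_fourier M \<omega>" and \<omega>: "\<And>P. P \<in> dual_group \<Longrightarrow> 0 < \<omega> P"
  obtains \<xi> \<eta> where "l2_sequence M \<xi>" "l2_sequence M \<eta>"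
    "(\<Sum>k. L2_norm M (\<xi> k) * L2_norm M (\<eta> k)) = beurling_norm M \<omega> f"
    "\<And>P. P \<in> dual_group \<Longrightarrow> fourier M (\<lambda>s. normal_functional M \<xi> \<eta> (left_regular s)) P = complex_of_real (\<omega> P) \<cdot>\<^sub>m fourier M f P"
proof -
  define d where "d = (\<lambda>P :: ('a \<Rightarrow> complex mat) set. irr_dim P)"
  define optimal where "optimal = (\<lambda>P x y \<mu>. (\<forall>j<d P. 0 \<le> \<mu> j) \<and> (\<forall>j<d P. (\<Sum>k<d P. (cmod (x j k))\<^sup>2) = \<mu> j) \<and>
      (\<forall>j<d P. (\<Sum>k<d P. (cmod (y j k))\<^sup>2) = \<mu> j) \<and>
      (\<forall>k<d P. \<forall>l<d P. fourier M f P $$ (k, l) = (\<Sum>j<d P. y j k * x j l)) \<and>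
      trace_norm (fourier M f P) = (\<Sum>j<d P. \<mu> j))"
  have "\<exists>x y \<mu>. optimal P x y \<mu>" for P
    unfolding d_def optimal_def by (rule trace_norm_factorization[OF fourier_carrier[of f P]]) blast
  then have "\<forall>P. \<exists>x y \<mu>. optimal P x y \<mu>" ..
  from choice[OF this] obtain x where "\<forall>P. \<exists>y \<mu>. optimal P (x P) y \<mu>" ..
  from choice[OF this] obtain y where "\<forall>P. \<exists>\<mu>. optimal P (x P) (y P) \<mu>" ..
  from choice[OF this] obtain \<mu> where "\<forall>P. optimal P (x P) (y P) (\<mu> P)" ..
  note fac = this[rule_format, unfolded optimal_def]
  have \<mu>0: "0 \<le> \<mu> P j" and x2: "(\<Sum>k<d P. (cmod (x P j k))\<^sup>2) = \<mu> P j"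
    and y2: "(\<Sum>k<d P. (cmod (y P j k))\<^sup>2) = \<mu> P j" if "j < d P" for P j
    using fac[of P] that by blast+
  have F: "fourier M f P $$ (k, l) = (\<Sum>j<d P. y P j k * x P j l)" if "k < d P" "l < d P" for P k l
    using fac[of P] that by blast
  have tn: "trace_norm (fourier M f P) = (\<Sum>j<d P. \<mu> P j)" for P using fac[of P] by blast
  define I where "I = Sigma (dual_group :: ('a \<Rightarrow> complex mat) set set) (\<lambda>P. {..<d P})"
  define r where "r = (\<lambda>(P, j). real (d P) * \<omega> P * \<mu> P j)"
  have r0: "0 \<le> r i" if "i \<in> I" for i
    using that \<mu>0 \<omega> by (auto simp: I_def r_def less_imp_le)
  have rsum: "(r has_sum beurling_norm M \<omega> f) I"
    unfolding I_def
  proof (rule has_sum_Sigma_finite)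
    show "0 \<le> r (P, j)" if "P \<in> dual_group" "j < d P" for P j using r0[of "(P, j)"] that by (simp add: I_def)
    have "(\<Sum>j<d P. r (P, j)) = real (irr_dim P) * \<omega> P * trace_norm (fourier M f P)" for P
      unfolding r_def tn d_def by (simp add: sum_distrib_left)
    then show "((\<lambda>P. \<Sum>j<d P. r (P, j)) has_sum beurling_norm M \<omega> f) dual_group"
      unfolding beurling_norm_def using f by (simp add: beurling_fourier_def has_sum_infsum)
  qed
  then have rs: "r summable_on I" by (rule has_sum_imp_summable)
  \<comment> \<open>the factor \<open>d\<^sub>P \<omega>(P)\<close> is split evenly between the two vectors\<close>
  define c where "c = (\<lambda>P. complex_of_real (sqrt (real (d P) * \<omega> P)))"
  have c2: "(cmod (c P))\<^sup>2 = real (d P) * \<omega> P" "c P * cnj (c P) = of_real (real (d P) * \<omega> P)" if "P \<in> dual_group" for P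
  proof -
    have nn: "0 \<le> real (d P) * \<omega> P" using \<omega>[OF that] by simp
    then show "(cmod (c P))\<^sup>2 = real (d P) * \<omega> P" by (simp add: c_def)
    show "c P * cnj (c P) = of_real (real (d P) * \<omega> P)"
      unfolding c_def complex_cnj_complex_of_real of_real_mult[symmetric] using nn by (simp only: real_sqrt_mult_self abs_of_nonneg)
  qed
  define X where "X = (\<lambda>(P, j). embed P (\<lambda>k. c P * x P j k))"
  define Y where "Y = (\<lambda>(P, j). embed P (\<lambda>k. c P * cnj (y P j k)))"
  have XL: "X i \<in> L2 M" and YL: "Y i \<in> L2 M" if "i \<in> I" for i
    using that embed_L2 by (auto simp: X_def Y_def I_def)
  have Xn: "(L2_norm M (X i))\<^sup>2 = r i" and Yn: "(L2_norm M (Y i))\<^sup>2 = r i" if i: "i \<in> I" for i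
  proof -
    obtain P j where ij: "i = (P, j)" "P \<in> dual_group" "j < d P" using i by (auto simp: I_def)
    have "(L2_norm M (embed P (\<lambda>k. c P * z k)))\<^sup>2 = real (d P) * \<omega> P * (\<Sum>k<d P. (cmod (z k))\<^sup>2)" for z
      unfolding embed_norm[OF ij(2)] norm_mult power_mult_distrib c2(1)[OF ij(2)] d_def by (rule sum_distrib_left[symmetric])
    with x2[OF ij(3)] y2[OF ij(3)] show "(L2_norm M (X i))\<^sup>2 = r i" "(L2_norm M (Y i))\<^sup>2 = r i"
      by (simp_all add: X_def Y_def r_def ij(1))
  qed
  obtain h :: "nat \<Rightarrow> ('a \<Rightarrow> complex mat) set \<times> nat" and K where h: "bij_betw h K {i\<in>I. r i \<noteq> 0}"
    by (rule countable_support_enumeration[OF rs])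
  have hI: "h k \<in> I" if "k \<in> K" for k using h that by (auto simp: bij_betw_def)
  define \<xi> where "\<xi> = (\<lambda>k. if k \<in> K then X (h k) else (\<lambda>t. 0))"
  define \<eta> where "\<eta> = (\<lambda>k. if k \<in> K then Y (h k) else (\<lambda>t. 0))"
  let ?r = "\<lambda>k. if k \<in> K then r (h k) else 0"
  have rsums: "?r sums beurling_norm M \<omega> f" by (rule sums_of_has_sum[OF h _ rsum]) auto
  have n0: "L2_norm M (\<lambda>t. 0) = 0" by (simp add: L2_norm_def)
  have \<xi>n: "(L2_norm M (\<xi> k))\<^sup>2 = ?r k" and \<eta>n: "(L2_norm M (\<eta> k))\<^sup>2 = ?r k" for k
    using Xn[OF hI] Yn[OF hI] by (auto simp: \<xi>_def \<eta>_def n0)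
  have \<xi>L: "\<xi> k \<in> L2 M" and \<eta>L: "\<eta> k \<in> L2 M" for k
    using XL[OF hI] YL[OF hI] L2_zero by (auto simp: \<xi>_def \<eta>_def)
  have \<xi>: "l2_sequence M \<xi>" and \<eta>: "l2_sequence M \<eta>"
    using rsums \<xi>L \<eta>L by (auto simp: l2_sequence_def \<xi>n \<eta>n sums_iff)
  have nn: "L2_norm M (\<xi> k) * L2_norm M (\<eta> k) = ?r k" for k
  proof -
    have "L2_norm M (\<xi> k) = L2_norm M (\<eta> k)"
    proof (rule power2_eq_imp_eq)
      show "(L2_norm M (\<xi> k))\<^sup>2 = (L2_norm M (\<eta> k))\<^sup>2" unfolding \<xi>n \<eta>n ..
    qed (rule L2_norm_nonneg)+
    then show ?thesis using \<xi>n[of k] by (simp add: power2_eq_square)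
  qed
  have norm_sum: "(\<Sum>k. L2_norm M (\<xi> k) * L2_norm M (\<eta> k)) = beurling_norm M \<omega> f"
    unfolding nn using rsums by (rule sums_unique[symmetric])
  have four: "fourier M (\<lambda>s. normal_functional M \<xi> \<eta> (left_regular s)) Q = complex_of_real (\<omega> Q) \<cdot>\<^sub>m fourier M f Q"
    if Q: "Q \<in> dual_group" for Q
  proof (rule eq_matI)
    fix a b assume "a < dim_row (complex_of_real (\<omega> Q) \<cdot>\<^sub>m fourier M f Q)" "b < dim_col (complex_of_real (\<omega> Q) \<cdot>\<^sub>m fourier M f Q)"
    then have ab: "a < d Q" "b < d Q" by (auto simp: fourier_def d_def)
    note ab' = ab[unfolded d_def]
    let ?q = "\<lambda>s. cnj (rep_of Q s $$ (a, b))"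
    define g where "g = (\<lambda>k s. L2_inner M (left_regular s (\<xi> k)) (\<eta> k))"
    have gb: "cmod (g k s) \<le> ?r k" for k s
      using L2_cauchy_schwarz[OF left_regular_L2[OF \<xi>L] \<eta>L, of s k k] nn[of k] left_regular_norm[OF \<xi>L] by (simp add: g_def)
    have qb: "cmod (?q s) \<le> 1" for s using unitary_rep_bound[OF unitary_rep_rep_of[OF Q] ab'] by simp
    have gqb: "cmod (g k s * ?q s) \<le> ?r k" for k s
    proof -
      have "0 \<le> ?r k" using r0[OF hI] by auto
      then have "cmod (g k s * ?q s) \<le> ?r k * 1"
        unfolding norm_mult by (rule mult_mono[OF gb qb]) (rule norm_ge_zero)
      then show ?thesis by simp
    qed
    have qc: "continuous_on UNIV ?q"
      by (intro continuous_on_cnj unitary_rep_continuous[OF unitary_rep_rep_of[OF Q] ab'])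
    have gi: "integrable M (\<lambda>s. g k s * ?q s)" for k
    proof (rule continuous_integrable, rule continuous_on_mult[OF _ qc])
      show "continuous_on UNIV (g k)"
        unfolding g_def using L2_translation_continuous[OF \<xi>L] \<eta>L by (auto simp: translation_continuous_def)
    qed
    \<comment> \<open>the coefficient of the summand with index \<open>(P, j)\<close>\<close>
    define e where "e = (\<lambda>(P, j). if P = Q then complex_of_real (\<omega> Q) * (y Q j a * x Q j b) else 0)"
    have gint: "(LINT s|M. g k s * ?q s) = (if k \<in> K then e (h k) else 0)" for k
    proof (cases "k \<in> K")
      case True
      obtain P j where Pj: "h k = (P, j)" "P \<in> dual_group" "j < d P" using hI[OF True] by (auto simp: I_def)
      have "g k s = ip (d P) (mv (d P) (ent (rep_of P s)) (\<lambda>l. c P * x P j l)) (\<lambda>l. c P * cnj (y P j l))" for s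
        unfolding g_def \<xi>_def \<eta>_def using True
        by (simp add: Pj(1) X_def Y_def left_regular_embed[OF Pj(2)] embed_inner[OF Pj(2)] d_def)
      then have "(LINT s|M. g k s * ?q s) = (if P = Q then (c P * x P j b) * cnj (c P * cnj (y P j a)) / of_nat (d P) else 0)"
        using coef_fourier[OF Pj(2) Q ab', of "\<lambda>l. c P * x P j l" "\<lambda>l. c P * cnj (y P j l)"] by (simp add: d_def)
      also have "\<dots> = e (P, j)"
      proof -
        have "(c P * x P j b) * cnj (c P * cnj (y P j a)) = (c P * cnj (c P)) * (y P j a * x P j b)" by (simp add: mult_ac)
        also have "\<dots> = of_nat (d P) * (complex_of_real (\<omega> P) * (y P j a * x P j b))"
          unfolding c2(2)[OF Pj(2)] by simp
        finally have eq: "(c P * x P j b) * cnj (c P * cnj (y P j a)) = of_nat (d P) * (complex_of_real (\<omega> P) * (y P j a * x P j b))" .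
        have "(of_nat (d P) :: complex) \<noteq> 0" using irr_dim_pos[OF Pj(2)] by (simp add: d_def)
        then show ?thesis unfolding eq by (cases "P = Q") (auto simp: e_def)
      qed
      finally show ?thesis using True Pj(1) by simp
    next
      case False
      then show ?thesis by (simp add: g_def \<xi>_def left_regular_def L2_inner_def)
    qed
    have rsm: "summable ?r" using rsums by (rule sums_summable)
    have "fourier M (\<lambda>s. normal_functional M \<xi> \<eta> (left_regular s)) Q $$ (a, b) = (LINT s|M. (\<Sum>k. g k s) * ?q s)"
      using ab by (simp add: fourier_def d_def normal_functional_def g_def)
    also have "\<dots> = (LINT s|M. (\<Sum>k. g k s * ?q s))"
    proof (intro Bochner_Integration.integral_cong refl)
      fix s
      have "summable (\<lambda>k. g k s)" using gb by (intro summable_comparison_test'[OF rsm]) simp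
      then show "(\<Sum>k. g k s) * ?q s = (\<Sum>k. g k s * ?q s)" by (rule suminf_mult2)
    qed
    also have "\<dots> = (\<Sum>k. LINT s|M. g k s * ?q s)"
    proof (rule integral_suminf[OF gi])
      have "summable (\<lambda>k. norm (g k s * ?q s))" for s
        using gqb by (intro summable_comparison_test'[OF rsm]) simp
      then show "AE s in M. summable (\<lambda>k. norm (g k s * ?q s))" by simp
      show "summable (\<lambda>k. LINT s|M. norm (g k s * ?q s))"
      proof (rule summable_comparison_test'[OF rsm])
        fix k
        have "(LINT s|M. norm (g k s * ?q s)) \<le> (LINT s|M. ?r k)"
          using gqb gi by (intro integral_mono integrable_norm) auto
        then have "(LINT s|M. norm (g k s * ?q s)) \<le> ?r k" by (simp add: prob_space)
        moreover have "0 \<le> (LINT s|M. norm (g k s * ?q s))" by simp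
        ultimately show "norm (LINT s|M. norm (g k s * ?q s)) \<le> ?r k" by simp
      qed
    qed
    also have "\<dots> = (\<Sum>k. if k \<in> K then e (h k) else 0)" by (simp only: gint)
    also have "\<dots> = (\<Sum>j<d Q. complex_of_real (\<omega> Q) * (y Q j a * x Q j b))"
    proof (rule sums_unique[symmetric], rule sums_of_has_sum[OF h])
      have "(e has_sum (\<Sum>i\<in>Pair Q ` {..<d Q}. e i)) (Pair Q ` {..<d Q})" by (rule has_sum_finite) simp
      also have "(\<Sum>i\<in>Pair Q ` {..<d Q}. e i) = (\<Sum>j<d Q. complex_of_real (\<omega> Q) * (y Q j a * x Q j b))"
        by (subst sum.reindex) (auto simp: inj_on_def e_def)
      finally have "(e has_sum (\<Sum>j<d Q. complex_of_real (\<omega> Q) * (y Q j a * x Q j b))) (Pair Q ` {..<d Q})" .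
      then show "(e has_sum (\<Sum>j<d Q. complex_of_real (\<omega> Q) * (y Q j a * x Q j b))) I"
        by (rule has_sum_cong_neutral[THEN iffD1, rotated -1]) (use Q in \<open>auto simp: I_def e_def\<close>)
      fix i assume i: "i \<in> I" "i \<notin> {i \<in> I. r i \<noteq> 0}"
      obtain P j where Pj: "i = (P, j)" "P \<in> dual_group" "j < d P" using i(1) by (auto simp: I_def)
      show "e i = 0"
      proof (cases "P = Q")
        case True
        have "r (P, j) = 0" using i Pj by auto
        then have "\<mu> P j = 0" using \<omega>[OF Pj(2)] irr_dim_pos[OF Pj(2)] by (simp add: r_def d_def)
        then have "(\<Sum>k<d P. (cmod (x P j k))\<^sup>2) = 0" using x2[OF Pj(3)] by simp
        then have "x P j b = 0" using ab(2) True by (simp add: sum_nonneg_eq_0_iff)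
        then show ?thesis using Pj True by (simp add: e_def)
      qed (simp add: e_def Pj)
    qed auto
    also have "\<dots> = complex_of_real (\<omega> Q) * fourier M f Q $$ (a, b)"
      unfolding F[OF ab] by (rule sum_distrib_left[symmetric])
    also have "\<dots> = (complex_of_real (\<omega> Q) \<cdot>\<^sub>m fourier M f Q) $$ (a, b)"
      using ab by (simp add: fourier_def d_def)
    finally show "fourier M (\<lambda>s. normal_functional M \<xi> \<eta> (left_regular s)) Q $$ (a, b) = (complex_of_real (\<omega> Q) \<cdot>\<^sub>m fourier M f Q) $$ (a, b)" .
  qed (auto simp: fourier_def)
  show thesis by (rule that[OF \<xi> \<eta> norm_sum four])
qed

lemma beurling_fourier_continuous: "f \<in> beurling_fourier M \<omega> \<Longrightarrow> continuous_on UNIV f"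
  by (simp add: beurling_fourier_def)

text \<open>The vectors that represent the image of \<open>f\<close> in the Fourier algebra bound its norm in \<open>M\<^sub>1(A(G, \<omega>))\<close>.  The
  scalar, which serves to normalize \<open>f\<close>, is absorbed into these vectors.\<close>

lemma beurling_mnorm_scale_le:
  assumes f: "f \<in> beurling_fourier M \<omega>" and \<omega>: "\<And>P. P \<in> dual_group \<Longrightarrow> 0 < \<omega> P"
  shows "beurling_mnorm M \<omega> 1 (\<lambda>_ _. (\<lambda>t. c * f t)) \<le> ennreal (cmod c * beurling_norm M \<omega> f)"
proof (rule weight_map_normal_functional[OF f \<omega>])
  fix \<xi> \<eta> assume \<xi>: "l2_sequence M \<xi>" and \<eta>: "l2_sequence M \<eta>"
    and n: "(\<Sum>k. L2_norm M (\<xi> k) * L2_norm M (\<eta> k)) = beurling_norm M \<omega> f"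
    and four: "\<And>P. P \<in> dual_group \<Longrightarrow> fourier M (\<lambda>s. normal_functional M \<xi> \<eta> (left_regular s)) P = complex_of_real (\<omega> P) \<cdot>\<^sub>m fourier M f P"
  define \<zeta> where "\<zeta> = (\<lambda>k t. c * \<xi> k t)"
  have \<xi>L: "\<xi> k \<in> L2 M" and \<eta>L: "\<eta> k \<in> L2 M" for k using \<xi> \<eta> by (auto simp: l2_sequence_def)
  have \<zeta>: "l2_sequence M \<zeta>"
    unfolding l2_sequence_def \<zeta>_def L2_norm_scale power_mult_distrib
    using \<xi> L2_scale by (auto simp: l2_sequence_def intro!: summable_mult)
  define \<phi> where "\<phi> = (\<lambda>s. normal_functional M \<xi> \<eta> (left_regular s))"
  have \<phi>c: "continuous_on UNIV \<phi>" unfolding \<phi>_def by (rule normal_functional_continuous[OF \<xi> \<eta>])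
  have \<zeta>\<phi>: "normal_functional M \<zeta> \<eta> (left_regular s) = c * \<phi> s" for s
  proof -
    have "L2_inner M (left_regular s (\<zeta> k)) (\<eta> k) = c * L2_inner M (left_regular s (\<xi> k)) (\<eta> k)" for k
      using L2_inner_lin[OF left_regular_L2[OF \<xi>L] left_regular_L2[OF \<xi>L] \<eta>L, of c s k 0 s k k]
      by (simp add: \<zeta>_def left_regular_def)
    then show ?thesis
      unfolding normal_functional_def \<phi>_def
      by (simp add: suminf_mult normal_functional_left_regular_summable[OF \<xi> \<eta>])
  qed
  have fc: "continuous_on UNIV f" by (rule beurling_fourier_continuous[OF f])
  have wm: "weight_map M \<omega> (\<lambda>t. c * f t) = (\<lambda>s. c * \<phi> s)"
  proof (rule weight_map_eqI)
    have "normal_functional M \<zeta> \<eta> \<in> normal_functionals M" using \<zeta> \<eta> normal_functionals_iff by blast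
    then show "(\<lambda>s. c * \<phi> s) \<in> fourier_algebra M"
      unfolding fourier_algebra_def \<zeta>\<phi>[symmetric] by blast
    fix P :: "('a \<Rightarrow> complex mat) set" assume P: "P \<in> dual_group"
    have "fourier M (\<lambda>s. c * \<phi> s + 0 * \<phi> s) P = c \<cdot>\<^sub>m fourier M \<phi> P + 0 \<cdot>\<^sub>m fourier M \<phi> P"
      by (rule fourier_lin[OF \<phi>c \<phi>c P])
    moreover have "fourier M (\<lambda>s. c * f s + 0 * f s) P = c \<cdot>\<^sub>m fourier M f P + 0 \<cdot>\<^sub>m fourier M f P"
      by (rule fourier_lin[OF fc fc P])
    moreover have "c \<cdot>\<^sub>m fourier M \<phi> P + 0 \<cdot>\<^sub>m fourier M \<phi> P = complex_of_real (\<omega> P) \<cdot>\<^sub>m (c \<cdot>\<^sub>m fourier M f P + 0 \<cdot>\<^sub>m fourier M f P)"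
      using four[OF P] fourier_carrier[of f P] unfolding \<phi>_def by (intro eq_matI) auto
    ultimately show "fourier M (\<lambda>s. c * \<phi> s) P = complex_of_real (\<omega> P) \<cdot>\<^sub>m fourier M (\<lambda>t. c * f t) P" by simp
  qed
  have "(\<Sum>k. L2_norm M (\<zeta> k) * L2_norm M (\<eta> k)) = cmod c * beurling_norm M \<omega> f"
    unfolding \<zeta>_def L2_norm_scale n[symmetric]
    by (simp add: mult.assoc suminf_mult l2_sequence_product_summable[OF \<xi> \<eta>])
  with fourier_mnorm_le[OF \<zeta> \<eta> \<zeta>\<phi>] show ?thesis
    unfolding beurling_mnorm_def wm by simp
qed

end

section \<open>Locally constant functions in the Beurling--Fourier algebra\<close>

text \<open>A square root of the zero matrix that is positive must vanish.\<close>

lemma trace_norm_zero: "trace_norm (0\<^sub>m d d) = 0"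
proof -
  let ?Z = "0\<^sub>m d d :: complex mat"
  have Z: "?Z \<in> carrier_mat d d" by simp
  have adj: "mat_adjoint ?Z = ?Z"
    using mat_adjoint_index[OF Z] mat_adjoint_carrier[OF Z] by (intro eq_matI) auto
  have "mat_abs ?Z = ?Z"
    unfolding mat_abs_def
  proof (rule the_equality)
    have "ip d (mv d (ent ?Z) x) x = 0" for x by (simp add: ip_def mv_def)
    then show "positive_semidef (dim_col ?Z) ?Z \<and> ?Z * ?Z = mat_adjoint ?Z * ?Z"
      unfolding adj by (simp add: positive_semidef_iff[OF Z])
  next
    fix P assume P: "positive_semidef (dim_col ?Z) P \<and> P * P = mat_adjoint ?Z * ?Z"
    have Pc: "P \<in> carrier_mat d d" using P by (simp add: positive_semidef_def)
    have PP: "P * P = ?Z" using P unfolding adj by simp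
    have psd: "positive_semidef d P" using P by simp
    note P1 = psd[unfolded positive_semidef_iff[OF Pc]]
    show "P = ?Z"
    proof (rule mat_eq_mv[OF Pc Z])
      fix x i assume i: "i < d"
      have sq: "mv d (ent P) (mv d (ent P) x) k = complex_of_real (0\<^sup>2) * x k" if "k < d" for k
        using mv_mult[OF Pc Pc that, of x] that unfolding PP by (simp add: mv_def)
      have "mv d (ent P) x i = complex_of_real 0 * x i"
        by (rule positive_sqrt_eigenvector[OF conjunct1[OF P1, rule_format] conjunct2[OF P1, rule_format] sq order_refl i])
      then show "mv d (ent P) x i = mv d (ent ?Z) x i" using i by (simp add: mv_def)
    qed
  qed
  then show ?thesis by (simp add: trace_norm_def)
qed

lemma trace_norm_nonneg:
  assumes "F \<in> carrier_mat d d" shows "0 \<le> trace_norm F"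
proof (rule trace_norm_factorization[OF assms])
  fix \<mu> :: "nat \<Rightarrow> real"
  assume "\<And>j. j < d \<Longrightarrow> 0 \<le> \<mu> j" "trace_norm F = (\<Sum>j<d. \<mu> j)"
  then show "0 \<le> trace_norm F" by (auto intro!: sum_nonneg)
qed

context profinite_group
begin

lemma beurling_norm_nonneg:
  assumes "\<And>P. P \<in> dual_group \<Longrightarrow> 0 < \<omega> P" shows "0 \<le> beurling_norm M \<omega> f"
  unfolding beurling_norm_def
proof (rule infsum_nonneg)
  fix P :: "('a \<Rightarrow> complex mat) set" assume "P \<in> dual_group"
  then show "0 \<le> real (irr_dim P) * \<omega> P * trace_norm (fourier M f P)"
    using assms[of P] trace_norm_nonneg[OF fourier_carrier[of f P]] by simp
qed

text \<open>Locally constant functions are trigonometric polynomials, so the sum defining the norm is finite.\<close>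

lemma locally_constant_beurling_fourier:
  assumes "locally_constant f" shows "f \<in> beurling_fourier M \<omega>"
proof -
  have "finite {P \<in> dual_group. fourier M f P \<noteq> 0\<^sub>m (irr_dim P) (irr_dim P)}"
    by (rule trig_fourier_finite[OF locally_constant_trig[OF compact_UNIV assms]])
  then have "finite {P \<in> dual_group. real (irr_dim P) * \<omega> P * trace_norm (fourier M f P) \<noteq> 0}"
    by (rule rev_finite_subset) (auto simp: trace_norm_zero)
  then have "(\<lambda>P. real (irr_dim P) * \<omega> P * trace_norm (fourier M f P)) summable_on dual_group"
    by (rule finite_nonzero_values_imp_summable_on)
  with locally_constant_continuous[OF assms] show ?thesis by (simp add: beurling_fourier_def)
qed

text \<open>A partial sum of the Fourier series of \<open>f\<close> is locally constant, and the norm of the rest is a tail of the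
  series that defines the norm of \<open>f\<close>.\<close>

lemma locally_constant_dense:
  assumes f: "f \<in> beurling_fourier M \<omega>" and e: "0 < e"
  obtains p where "locally_constant p" "(\<lambda>t. f t - p t) \<in> beurling_fourier M \<omega>" "beurling_norm M \<omega> (\<lambda>t. f t - p t) < e"
proof -
  let ?s = "\<lambda>f P. real (irr_dim P) * \<omega> P * trace_norm (fourier M f P)"
  have fc: "continuous_on UNIV f" by (rule beurling_fourier_continuous[OF f])
  have hs: "(?s f has_sum beurling_norm M \<omega> f) dual_group"
    unfolding beurling_norm_def using f by (simp add: beurling_fourier_def has_sum_infsum)
  obtain F where F: "finite F" "F \<subseteq> dual_group" "dist (sum (?s f) F) (beurling_norm M \<omega> f) \<le> e / 2"
    using has_sum_finite_approximation[OF hs half_gt_zero[OF e]] by blast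
  define p where "p = (\<lambda>t. \<Sum>P\<in>F. \<Sum>k<irr_dim P. \<Sum>l<irr_dim P.
      (of_nat (irr_dim P) * fourier M f P $$ (k, l)) * rep_of P t $$ (k, l))"
  have lcP: "locally_constant (\<lambda>t. c * rep_of P t $$ (k, l))" if "P \<in> F" for P k l c
    using unitary_rep_locally_constant[OF compact_UNIV totally_disconnected_UNIV unitary_rep_rep_of, of P k l] that F(2)
    by (intro locally_constant_binop[OF locally_constant_const, where h = "(*)"]) auto
  have lc: "locally_constant p"
    unfolding p_def by (intro locally_constant_sum lcP)
  have pc: "continuous_on UNIV p" by (rule locally_constant_continuous[OF lc])
  have fp: "fourier M p Q = (if Q \<in> F then fourier M f Q else 0\<^sub>m (irr_dim Q) (irr_dim Q))"
    if Q: "Q \<in> dual_group" for Q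
  proof (rule eq_matI)
    let ?R = "if Q \<in> F then fourier M f Q else 0\<^sub>m (irr_dim Q) (irr_dim Q)"
    fix a b assume "a < dim_row ?R" "b < dim_col ?R"
    then have ab: "a < irr_dim Q" "b < irr_dim Q" by (auto simp: fourier_def split: if_splits)
    have int: "integrable M (\<lambda>t. rep_of P t $$ (k, l) * cnj (rep_of Q t $$ (a, b)))"
      if "P \<in> F" "k < irr_dim P" "l < irr_dim P" for P k l
      using that F(2) by (intro coef_product_integrable[OF unitary_rep_rep_of unitary_rep_rep_of[OF Q] _ _ ab]) auto
    have val: "(LINT t|M. rep_of P t $$ (k, l) * cnj (rep_of Q t $$ (a, b))) = (if P = Q \<and> a = k \<and> b = l then 1 / of_nat (irr_dim Q) else 0)"
      if "P \<in> F" "k < irr_dim P" "l < irr_dim P" for P k l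
    proof -
      have PD: "P \<in> dual_group" using that(1) F(2) by blast
      have "(LINT t|M. rep_of P t $$ (k, l) * cnj (rep_of Q t $$ (a, b))) = fourier M (\<lambda>t. rep_of P t $$ (k, l)) Q $$ (a, b)"
        by (rule fourier_index[OF ab, symmetric])
      also have "\<dots> = (if Q = P \<and> a = k \<and> b = l then 1 / of_nat (irr_dim Q) else 0)"
        by (rule fourier_coef[OF Q PD that(2,3) ab])
      finally show ?thesis by (cases "P = Q") auto
    qed
    have "fourier M p Q $$ (a, b) = (LINT t|M. (\<Sum>P\<in>F. \<Sum>k<irr_dim P. \<Sum>l<irr_dim P.
      (of_nat (irr_dim P) * fourier M f P $$ (k, l)) * (rep_of P t $$ (k, l) * cnj (rep_of Q t $$ (a, b)))))"
      unfolding fourier_index[OF ab] p_def sum_distrib_right by (simp only: mult.assoc)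
    also have "\<dots> = (\<Sum>P\<in>F. \<Sum>k<irr_dim P. \<Sum>l<irr_dim P.
      (of_nat (irr_dim P) * fourier M f P $$ (k, l)) * (LINT t|M. rep_of P t $$ (k, l) * cnj (rep_of Q t $$ (a, b))))"
    proof (subst Bochner_Integration.integral_sum)
      show "integrable M (\<lambda>t. \<Sum>k<irr_dim P. \<Sum>l<irr_dim P.
        (of_nat (irr_dim P) * fourier M f P $$ (k, l)) * (rep_of P t $$ (k, l) * cnj (rep_of Q t $$ (a, b))))"
        if "P \<in> F" for P
        using int[OF that] by (intro Bochner_Integration.integrable_sum integrable_mult_right) auto
      show "(\<Sum>P\<in>F. LINT t|M. (\<Sum>k<irr_dim P. \<Sum>l<irr_dim P.
          (of_nat (irr_dim P) * fourier M f P $$ (k, l)) * (rep_of P t $$ (k, l) * cnj (rep_of Q t $$ (a, b)))))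
        = (\<Sum>P\<in>F. \<Sum>k<irr_dim P. \<Sum>l<irr_dim P.
          (of_nat (irr_dim P) * fourier M f P $$ (k, l)) * (LINT t|M. rep_of P t $$ (k, l) * cnj (rep_of Q t $$ (a, b))))"
        by (rule sum.cong[OF refl]) (rule integral_double_sum, rule int)
    qed
    also have "\<dots> = (\<Sum>P\<in>F. if P = Q then fourier M f Q $$ (a, b) else 0)"
    proof (rule sum.cong[OF refl])
      fix P assume P: "P \<in> F"
      show "(\<Sum>k<irr_dim P. \<Sum>l<irr_dim P.
        (of_nat (irr_dim P) * fourier M f P $$ (k, l)) * (LINT t|M. rep_of P t $$ (k, l) * cnj (rep_of Q t $$ (a, b))))
        = (if P = Q then fourier M f Q $$ (a, b) else 0)"
      proof (cases "P = Q")
        case True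
        have "(of_nat (irr_dim P) * fourier M f P $$ (k, l)) * (LINT t|M. rep_of P t $$ (k, l) * cnj (rep_of Q t $$ (a, b)))
            = (if k = a then if l = b then fourier M f Q $$ (a, b) else 0 else 0)"
          if "k < irr_dim P" "l < irr_dim P" for k l
          unfolding val[OF P that] using True irr_dim_pos[OF Q] by auto
        then have "(\<Sum>k<irr_dim P. \<Sum>l<irr_dim P.
        (of_nat (irr_dim P) * fourier M f P $$ (k, l)) * (LINT t|M. rep_of P t $$ (k, l) * cnj (rep_of Q t $$ (a, b))))
          = (\<Sum>k<irr_dim P. \<Sum>l<irr_dim P. if k = a then if l = b then fourier M f Q $$ (a, b) else 0 else 0)"
          by (intro sum.cong refl) auto
        also have "\<dots> = (\<Sum>k<irr_dim P. if k = a then fourier M f Q $$ (a, b) else 0)"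
          using ab True by (intro sum.cong refl) auto
        also have "\<dots> = fourier M f Q $$ (a, b)" using ab True by simp
        finally show ?thesis using True by simp
      qed (use val[OF P] in simp)
    qed
    also have "\<dots> = ?R $$ (a, b)" using F(1) ab by simp
    finally show "fourier M p Q $$ (a, b) = ?R $$ (a, b)" .
  qed (auto simp: fourier_def)
  have diff: "fourier M (\<lambda>t. f t - p t) Q = (if Q \<in> F then 0\<^sub>m (irr_dim Q) (irr_dim Q) else fourier M f Q)"
    if Q: "Q \<in> dual_group" for Q
  proof -
    have "fourier M (\<lambda>t. 1 * f t + (- 1) * p t) Q = 1 \<cdot>\<^sub>m fourier M f Q + (- 1) \<cdot>\<^sub>m fourier M p Q"
      by (rule fourier_lin[OF fc pc Q])
    also have "\<dots> = (if Q \<in> F then 0\<^sub>m (irr_dim Q) (irr_dim Q) else fourier M f Q)"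
      unfolding fp[OF Q] using fourier_carrier[of f Q] by (intro eq_matI) auto
    finally show ?thesis by simp
  qed
  have "(?s f has_sum (beurling_norm M \<omega> f - sum (?s f) F)) (dual_group - F)"
    using F(1,2) by (intro has_sum_Diff hs has_sum_finite) auto
  then have hs': "(?s (\<lambda>t. f t - p t) has_sum (beurling_norm M \<omega> f - sum (?s f) F)) dual_group"
    by (rule has_sum_cong_neutral[THEN iffD1, rotated -1]) (auto simp: diff trace_norm_zero)
  show thesis
  proof (rule that[OF lc])
    show "(\<lambda>t. f t - p t) \<in> beurling_fourier M \<omega>"
      unfolding beurling_fourier_def using hs' by (auto simp: summable_on_def intro!: continuous_on_diff fc pc)
    have "beurling_norm M \<omega> (\<lambda>t. f t - p t) = beurling_norm M \<omega> f - sum (?s f) F"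
      using infsumI[OF hs'] by (simp only: beurling_norm_def)
    then show "beurling_norm M \<omega> (\<lambda>t. f t - p t) < e"
      using F(3) e unfolding dist_real_def by linarith
  qed
qed

section \<open>Derivations\<close>

lemma dual_mnorm_lower:
  assumes "g \<in> A" "MN 1 (\<lambda>_ _. g) \<le> 1"
  shows "ennreal (cmod (\<psi> g)) \<le> dual_mnorm A MN 1 (\<lambda>_ _. \<psi>)"
proof -
  let ?v = "\<lambda>_ :: nat \<times> nat. 1 :: complex"
  have "ennreal (cmod (\<psi> g)) \<le> idx_opnorm ({..<1::nat} \<times> {..<1::nat}) (\<lambda>(i, p) (j, q). \<psi> g)"
    unfolding idx_opnorm_def sum_singleton_times by (rule SUP_upper2[of ?v]) auto
  also have "\<dots> \<le> dual_mnorm A MN 1 (\<lambda>_ _. \<psi>)"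
    unfolding dual_mnorm_def using assms by (intro SUP_upper2[of "(1, \<lambda>_ _. g)"]) auto
  finally show ?thesis .
qed

text \<open>For an idempotent \<open>e\<close> the derivation rule reads \<open>D(e)(g) = 2 D(e)(e g)\<close>.  For \<open>e g\<close> in place of \<open>g\<close> it gives
  \<open>D(e)(e g) = 0\<close>, and then \<open>D(e)(g) = 0\<close>.\<close>

lemma derivation_zero_locally_constant:
  assumes D: "derivation (beurling_fourier M \<omega>) (beurling_norm M \<omega>) D"
    and p: "locally_constant p" and h: "locally_constant h"
  shows "D p h = 0"
  using compact_UNIV p h
proof (induction p arbitrary: h rule: locally_constant_induct)
  case (indicator C)
  let ?e = "indicator C :: 'a \<Rightarrow> complex"
  have e: "locally_constant ?e" using indicator by (intro locally_constant_indicator)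
  have ee: "(\<lambda>x. ?e x * ?e x) = ?e" by (auto simp: indicator_def)
  have step: "D ?e g = 2 * D ?e (\<lambda>x. ?e x * g x)" if g: "locally_constant g" for g
  proof -
    have "D (\<lambda>x. ?e x * ?e x) g = left_action ?e (D ?e) g + right_action (D ?e) ?e g"
      using D locally_constant_beurling_fourier[OF e] locally_constant_beurling_fourier[OF g] unfolding derivation_def by blast
    then show ?thesis unfolding ee left_action_def right_action_def by (simp add: mult.commute)
  qed
  have eh: "locally_constant (\<lambda>x. ?e x * h x)" by (rule locally_constant_binop[OF e indicator(3)])
  have "(\<lambda>x. ?e x * (?e x * h x)) = (\<lambda>x. ?e x * h x)" by (auto simp: indicator_def)
  with step[OF eh] have "D ?e (\<lambda>x. ?e x * h x) = 0" by simp
  with step[OF indicator(3)] show ?case by simp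
next
  case (lin f g a b)
  have "D (\<lambda>x. a * f x + b * g x) h = a * D f h + b * D g h"
    using D lin locally_constant_beurling_fourier unfolding derivation_def by blast
  with lin show ?case by simp
qed

text \<open>Complete boundedness, applied to matrices of size one, bounds \<open>D(u)(g)\<close> by a multiple of the norm of \<open>u\<close> when
  \<open>g\<close> is small.  So \<open>D(f)(g) = 0\<close> for locally constant \<open>g\<close> follows by approximation of \<open>f\<close>, and the continuity of the
  functional \<open>D(f)\<close> extends this to all \<open>g\<close>.\<close>

lemma completely_bounded_derivation_zero:
  assumes \<omega>: "\<And>P. P \<in> dual_group \<Longrightarrow> 0 < \<omega> P"
    and D: "derivation (beurling_fourier M \<omega>) (beurling_norm M \<omega>) D"
    and cb: "completely_bounded (beurling_fourier M \<omega>) (beurling_mnorm M \<omega>)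
      (dual_mnorm (beurling_fourier M \<omega>) (beurling_mnorm M \<omega>)) D"
    and f: "f \<in> beurling_fourier M \<omega>" and h: "h \<in> beurling_fourier M \<omega>"
  shows "D f h = 0"
proof -
  let ?A = "beurling_fourier M \<omega>" and ?N = "beurling_norm M \<omega>"
  note lcA = locally_constant_beurling_fourier
  have Dlin: "D (\<lambda>x. a * u x + b * v x) w = a * D u w + b * D v w" if "u \<in> ?A" "v \<in> ?A" "w \<in> ?A" for u v w a b
    using D that unfolding derivation_def by blast
  have Ddual: "D u \<in> dual_space ?A ?N" if "u \<in> ?A" for u using D that unfolding derivation_def by blast
  have Dlin2: "D u (\<lambda>x. a * v x + b * w x) = a * D u v + b * D u w" if "u \<in> ?A" "v \<in> ?A" "w \<in> ?A" for u v w a b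
    using Ddual[OF that(1)] that(2,3) unfolding dual_space_def by blast
  have "\<exists>C::real. \<forall>n u. (\<forall>i<n. \<forall>j<n. u i j \<in> ?A) \<longrightarrow>
      dual_mnorm ?A (beurling_mnorm M \<omega>) n (\<lambda>i j. D (u i j)) \<le> ennreal C * beurling_mnorm M \<omega> n u"
    using cb unfolding completely_bounded_def .
  then obtain C :: real where C: "\<forall>n u. (\<forall>i<n. \<forall>j<n. u i j \<in> ?A) \<longrightarrow>
      dual_mnorm ?A (beurling_mnorm M \<omega>) n (\<lambda>i j. D (u i j)) \<le> ennreal C * beurling_mnorm M \<omega> n u" ..
  have bound: "cmod (D u g) \<le> \<bar>C\<bar> * ?N u" if u: "u \<in> ?A" and g: "g \<in> ?A" "beurling_mnorm M \<omega> 1 (\<lambda>_ _. g) \<le> 1" for u g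
  proof -
    have "ennreal (cmod (D u g)) \<le> dual_mnorm ?A (beurling_mnorm M \<omega>) 1 (\<lambda>_ _. D u)" by (rule dual_mnorm_lower[where MN = "beurling_mnorm M \<omega>" and \<psi> = "D u" and g = g, OF g])
    also have "\<dots> \<le> ennreal C * beurling_mnorm M \<omega> 1 (\<lambda>_ _. u)"
      using C[rule_format, of 1 "\<lambda>_ _. u"] u by simp
    also have "\<dots> \<le> ennreal \<bar>C\<bar> * ennreal (?N u)"
      using beurling_mnorm_scale_le[OF u \<omega>, of 1] by (intro mult_mono ennreal_leI) auto
    also have "\<dots> = ennreal (\<bar>C\<bar> * ?N u)" by (rule ennreal_mult'[symmetric]) simp
    finally have "ennreal (cmod (D u g)) \<le> ennreal (\<bar>C\<bar> * ?N u)" .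
    moreover have "0 \<le> \<bar>C\<bar> * ?N u" using beurling_norm_nonneg[OF \<omega>] by simp
    ultimately show ?thesis by (simp add: ennreal_le_iff)
  qed
  have small: "\<exists>c. c \<noteq> 0 \<and> beurling_mnorm M \<omega> 1 (\<lambda>_ _. (\<lambda>t. c * g t)) \<le> 1" if "g \<in> ?A" for g
  proof (intro exI conjI)
    define s where "s = 1 / (\<bar>?N g\<bar> + 1)"
    let ?c = "complex_of_real s"
    have s: "0 < s" by (simp add: s_def)
    then show "?c \<noteq> 0" by simp
    have "s * ?N g \<le> 1" unfolding s_def by (simp add: field_simps)
    with s have "cmod ?c * ?N g \<le> 1" by simp
    then show "beurling_mnorm M \<omega> 1 (\<lambda>_ _. (\<lambda>t. ?c * g t)) \<le> 1"
      using beurling_mnorm_scale_le[OF that \<omega>, of ?c] by (metis dual_order.trans ennreal_leI ennreal_1)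
  qed
  have lc: "D f g = 0" if g: "locally_constant g" for g
  proof -
    obtain c where c: "c \<noteq> 0" "beurling_mnorm M \<omega> 1 (\<lambda>_ _. (\<lambda>t. c * g t)) \<le> 1" using small[OF lcA[OF g]] by blast
    have cg: "locally_constant (\<lambda>t. c * g t)" by (rule locally_constant_binop[OF locally_constant_const g, where h="(*)"])
    have "cmod (D f (\<lambda>t. c * g t)) \<le> 0 + e" if e: "0 < e" for e
    proof -
      obtain p where p: "locally_constant p" "(\<lambda>t. f t - p t) \<in> ?A" "?N (\<lambda>t. f t - p t) < e / (\<bar>C\<bar> + 1)"
        by (rule locally_constant_dense[OF f, of "e / (\<bar>C\<bar> + 1)"]) (use e in \<open>auto simp: add_nonneg_pos\<close>)
      have "D (\<lambda>t. 1 * (f t - p t) + 1 * p t) (\<lambda>t. c * g t) = 1 * D (\<lambda>t. f t - p t) (\<lambda>t. c * g t) + 1 * D p (\<lambda>t. c * g t)"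
        by (rule Dlin[OF p(2) lcA[OF p(1)] lcA[OF cg]])
      then have "D f (\<lambda>t. c * g t) = D (\<lambda>t. f t - p t) (\<lambda>t. c * g t)"
        using derivation_zero_locally_constant[OF D p(1) cg] by simp
      then have "cmod (D f (\<lambda>t. c * g t)) \<le> \<bar>C\<bar> * ?N (\<lambda>t. f t - p t)"
        using bound[OF p(2) lcA[OF cg] c(2)] by simp
      also have "\<dots> \<le> \<bar>C\<bar> * (e / (\<bar>C\<bar> + 1))" using p(3) by (intro mult_left_mono) auto
      also have "\<dots> \<le> e" using e by (simp add: field_simps)
      finally show ?thesis by simp
    qed
    then have "cmod (D f (\<lambda>t. c * g t)) \<le> 0" by (rule field_le_epsilon)
    moreover have "D f (\<lambda>t. c * g t + 0 * g t) = c * D f g + 0 * D f g" by (rule Dlin2[OF f lcA[OF g] lcA[OF g]])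
    ultimately show ?thesis using c(1) by simp
  qed
  obtain B where B: "\<And>g. g \<in> ?A \<Longrightarrow> cmod (D f g) \<le> B * ?N g" using Ddual[OF f] unfolding dual_space_def by blast
  have "cmod (D f h) \<le> 0 + e" if e: "0 < e" for e
  proof -
    obtain q where q: "locally_constant q" "(\<lambda>t. h t - q t) \<in> ?A" "?N (\<lambda>t. h t - q t) < e / (\<bar>B\<bar> + 1)"
      by (rule locally_constant_dense[OF h, of "e / (\<bar>B\<bar> + 1)"]) (use e in \<open>auto simp: add_nonneg_pos\<close>)
    have "D f (\<lambda>t. 1 * (h t - q t) + 1 * q t) = 1 * D f (\<lambda>t. h t - q t) + 1 * D f q"
      by (rule Dlin2[OF f q(2) lcA[OF q(1)]])
    then have "D f h = D f (\<lambda>t. h t - q t)" using lc[OF q(1)] by simp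
    then have "cmod (D f h) \<le> B * ?N (\<lambda>t. h t - q t)" using B[OF q(2)] by simp
    also have "\<dots> \<le> \<bar>B\<bar> * ?N (\<lambda>t. h t - q t)" using beurling_norm_nonneg[OF \<omega>] by (intro mult_right_mono) auto
    also have "\<dots> \<le> \<bar>B\<bar> * (e / (\<bar>B\<bar> + 1))" using q(3) by (intro mult_left_mono) auto
    also have "\<dots> \<le> e" using e by (simp add: field_simps)
    finally show ?thesis by simp
  qed
  then have "cmod (D f h) \<le> 0" by (rule field_le_epsilon)
  then show ?thesis by simp
qed

end

theorem theorem3p14:
  fixes M :: "'a::{topological_group_add, t2_space} measure"
    and \<omega> :: "('a \<Rightarrow> complex mat) set \<Rightarrow> real"
  assumes "compact (UNIV :: 'a set)"
    and "totally_disconnected (UNIV :: 'a set)"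
    and "haar_probability M"
    and "central_weight \<omega>"
  shows "operator_weakly_amenable (beurling_fourier M \<omega>) (beurling_norm M \<omega>) (beurling_mnorm M \<omega>)"
proof -
  interpret profinite_group M using assms(1-3) by unfold_locales
  obtain \<delta> where "0 < \<delta>" "\<forall>P\<in>dual_group. \<delta> < \<omega> P" using assms(4) unfolding central_weight_def by blast
  then have pos: "0 < \<omega> P" if "P \<in> dual_group" for P using that by force
  show ?thesis
    unfolding operator_weakly_amenable_def
  proof (intro allI impI)
    fix D assume "derivation (beurling_fourier M \<omega>) (beurling_norm M \<omega>) D \<and>
      completely_bounded (beurling_fourier M \<omega>) (beurling_mnorm M \<omega>) (dual_mnorm (beurling_fourier M \<omega>) (beurling_mnorm M \<omega>)) D"
    then have zero: "D f h = 0" if "f \<in> beurling_fourier M \<omega>" "h \<in> beurling_fourier M \<omega>" for f h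
      using completely_bounded_derivation_zero[where \<omega> = \<omega>, OF pos] that by blast
    have "(\<lambda>_. 0) \<in> dual_space (beurling_fourier M \<omega>) (beurling_norm M \<omega>)"
      unfolding dual_space_def by (auto intro!: exI[of _ 0])
    then show "inner_derivation (beurling_fourier M \<omega>) (beurling_norm M \<omega>) D"
      unfolding inner_derivation_def using zero by (intro bexI[of _ "\<lambda>_. 0"]) (auto simp: left_action_def right_action_def)
  qed
qed

end
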